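(* Fix a positional scoring rule given by $\vec{\alpha}=(\alpha_0,\ldots,\alpha_m)$. There is a constant $d>0$ such that, with $\beta=d\sqrt{m\log m}$ and $g(\vec{\alpha})=\max_{i=0,\ldots,m-\beta}\lvert\alpha_{i+\beta}-\alpha_i\rvert$, there exists a randomized Monte Carlo algorithm for $\mathcal{R}_{\vec{\alpha}}$-WCM which, given $(\sigma_0,\ldots,\sigma_m)$ and weights $(w_1,\ldots,w_k)$, outputs a manipulation strategy $S$ such that $\max_{1\le i\le m}\mathrm{score}_S(c_i)\le T^*+W\cdot g(\vec{\alpha})$, where $W=\sum_{\ell=1}^k w_\ell$, except with a failure probability that is exponentially small in $m$.
   Context: Positional scoring rule $\mathcal{R}_{\vec{\alpha}}$: $\vec{\alpha}=(\alpha_0,\ldots,\alpha_m)$ with $0\le\alpha_0\le\cdots\le\alpha_m$ integers, $\alpha_m$ bounded by a polynomial in $m$. Candidates $p=c_0,c_1,\ldots,c_m$, $p$ preferred. Non-manipulator scores so far: arbitrary nonnegative integers $(\sigma_0,\ldots,\sigma_m)$. In $\mathcal{R}_{\vec{\alpha}}$-WCM (weighted coalitional manipulation) there are $k$ manipulators with positive integer weights $w_1,\ldots,w_k$; each manipulator $\ell$ assigns the scores $\alpha_0,\ldots,\alpha_m$ bijectively to the $m+1$ candidates, and a score $\alpha$ assigned by manipulator $\ell$ contributes $w_\ell\alpha$ to the candidate. A strategy $S$ is the collection of these $k$ assignments; $\mathrm{score}_S(c_i)=\sigma_i+\sum_\ell w_\ell\cdot(\text{score assigned to }c_i\text{ by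 }\ell)$. $T^*=\min_S\max_{1\le i\le m}\mathrm{score}_S(c_i)$. $\beta$ is treated as an integer (rounded). *)

theory Defs
  imports "HOL-Probability.Probability" "HOL-Library.Log_Nat"
    "HOL-Computational_Algebra.Polynomial"
begin

section \<open>Weighted coalitional manipulation for a positional scoring rule\<close>

text \<open>
  There are m + 1 candidates 0, ..., m; candidate 0 is the preferred one.  The scoring vector of an
  election with m + 1 candidates is \<open>a :: nat \<Rightarrow> nat\<close>, of which only \<open>a 0, ..., a m\<close> matter.
  The k manipulators are 0, ..., k - 1 and their weights form a list \<open>ws\<close> of length k.
  \<open>S l i\<close> is the index of the score that manipulator \<open>l\<close> assigns to candidate \<open>i\<close>, so that a
  bijection on the indices assigns every score (with multiplicity) exactly once.
\<close>

definition strategy :: "nat \<Rightarrow> nat \<Rightarrow> (nat \<Rightarrow> nat \<Rightarrow> nat) \<Rightarrow> bool" where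
  "strategy m k S \<longleftrightarrow> (\<forall>l<k. bij_betw (S l) {0..m} {0..m})"

definition score ::
  "(nat \<Rightarrow> nat) \<Rightarrow> (nat \<Rightarrow> nat) \<Rightarrow> nat list \<Rightarrow> (nat \<Rightarrow> nat \<Rightarrow> nat) \<Rightarrow> nat \<Rightarrow> nat" where
  "score a \<sigma> ws S i = \<sigma> i + (\<Sum>l<length ws. ws ! l * a (S l i))"

definition max_score ::
  "nat \<Rightarrow> (nat \<Rightarrow> nat) \<Rightarrow> (nat \<Rightarrow> nat) \<Rightarrow> nat list \<Rightarrow> (nat \<Rightarrow> nat \<Rightarrow> nat) \<Rightarrow> nat" where
  "max_score m a \<sigma> ws S = Max (score a \<sigma> ws S ` {1..m})"

text \<open>An infimum of a nonempty set of natural numbers, hence a minimum.\<close>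

definition T_opt :: "nat \<Rightarrow> (nat \<Rightarrow> nat) \<Rightarrow> (nat \<Rightarrow> nat) \<Rightarrow> nat list \<Rightarrow> nat" where
  "T_opt m a \<sigma> ws = (INF S \<in> {S. strategy m (length ws) S}. max_score m a \<sigma> ws S)"

definition beta :: "real \<Rightarrow> nat \<Rightarrow> nat" where
  "beta d m = nat \<lceil>d * sqrt (real m * ln (real m))\<rceil>"

text \<open>Meaningful only for \<open>b \<le> m\<close>: otherwise the index range i = 0, ..., m - b is empty.\<close>

definition gap :: "nat \<Rightarrow> (nat \<Rightarrow> nat) \<Rightarrow> nat \<Rightarrow> int" where
  "gap m a b = Max ((\<lambda>i. \<bar>int (a (i + b)) - int (a i)\<bar>) ` {0..m - b})"


section \<open>Randomized algorithms\<close>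

text \<open>
  Algorithms are programs of a random access machine with logarithmic cost: memory is an array of
  natural numbers with indirect addressing, and every operation is charged at least the bit length
  of the numbers involved, so that polynomial running time agrees with that of Turing machines.
  Randomness is a finite tape of fair coins, read by \<open>Flip\<close>; a run that exhausts its tape
  is stuck.
\<close>

type_synonym memory = "nat \<Rightarrow> nat"

abbreviation bits :: "nat \<Rightarrow> nat" where
  "bits n \<equiv> floorlog 2 n"

datatype expr =
    Lit nat
  | Cell expr
  | Add expr expr
  | Sub expr expr
  | Mul expr expr
  | Div expr expr

fun val :: "expr \<Rightarrow> memory \<Rightarrow> nat" where
  "val (Lit n) s = n"
| "val (Cell e) s = s (val e s)"
| "val (Add e f) s = val e s + val f s"
| "val (Sub e f) s = val e s - val f s"
| "val (Mul e f) s = val e s * val f s"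
| "val (Div e f) s = val e s div val f s"

fun cost :: "expr \<Rightarrow> memory \<Rightarrow> nat" where
  "cost (Lit n) s = 1 + bits n"
| "cost (Cell e) s = cost e s + 1 + bits (val (Cell e) s)"
| "cost (Add e f) s = cost e s + cost f s + 1 + bits (val (Add e f) s)"
| "cost (Sub e f) s = cost e s + cost f s + 1 + bits (val (Sub e f) s)"
| "cost (Mul e f) s = cost e s + cost f s + 1 + bits (val (Mul e f) s)"
| "cost (Div e f) s = cost e s + cost f s + 1 + bits (val (Div e f) s)"

text \<open>In \<open>Store e f\<close> and \<open>Flip e\<close>, the expression \<open>e\<close> denotes the address that is written.\<close>

datatype prog =
    Skip
  | Store expr expr
  | Flip expr
  | Seq prog prog
  | If expr prog prog
  | While expr prog

text \<open>
  \<open>run c (s, r) t (s', r')\<close>: started in memory \<open>s\<close> with coin tape \<open>r\<close>, program \<open>c\<close> halts after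
  time \<open>t\<close> with memory \<open>s'\<close> and remaining tape \<open>r'\<close>.
\<close>

inductive run :: "prog \<Rightarrow> memory \<times> bool list \<Rightarrow> nat \<Rightarrow> memory \<times> bool list \<Rightarrow> bool" where
  run_Skip: "run Skip (s, r) 1 (s, r)"
| run_Store: "run (Store e f) (s, r) (cost e s + cost f s + 1) (s(val e s := val f s), r)"
| run_Flip: "run (Flip e) (s, b # r) (cost e s + 1) (s(val e s := of_bool b), r)"
| run_Seq: "run c x t y \<Longrightarrow> run c' y t' z \<Longrightarrow> run (Seq c c') x (t + t') z"
| run_IfTrue: "val e s \<noteq> 0 \<Longrightarrow> run c (s, r) t y \<Longrightarrow> run (If e c c') (s, r) (cost e s + t) y"
| run_IfFalse: "val e s = 0 \<Longrightarrow> run c' (s, r) t y \<Longrightarrow> run (If e c c') (s, r) (cost e s + t) y"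
| run_WhileFalse: "val e s = 0 \<Longrightarrow> run (While e c) (s, r) (cost e s) (s, r)"
| run_WhileTrue: "val e s \<noteq> 0 \<Longrightarrow> run c (s, r) t y \<Longrightarrow> run (While e c) y t' z
    \<Longrightarrow> run (While e c) (s, r) (cost e s + t + t') z"

inductive_cases run_SkipE: "run Skip x t y"
inductive_cases run_StoreE: "run (Store e f) x t y"
inductive_cases run_FlipE: "run (Flip e) x t y"
inductive_cases run_SeqE: "run (Seq c c') x t y"
inductive_cases run_IfE: "run (If e c c') x t y"
inductive_cases run_WhileE: "run (While e c) x t y"

lemma run_deterministic:
  assumes "run c x t y" and "run c x t' y'"
  shows "t' = t \<and> y' = y"
  using assms
proof (induction arbitrary: t' y' rule: run.induct)
  case (run_Skip s r)
  then show ?case by (rule run_SkipE) simp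
next
  case (run_Store e f s r)
  then show ?case by (rule run_StoreE) simp
next
  case (run_Flip e s b r)
  then show ?case by (rule run_FlipE) simp
next
  case (run_Seq c x t y c' u z)
  from run_Seq.prems obtain t1 y1 t2 where
    1: "run c x t1 y1" and 2: "run c' y1 t2 y'" and "t' = t1 + t2"
    by (rule run_SeqE)
  with run_Seq.IH(1)[OF 1] run_Seq.IH(2)[of t2 y'] show ?case by simp
next
  case (run_IfTrue e s c r t y c')
  from run_IfTrue.prems show ?case
    by (rule run_IfE) (use run_IfTrue.hyps in \<open>auto dest: run_IfTrue.IH\<close>)
next
  case (run_IfFalse e s c' r t y c)
  from run_IfFalse.prems show ?case
    by (rule run_IfE) (use run_IfFalse.hyps in \<open>auto dest: run_IfFalse.IH\<close>)
next
  case (run_WhileFalse e s c r)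
  from run_WhileFalse.prems show ?case
    by (rule run_WhileE) (use run_WhileFalse.hyps in simp_all)
next
  case (run_WhileTrue e s c r t y u z)
  from run_WhileTrue.prems show ?case
  proof (rule run_WhileE)
    fix s1 r1 t1 y1 t2
    assume "(s, r) = (s1, r1)" and t': "t' = cost e s1 + t1 + t2"
      and 1: "run c (s1, r1) t1 y1" and 2: "run (While e c) y1 t2 y'"
    then have eq: "s1 = s" "r1 = r" by simp_all
    from 1 have "t1 = t \<and> y1 = y" unfolding eq by (rule run_WhileTrue.IH(1))
    with 2 t' eq run_WhileTrue.IH(2)[of t2 y'] show ?thesis by simp
  qed (use run_WhileTrue.hyps in simp)
qed

definition load :: "nat list \<Rightarrow> memory" where
  "load xs = (\<lambda>i. if i < length xs then xs ! i else 0)"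

definition input_size :: "nat list \<Rightarrow> nat" where
  "input_size xs = (\<Sum>x\<leftarrow>xs. bits x + 1)"

text \<open>
  The algorithm halts within time N for every outcome of its coins; N coins are enough because
  each \<open>Flip\<close> takes time at least one.
\<close>

definition halts_within :: "prog \<Rightarrow> nat list \<Rightarrow> nat \<Rightarrow> bool" where
  "halts_within c xs N \<longleftrightarrow>
     (\<forall>r. length r = N \<longrightarrow> (\<exists>t s r'. run c (load xs, r) t (s, r') \<and> t \<le> N))"

definition failure_prob :: "prog \<Rightarrow> nat list \<Rightarrow> nat \<Rightarrow> (memory \<Rightarrow> bool) \<Rightarrow> real" where
  "failure_prob c xs N good =
     measure_pmf.prob (pmf_of_set {r :: bool list. length r = N})
       {r. \<not> (\<exists>t s r'. run c (load xs, r) t (s, r') \<and> good s)}"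

definition encode_instance ::
  "nat \<Rightarrow> (nat \<Rightarrow> nat) \<Rightarrow> (nat \<Rightarrow> nat) \<Rightarrow> nat list \<Rightarrow> nat list" where
  "encode_instance m a \<sigma> ws =
     [m, length ws] @ map a [0..<m + 1] @ map \<sigma> [0..<m + 1] @ ws"

text \<open>The output is a matrix with one row per manipulator, stored row by row from address 0.\<close>

definition decode_strategy :: "nat \<Rightarrow> memory \<Rightarrow> nat \<Rightarrow> nat \<Rightarrow> nat" where
  "decode_strategy m s = (\<lambda>l i. s (l * (m + 1) + i))"

end

theory Submission
  imports Defs
begin

text \<open>
  The algorithm is deterministic and leaves its coins untouched.  For a bound \<open>T\<close> on the score, it
  looks for configurations \<open>C i l\<close> (the position that manipulator \<open>l\<close> assigns to candidate \<open>i\<close>) such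
  that each candidate alone respects \<open>T\<close> and no prefix of positions is overloaded by much: if
  manipulator \<open>l\<close> places at most \<open>t + 1 + b\<close> candidates on positions up to \<open>t\<close>, for every \<open>t\<close>, then
  sorting yields a permutation that moves nobody up by more than about \<open>b\<close> positions.  The overloads
  are controlled by an exponential potential, which local search decreases: the configuration
  of one candidate is replaced by a better one, found by dynamic programming over rounded prices.  At a
  local optimum, comparing each candidate with its configuration in an optimal strategy bounds the
  mean overload under the exponential weights by \<open>O(m / M)\<close>, where \<open>1 / M\<close> is of order
  \<open>sqrt (log m / m)\<close>, and convexity turns this into a bound on the potential.  The least \<open>T\<close> for which
  the potential is small is approximated by bisection.

  The number of manipulators may exceed every polynomial in \<open>m\<close>, so the potential cannot control all of
  them.  Its initial weights follow the weights of the manipulators, except that the \<open>m\<close> heaviest ones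
  are protected, so that the manipulators with a large overload are light in total.  This loss is compensated by
  exact treatment of one favoured candidate per manipulator, rotating in the order of the weights.
\<close>

section \<open>Bounded loop programs\<close>

text \<open>The order of \<open>1 / M\<close> balances two losses: the error \<open>m / M\<close> of
  the comparison at a local optimum, and the \<open>O(M * log m)\<close> further positions over
  which an exponential weight must fall by a factor polynomial in \<open>m\<close>. Both become
  \<open>O(sqrt (m * log m))\<close>, with constants that fit into the factor 30 of
  \<open>beta\<close>. A manipulator with too large an overload may move a candidate up through all
  positions, at a loss of up to \<open>m * g\<close> per unit of weight. Where a candidate is
  favoured it keeps its position, and the allowance \<open>g\<close> stays unspent. Hence it is
  enough that the failing weight is at most a fraction \<open>1 / m\<close> of the weight favouring
  any given candidate. Scores and weights are binary numbers, so a table indexed by loads would be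
  exponential; the dynamic program tabulates the least load for each rounded price instead.
  Polynomial time is obtained separately from correctness: the program is written in a language
  whose stored values and iteration counts are capped by its semantics. The time bound then holds
  whatever the program computes, and the invariants only have to show that the cap on values never
  takes effect.\<close>

type_synonym store = "nat \<Rightarrow> nat \<Rightarrow> nat"

datatype hexp =
    HN nat
  | HA nat hexp
  | HAdd hexp hexp (infixl "[+]" 65)
  | HSub hexp hexp (infixl "[-]" 65)
  | HMul hexp hexp (infixl "[*]" 70)
  | HDiv hexp hexp (infixl "[div]" 70)

primrec hval :: "hexp \<Rightarrow> store \<Rightarrow> nat" where
  "hval (HN n) h = n"
| "hval (HA A e) h = h A (hval e h)"
| "hval (e [+] f) h = hval e h + hval f h"
| "hval (e [-] f) h = hval e h - hval f h"
| "hval (e [*] f) h = hval e h * hval f h"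
| "hval (e [div] f) h = hval e h div hval f h"

datatype hprog =
    HSet nat hexp hexp
  | HSeq hprog hprog (infixr ";;" 60)
  | HIf hexp hprog hprog
  | HFor nat hexp hprog

definition upd :: "store \<Rightarrow> nat \<Rightarrow> nat \<Rightarrow> nat \<Rightarrow> store" where
  "upd h A i v = h(A := (h A)(i := v))"

lemma upd_apply: "upd h A i v A' i' = (if A' = A \<and> i' = i then v else h A' i')"
  by (simp add: upd_def)

lemma upd_other [simp]: "A' \<noteq> A \<Longrightarrow> upd h A i v A' = h A'"
  by (simp add: upd_def)

lemma upd_same [simp]: "upd h A i v A = (h A)(i := v)"
  by (simp add: upd_def)

text \<open>No run stores a value above \<open>cap\<close> or iterates a loop more than
  \<open>lm\<close> times, so compiled code has a time bound without any invariant. The bound of a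
  loop is evaluated once, on entry.\<close>

primrec sem :: "nat \<Rightarrow> nat \<Rightarrow> hprog \<Rightarrow> store \<Rightarrow> store" where
  "sem cap lm (HSet A e f) = (\<lambda>h. upd h A (hval e h) (min cap (hval f h)))"
| "sem cap lm (c ;; c') = (\<lambda>h. sem cap lm c' (sem cap lm c h))"
| "sem cap lm (HIf e c c') = (\<lambda>h. if hval e h \<noteq> 0 then sem cap lm c h else sem cap lm c' h)"
| "sem cap lm (HFor x e c) =
     (\<lambda>h. fold (\<lambda>i g. sem cap lm c (upd g x 0 i)) [0..<min lm (hval e h)] h)"

primrec mods :: "hprog \<Rightarrow> nat set" where
  "mods (HSet A e f) = {A}"
| "mods (c ;; c') = mods c \<union> mods c'"
| "mods (HIf e c c') = mods c \<union> mods c'"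
| "mods (HFor x e c) = insert x (mods c)"

lemma fold_upt_invariant:
  assumes "I 0 h" "\<And>i g. i < n \<Longrightarrow> I i g \<Longrightarrow> I (Suc i) (f i g)"
  shows "I n (fold f [0..<n] h)"
  using assms by (induction n) auto

lemma sem_frame: "A \<notin> mods c \<Longrightarrow> sem cap lm c h A = h A"
proof (induction c arbitrary: h)
  case (HFor x e c)
  show ?case unfolding sem.simps
    by (rule fold_upt_invariant[where I = "\<lambda>_ g. g A = h A"]) (use HFor in auto)
qed auto

text \<open>The step may use that all arrays outside the modified ones still have their contents
  from before the loop, which keeps read-only data out of the invariants.\<close>

lemma sem_for:
  fixes cap lm x e c h
  defines "n \<equiv> min lm (hval e h)"
  assumes "I 0 h"
    and "\<And>i g. i < n \<Longrightarrow> I i g \<Longrightarrow> (\<And>A. A \<notin> insert x (mods c) \<Longrightarrow> g A = h A) \<Longrightarrow>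
           I (Suc i) (sem cap lm c (upd g x 0 i))"
  shows "I n (sem cap lm (HFor x e c) h)"
proof -
  have "I n (sem cap lm (HFor x e c) h) \<and>
      (\<forall>A. A \<notin> insert x (mods c) \<longrightarrow> sem cap lm (HFor x e c) h A = h A)"
    unfolding sem.simps n_def[symmetric]
    by (rule fold_upt_invariant[where I = "\<lambda>i g. I i g \<and> (\<forall>A. A \<notin> insert x (mods c) \<longrightarrow> g A = h A)"])
      (use assms in \<open>auto simp: sem_frame\<close>)
  then show ?thesis ..
qed


section \<open>Compilation\<close>

text \<open>Arrays are interleaved: entry \<open>e\<close> of array \<open>A\<close> has offset
  \<open>A + 64 * e\<close> from the base address in cell 0. Thus 64 unbounded arrays coexist
  without any allocation.\<close>

abbreviation loc :: "nat \<Rightarrow> expr \<Rightarrow> expr" where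
  "loc A e \<equiv> Add (Cell (Lit 0)) (Add (Lit A) (Mul (Lit 64) e))"

text \<open>With truncated subtraction, \<open>f - (f - c)\<close> is the minimum of
  \<open>f\<close> and \<open>c\<close>.\<close>

abbreviation capped :: "nat \<Rightarrow> expr \<Rightarrow> expr" where
  "capped z f \<equiv> Sub f (Sub f (Cell (loc z (Lit 0))))"

primrec cexp :: "hexp \<Rightarrow> expr" where
  "cexp (HN n) = Lit n"
| "cexp (HA A e) = Cell (loc (A + 3) (cexp e))"
| "cexp (e [+] f) = Add (cexp e) (cexp f)"
| "cexp (e [-] f) = Sub (cexp e) (cexp f)"
| "cexp (e [*] f) = Mul (cexp e) (cexp f)"
| "cexp (e [div] f) = Div (cexp e) (cexp f)"

abbreviation stk :: "nat \<Rightarrow> expr" where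
  "stk j \<equiv> Cell (loc 2 (Lit j))"

text \<open>
  Array 0 holds the cap on stored values, array 1 the cap on the number of iterations, and array 2
  the counter and the bound of the loops, indexed by their nesting depth \<open>d\<close>.
\<close>

primrec compile :: "nat \<Rightarrow> hprog \<Rightarrow> prog" where
  "compile d (HSet A e f) = Store (loc (A + 3) (cexp e)) (capped 0 (cexp f))"
| "compile d (c ;; c') = Seq (compile d c) (compile d c')"
| "compile d (HIf e c c') = If (cexp e) (compile d c) (compile d c')"
| "compile d (HFor x e c) =
     Seq (Store (loc 2 (Lit (2 * d))) (Lit 0))
    (Seq (Store (loc 2 (Lit (2 * d + 1))) (capped 1 (cexp e)))
      (While (Sub (stk (2 * d + 1)) (stk (2 * d)))
        (Seq (Store (loc (x + 3) (Lit 0)) (stk (2 * d)))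
        (Seq (compile (Suc d) c)
          (Store (loc 2 (Lit (2 * d))) (Add (stk (2 * d)) (Lit 1)))))))"

text \<open>The bound 61 leaves room below 64 for the three arrays reserved by compiled
  code.\<close>

primrec wf_exp :: "hexp \<Rightarrow> bool" where
  "wf_exp (HN n) = True"
| "wf_exp (HA A e) = (A < 61 \<and> wf_exp e)"
| "wf_exp (e [+] f) = (wf_exp e \<and> wf_exp f)"
| "wf_exp (e [-] f) = (wf_exp e \<and> wf_exp f)"
| "wf_exp (e [*] f) = (wf_exp e \<and> wf_exp f)"
| "wf_exp (e [div] f) = (wf_exp e \<and> wf_exp f)"

primrec wf_prog :: "hprog \<Rightarrow> bool" where
  "wf_prog (HSet A e f) = (A < 61 \<and> wf_exp e \<and> wf_exp f)"
| "wf_prog (c ;; c') = (wf_prog c \<and> wf_prog c')"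
| "wf_prog (HIf e c c') = (wf_exp e \<and> wf_prog c \<and> wf_prog c')"
| "wf_prog (HFor x e c) = (x < 61 \<and> wf_exp e \<and> wf_prog c)"

definition represents :: "nat \<Rightarrow> nat \<Rightarrow> nat \<Rightarrow> store \<Rightarrow> memory \<Rightarrow> bool" where
  "represents B cap lm h s \<longleftrightarrow> B > 0 \<and> s 0 = B \<and> s B = cap \<and> s (Suc B) = lm \<and>
     (\<forall>A<61. \<forall>i. s (B + (A + 3 + 64 * i)) = h A i)"

lemma address_eq_iff:
  fixes A A' i i' :: nat
  assumes "A < 64" "A' < 64"
  shows "A + 64 * i = A' + 64 * i' \<longleftrightarrow> A = A' \<and> i = i'"
proof
  assume eq: "A + 64 * i = A' + 64 * i'"
  have "A = (A + 64 * i) mod 64" using assms by simp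
  also have "\<dots> = A'" unfolding eq using assms by simp
  finally show "A = A' \<and> i = i'" using eq by simp
qed simp

section \<open>Bit length and cost of expressions\<close>

primrec esize :: "expr \<Rightarrow> nat" where
  "esize (Lit n) = 1 + bits n"
| "esize (Cell e) = esize e + 1"
| "esize (Add e f) = esize e + esize f + 1"
| "esize (Sub e f) = esize e + esize f + 1"
| "esize (Mul e f) = esize e + esize f + 1"
| "esize (Div e f) = esize e + esize f + 1"

text \<open>Quadratic, because each of at most \<open>esize e\<close> nodes is charged for a value
  of at most \<open>L * esize e\<close> bits when all cells have at most \<open>L\<close>
  bits.\<close>

definition ecost :: "expr \<Rightarrow> nat" where
  "ecost e = 2 * (esize e)\<^sup>2"

lemma less_two_power_bits: "n < 2 ^ bits n"
  using floorlog_bounds[of n 2] by (cases "n = 0") auto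

lemma bits_leI: "n < 2 ^ L \<Longrightarrow> bits n \<le> L"
  by (rule floorlog_leI) auto

text \<open>Multiplication adds bit lengths and addition costs at most one carry, which the unit
  contributed by each node to \<open>esize\<close> pays for.\<close>

lemma val_less:
  assumes "\<And>x. s x < 2 ^ L" "L \<ge> 1"
  shows "val e s < 2 ^ (L * esize e)"
proof (induction e)
  case (Lit n)
  have "bits n \<le> L * (1 + bits n)" using assms(2) by (cases L) auto
  then have "(2::nat) ^ bits n \<le> 2 ^ (L * (1 + bits n))" by (intro power_increasing) auto
  with less_two_power_bits[of n] show ?case by (metis val.simps(1) esize.simps(1) less_le_trans)
next
  case (Cell e)
  have "(2::nat) ^ L \<le> 2 ^ (L * (esize e + 1))" by (intro power_increasing) auto
  with assms(1)[of "val e s"] show ?case by (metis val.simps(2) esize.simps(2) less_le_trans)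
next
  case (Add e f)
  let ?a = "L * esize e" and ?b = "L * esize f"
  have "val e s + val f s < 2 ^ ?a + 2 ^ ?b" using Add by simp
  also have "\<dots> \<le> 2 ^ (?a + ?b) + 2 ^ (?a + ?b)" by (intro add_mono power_increasing) auto
  also have "\<dots> = 2 ^ (?a + ?b + 1)" by simp
  also have "\<dots> \<le> 2 ^ (L * (esize e + esize f + 1))"
    using assms(2) by (intro power_increasing) (auto simp: algebra_simps)
  finally show ?case by simp
next
  case (Sub e f)
  have "(2::nat) ^ (L * esize e) \<le> 2 ^ (L * (esize e + esize f + 1))"
    by (intro power_increasing mult_left_mono) auto
  with Sub show ?case unfolding val.simps esize.simps by linarith
next
  case (Mul e f)
  have "val e s * val f s < 2 ^ (L * esize e) * 2 ^ (L * esize f)"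
    using Mul by (intro mult_strict_mono') auto
  also have "\<dots> = 2 ^ (L * esize e + L * esize f)" by (simp add: power_add)
  also have "\<dots> \<le> 2 ^ (L * (esize e + esize f + 1))"
    by (intro power_increasing) (auto simp: algebra_simps)
  finally show ?case by simp
next
  case (Div e f)
  have "(2::nat) ^ (L * esize e) \<le> 2 ^ (L * (esize e + esize f + 1))"
    by (intro power_increasing mult_left_mono) auto
  moreover have "val e s div val f s \<le> val e s" by simp
  ultimately show ?case using Div unfolding val.simps esize.simps by linarith
qed

lemma cost_le:
  assumes "\<And>x. s x < 2 ^ L" "L \<ge> 1"
  shows "cost e s \<le> L * ecost e"
proof -
  have b: "bits (val e s) \<le> L * esize e" for e
    by (rule bits_leI) (rule val_less[OF assms])
  \<comment> \<open>One induction step for all operators: in \<open>2 * (x + y + 1)^2\<close> the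
    terms beyond \<open>2 * x^2 + 2 * y^2\<close> cover the charge for the new value.\<close>
  have node: "C + D + 1 + b \<le> L * (2 * (x + y + 1)\<^sup>2)"
    if "C \<le> L * (2 * x\<^sup>2)" "D \<le> L * (2 * y\<^sup>2)" "b \<le> L * (x + y + 1)" for C D b x y
  proof -
    have "C + D + 1 + b \<le> L * (2 * x\<^sup>2) + L * (2 * y\<^sup>2) + L * 1 + L * (x + y + 1)"
      using that assms(2) by linarith
    also have "\<dots> = L * (2 * x\<^sup>2 + 2 * y\<^sup>2 + 1 + (x + y + 1))" by (simp add: algebra_simps)
    also have "\<dots> \<le> L * (2 * (x + y + 1)\<^sup>2)"
      by (intro mult_left_mono) (auto simp: power2_eq_square algebra_simps)
    finally show ?thesis .
  qed
  show ?thesis unfolding ecost_def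
  proof (induction e)
    case (Lit n)
    show ?case using b[of "Lit n"] assms(2) node[where x = 0 and y = "bits n" and C = 0 and D = 0 and b = "bits n"]
      by (cases L) auto
  next
    case (Cell e)
    from node[OF Cell, where D = 0 and y = 0] b[of "Cell e"] show ?case by simp
  next
    case (Add e f)
    from node[OF Add] b[of "Add e f"] show ?case by simp
  next
    case (Sub e f)
    from node[OF Sub] b[of "Sub e f"] show ?case by simp
  next
    case (Mul e f)
    from node[OF Mul] b[of "Mul e f"] show ?case by simp
  next
    case (Div e f)
    from node[OF Div] b[of "Div e f"] show ?case by simp
  qed
qed

section \<open>Simulation of bounded loop programs\<close>

lemma run_while_count:
  assumes "I 0 s"
    and step: "\<And>i s. i < n \<Longrightarrow> I i s \<Longrightarrow> \<exists>t s'. run c (s, r) t (s', r) \<and> I (Suc i) s' \<and> t \<le> T"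
    and guard: "\<And>i s. i \<le> n \<Longrightarrow> I i s \<Longrightarrow> (val e s \<noteq> 0 \<longleftrightarrow> i < n) \<and> cost e s \<le> G"
  shows "\<exists>t s'. run (While e c) (s, r) t (s', r) \<and> I n s' \<and> t \<le> (n + 1) * (T + G)"
proof -
  have "\<exists>t s'. run (While e c) (s, r) t (s', r) \<and> I n s' \<and> t \<le> (n - i + 1) * (T + G)"
    if "i \<le> n" "I i s" for i s
    using that
  proof (induction "n - i" arbitrary: i s)
    case 0
    then have "i = n" by simp
    with guard[of i s] 0 have "run (While e c) (s, r) (cost e s) (s, r)"
      by (intro run_WhileFalse) auto
    with 0 \<open>i = n\<close> guard[of i s] show ?case by (intro exI conjI) auto
  next
    case (Suc x)
    then have "i < n" by simp
    from step[OF this Suc(4)] obtain t1 s1 where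
      1: "run c (s, r) t1 (s1, r)" "I (Suc i) s1" "t1 \<le> T" by blast
    from Suc.hyps(1)[of "Suc i" s1] Suc 1 obtain t2 s2 where
      2: "run (While e c) (s1, r) t2 (s2, r)" "I n s2" "t2 \<le> (n - Suc i + 1) * (T + G)"
      by (metis Suc_diff_Suc Suc_leI Suc_inject \<open>i < n\<close>)
    have g: "val e s \<noteq> 0" "cost e s \<le> G" using guard[of i s] \<open>i < n\<close> Suc by auto
    have "run (While e c) (s, r) (cost e s + t1 + t2) (s2, r)"
      using run_WhileTrue[OF g(1) 1(1) 2(1)] .
    moreover have "cost e s + t1 + t2 \<le> (n - i + 1) * (T + G)"
    proof -
      have "n - i = Suc (n - Suc i)" using \<open>i < n\<close> by simp
      then have "(n - i + 1) * (T + G) = (n - Suc i + 1) * (T + G) + (T + G)"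
        by (simp add: algebra_simps)
      then show ?thesis using g 1 2 by linarith
    qed
    ultimately show ?case using 2 by blast
  qed
  from this[of 0 s] assms show ?thesis by auto
qed

lemma val_cexp:
  assumes "represents B cap lm h s" "wf_exp e"
  shows "val (cexp e) s = hval e h"
  using assms(2)
proof (induction e)
  case (HA A e)
  then show ?case using assms(1) by (simp add: represents_def)
qed auto

lemma represents_upd:
  assumes "represents B cap lm h s" "A < 61"
  shows "represents B cap lm (upd h A i v) (s(B + (A + 3 + 64 * i) := v))"
proof -
  have "A' + 3 + 64 * i' = A + 3 + 64 * i \<longleftrightarrow> A' = A \<and> i' = i" if "A' < 61" for A' i'
    using address_eq_iff[of "A' + 3" "A + 3" i' i] assms(2) that by simp
  with assms(1) show ?thesis unfolding represents_def by (simp add: upd_apply)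
qed

lemma represents_stk:
  assumes "represents B cap lm h s"
  shows "represents B cap lm h (s(B + (2 + 64 * i) := v))"
proof -
  have "A' + 3 + 64 * i' \<noteq> 2 + 64 * i" if "A' < 61" for A' i'
    using address_eq_iff[of "A' + 3" 2 i' i] that by simp
  with assms show ?thesis unfolding represents_def by simp
qed

text \<open>The time per bit of cell content: the bit length \<open>L\<close> of the cells enters
  the running time only as a factor in front of this number.\<close>

primrec hcost :: "nat \<Rightarrow> nat \<Rightarrow> hprog \<Rightarrow> nat" where
  "hcost lm d (HSet A e f) = ecost (loc (A + 3) (cexp e)) + ecost (capped 0 (cexp f)) + 1"
| "hcost lm d (c ;; c') = hcost lm d c + hcost lm d c'"
| "hcost lm d (HIf e c c') = ecost (cexp e) + hcost lm d c + hcost lm d c'"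
| "hcost lm d (HFor x e c) =
     (ecost (loc 2 (Lit (2 * d))) + ecost (Lit 0) + 1) +
     (ecost (loc 2 (Lit (2 * d + 1))) + ecost (capped 1 (cexp e)) + 1) +
     (lm + 1) *
       ((ecost (loc (x + 3) (Lit 0)) + ecost (stk (2 * d)) + 1) + hcost lm (Suc d) c +
        (ecost (loc 2 (Lit (2 * d))) + ecost (Add (stk (2 * d)) (Lit 1)) + 1) +
        ecost (Sub (stk (2 * d + 1)) (stk (2 * d))))"

lemma hcost_polynomial: "\<exists>K e. \<forall>lm. hcost lm d c \<le> K * (lm + 1) ^ e"
proof (induction c arbitrary: d)
  case (HSet A e f)
  have "hcost lm d (HSet A e f) \<le> hcost 0 d (HSet A e f) * (lm + 1) ^ 0" for lm by simp
  then show ?case by blast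
next
  case (HSeq c c')
  then obtain K e K' e' where
    "\<And>lm. hcost lm d c \<le> K * (lm + 1) ^ e" "\<And>lm. hcost lm d c' \<le> K' * (lm + 1) ^ e'"
    by metis
  then have *: "hcost lm d c \<le> K * (lm + 1) ^ e" "hcost lm d c' \<le> K' * (lm + 1) ^ e'" for lm
    by auto
  have "hcost lm d (c ;; c') \<le> (K + K') * (lm + 1) ^ (e + e')" for lm
  proof -
    have "(lm + 1) ^ e \<le> (lm + 1) ^ (e + e')" "(lm + 1) ^ e' \<le> (lm + 1) ^ (e + e')"
      by (intro power_increasing; simp)+
    then have "K * (lm + 1) ^ e + K' * (lm + 1) ^ e'
        \<le> K * (lm + 1) ^ (e + e') + K' * (lm + 1) ^ (e + e')"
      by (intro add_mono mult_left_mono) auto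
    with *[of lm] show ?thesis by (simp add: distrib_right)
  qed
  then show ?case by blast
next
  case (HIf x c c')
  then obtain K e K' e' where
    *: "\<And>lm. hcost lm d c \<le> K * (lm + 1) ^ e" "\<And>lm. hcost lm d c' \<le> K' * (lm + 1) ^ e'"
    by metis
  have "hcost lm d (HIf x c c') \<le> (ecost (cexp x) + K + K') * (lm + 1) ^ (e + e')" for lm
  proof -
    have "(lm + 1) ^ e \<le> (lm + 1) ^ (e + e')" "(lm + 1) ^ e' \<le> (lm + 1) ^ (e + e')"
      "1 \<le> (lm + 1) ^ (e + e')" by (intro power_increasing; simp)+ simp
    then have "ecost (cexp x) * 1 + K * (lm + 1) ^ e + K' * (lm + 1) ^ e'
        \<le> ecost (cexp x) * (lm + 1) ^ (e + e') + K * (lm + 1) ^ (e + e') + K' * (lm + 1) ^ (e + e')"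
      by (intro add_mono mult_left_mono) auto
    with *[of lm] show ?thesis by (simp add: distrib_right)
  qed
  then show ?case by blast
next
  case (HFor x e c)
  then obtain K n where *: "\<And>lm. hcost lm (Suc d) c \<le> K * (lm + 1) ^ n" by metis
  define k1 where "k1 = (ecost (loc 2 (Lit (2 * d))) + ecost (Lit 0) + 1) +
     (ecost (loc 2 (Lit (2 * d + 1))) + ecost (capped 1 (cexp e)) + 1)"
  define k2 where "k2 = (ecost (loc (x + 3) (Lit 0)) + ecost (stk (2 * d)) + 1) +
     (ecost (loc 2 (Lit (2 * d))) + ecost (Add (stk (2 * d)) (Lit 1)) + 1) +
        ecost (Sub (stk (2 * d + 1)) (stk (2 * d)))"
  have "hcost lm d (HFor x e c) \<le> (k1 + k2 + K) * (lm + 1) ^ Suc n" for lm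
  proof -
    have "hcost lm d (HFor x e c) = k1 + (lm + 1) * (k2 + hcost lm (Suc d) c)"
      by (simp add: k1_def k2_def)
    also have "\<dots> \<le> k1 * 1 + (lm + 1) * (k2 * 1 + K * (lm + 1) ^ n)"
      using * by (intro add_mono mult_left_mono) auto
    also have "\<dots> \<le> k1 * (lm + 1) ^ Suc n + (lm + 1) * (k2 * (lm + 1) ^ n + K * (lm + 1) ^ n)"
      by (intro add_mono mult_left_mono one_le_power) auto
    also have "\<dots> = (k1 + k2 + K) * (lm + 1) ^ Suc n" by (simp add: algebra_simps)
    finally show ?thesis .
  qed
  then show ?case by blast
qed

lemma run_Seq_bound:
  assumes "run c x t y" "run c' y t' z" "t \<le> T" "t' \<le> T'"
  shows "\<exists>u. run (Seq c c') x u z \<and> u \<le> T + T'"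
  using run_Seq[OF assms(1,2)] assms(3,4) by (intro exI[of _ "t + t'"]) auto

text \<open>Compiled code contains no \<open>Flip\<close>, hence the unchanged tape. That the stack
  entries below depth \<open>d\<close> survive is what lets an enclosing loop keep its counter and
  bound while its body, compiled at the next depth, runs.\<close>

theorem comp_correct:
  assumes "wf_prog c" "represents B cap lm h s" "\<And>x. s x \<le> cap" "lm \<le> cap"
    and "cap < 2 ^ L" "L \<ge> 1"
  shows "\<exists>t s'. run (compile d c) (s, r) t (s', r) \<and> represents B cap lm (sem cap lm c h) s' \<and>
           (\<forall>x. s' x \<le> cap) \<and> (\<forall>j<2 * d. s' (B + (2 + 64 * j)) = s (B + (2 + 64 * j))) \<and>
           t \<le> L * hcost lm d c"
proof -
  have cst: "cost e s \<le> L * ecost e" if "\<And>x. s x \<le> cap" for e s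
    by (rule cost_le) (use that assms(5,6) le_less_trans in blast)+
  have store: "\<exists>t. run (Store e f) (s, r) t (s(val e s := val f s), r) \<and> t \<le> L * (ecost e + ecost f + 1)"
    if "\<And>x. s x \<le> cap" for e f s
  proof -
    have "cost e s + cost f s + 1 \<le> L * ecost e + L * ecost f + L * 1"
      using cst[OF that] assms(6) by (intro add_mono) auto
    then show ?thesis
      using run_Store[of e f s r] by (intro exI[of _ "cost e s + cost f s + 1"]) (auto simp: algebra_simps)
  qed
  show ?thesis using assms(1,2,3)
  proof (induction c arbitrary: h s d)
    case (HSet A e f)
    let ?s = "s(B + (A + 3 + 64 * hval e h) := min cap (hval f h))"
    from HSet have vals: "val (loc (A + 3) (cexp e)) s = B + (A + 3 + 64 * hval e h)"
        "val (capped 0 (cexp f)) s = min cap (hval f h)"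
      by (auto simp: val_cexp represents_def)
    have "represents B cap lm (sem cap lm (HSet A e f) h) ?s"
      using represents_upd[OF HSet(2), of A] HSet(1) by simp
    moreover have "\<forall>x. ?s x \<le> cap" using HSet(3) by simp
    moreover have "\<forall>j<2 * d. ?s (B + (2 + 64 * j)) = s (B + (2 + 64 * j))"
      using address_eq_iff[of 2 "A + 3"] HSet(1) by auto
    moreover obtain t where "run (compile d (HSet A e f)) (s, r) t (?s, r)"
        "t \<le> L * hcost lm d (HSet A e f)"
      using store[where s = s and e = "loc (A + 3) (cexp e)" and f = "capped 0 (cexp f)", OF HSet(3)]
      unfolding vals by auto
    ultimately show ?case by blast
  next
    case (HSeq c c')
    from HSeq.IH(1)[of h s d] HSeq.prems obtain t1 s1 where
      1: "run (compile d c) (s, r) t1 (s1, r)" "represents B cap lm (sem cap lm c h) s1"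
        "\<And>x. s1 x \<le> cap" "\<forall>j<2 * d. s1 (B + (2 + 64 * j)) = s (B + (2 + 64 * j))"
        "t1 \<le> L * hcost lm d c" by auto
    from HSeq.IH(2)[OF _ 1(2,3), of d] HSeq.prems obtain t2 s2 where
      2: "run (compile d c') (s1, r) t2 (s2, r)"
        "represents B cap lm (sem cap lm c' (sem cap lm c h)) s2"
        "\<And>x. s2 x \<le> cap" "\<forall>j<2 * d. s2 (B + (2 + 64 * j)) = s1 (B + (2 + 64 * j))"
        "t2 \<le> L * hcost lm d c'" by auto
    from run_Seq[OF 1(1) 2(1)] 1 2 show ?case
      by (intro exI[of _ "t1 + t2"] exI[of _ s2]) (auto simp: algebra_simps)
  next
    case (HIf e c c')
    have v: "val (cexp e) s = hval e h" using HIf.prems by (simp add: val_cexp)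
    have ce: "cost (cexp e) s \<le> L * ecost (cexp e)" using cst[OF HIf.prems(3)] .
    show ?case
    proof (cases "hval e h = 0")
      case False
      from HIf.IH(1)[of h s d] HIf.prems obtain t1 s1 where
        1: "run (compile d c) (s, r) t1 (s1, r)" "represents B cap lm (sem cap lm c h) s1"
          "\<And>x. s1 x \<le> cap" "\<forall>j<2 * d. s1 (B + (2 + 64 * j)) = s (B + (2 + 64 * j))"
          "t1 \<le> L * hcost lm d c" by auto
      from run_IfTrue[OF _ 1(1)] v False 1 ce show ?thesis
        by (intro exI[of _ "cost (cexp e) s + t1"] exI[of _ s1]) (auto simp: algebra_simps)
    next
      case True
      from HIf.IH(2)[of h s d] HIf.prems obtain t1 s1 where
        1: "run (compile d c') (s, r) t1 (s1, r)" "represents B cap lm (sem cap lm c' h) s1"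
          "\<And>x. s1 x \<le> cap" "\<forall>j<2 * d. s1 (B + (2 + 64 * j)) = s (B + (2 + 64 * j))"
          "t1 \<le> L * hcost lm d c'" by auto
      from run_IfFalse[OF _ 1(1)] v True 1 ce show ?thesis
        by (intro exI[of _ "cost (cexp e) s + t1"] exI[of _ s1]) (auto simp: algebra_simps)
    qed
  next
    case (HFor x e c)
    define n where "n = min lm (hval e h)"
    let ?S = "\<lambda>j. B + (2 + 64 * j)"
    define T1 where "T1 = ecost (loc 2 (Lit (2 * d))) + ecost (Lit 0) + 1"
    define T2 where "T2 = ecost (loc 2 (Lit (2 * d + 1))) + ecost (capped 1 (cexp e)) + 1"
    define T3 where "T3 = ecost (loc (x + 3) (Lit 0)) + ecost (stk (2 * d)) + 1"
    define T4 where "T4 = ecost (loc 2 (Lit (2 * d))) + ecost (Add (stk (2 * d)) (Lit 1)) + 1"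
    define G where "G = ecost (Sub (stk (2 * d + 1)) (stk (2 * d)))"
    define H where "H i = fold (\<lambda>i g. sem cap lm c (upd g x 0 i)) [0..<i] h" for i
    define I where "I i s' \<longleftrightarrow> represents B cap lm (H i) s' \<and> (\<forall>y. s' y \<le> cap) \<and>
        (\<forall>j<2 * d. s' (?S j) = s (?S j)) \<and> s' (?S (2 * d)) = i \<and> s' (?S (2 * d + 1)) = n" for i s'
    have nle: "n \<le> cap" using assms(4) by (simp add: n_def)
    let ?s1 = "s(?S (2 * d) := 0)"
    let ?s2 = "?s1(?S (2 * d + 1) := n)"
    from HFor.prems have s0: "s 0 = B" by (simp add: represents_def)
    have 1: "\<exists>t. run (Store (loc 2 (Lit (2 * d))) (Lit 0)) (s, r) t (?s1, r) \<and> t \<le> L * T1"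
      using store[where s = s and e = "loc 2 (Lit (2 * d))" and f = "Lit 0", OF HFor.prems(3)] s0 by (simp add: T1_def)
    have r1: "represents B cap lm h ?s1" using represents_stk[OF HFor.prems(2)] .
    have b1: "\<And>y. ?s1 y \<le> cap" using HFor.prems(3) by simp
    have "val (capped 1 (cexp e)) ?s1 = n" "val (loc 2 (Lit (2 * d + 1))) ?s1 = ?S (2 * d + 1)"
      using val_cexp[OF r1, of e] r1 HFor.prems(1) by (auto simp: n_def represents_def)
    then have 2: "\<exists>t. run (Store (loc 2 (Lit (2 * d + 1))) (capped 1 (cexp e))) (?s1, r) t (?s2, r) \<and> t \<le> L * T2"
      using store[where s = "?s1" and e = "loc 2 (Lit (2 * d + 1))" and f = "capped 1 (cexp e)", OF b1] unfolding T2_def by metis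
    have w1: "I 0 ?s2"
      using represents_stk[OF r1, of "2 * d + 1" n] HFor.prems(3) nle
      by (auto simp: I_def H_def)
    have w2: "\<exists>t s''. run (Seq (Store (loc (x + 3) (Lit 0)) (stk (2 * d)))
        (Seq (compile (Suc d) c) (Store (loc 2 (Lit (2 * d))) (Add (stk (2 * d)) (Lit 1))))) (s', r) t (s'', r)
        \<and> I (Suc i) s'' \<and> t \<le> L * (T3 + hcost lm (Suc d) c + T4)" if i: "i < n" and I: "I i s'" for i s'
    proof -
      from I have rep: "represents B cap lm (H i) s'" and bd: "\<And>y. s' y \<le> cap"
        and fr: "\<forall>j<2 * d. s' (?S j) = s (?S j)"
        and ctr: "s' (?S (2 * d)) = i" "s' (?S (2 * d + 1)) = n" by (auto simp: I_def)
      let ?a = "s'(B + (x + 3 + 64 * 0) := i)"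
      have s0: "s' 0 = B" using rep by (simp add: represents_def)
      have a: "\<exists>t. run (Store (loc (x + 3) (Lit 0)) (stk (2 * d))) (s', r) t (?a, r) \<and> t \<le> L * T3"
        using store[where s = "s'" and e = "loc (x + 3) (Lit 0)" and f = "stk (2 * d)", OF bd] s0 ctr by (simp add: T3_def)
      have ra: "represents B cap lm (upd (H i) x 0 i) ?a"
        using represents_upd[OF rep, of x 0 i] HFor.prems(1) by simp
      have ba: "\<And>y. ?a y \<le> cap" using bd i nle by simp
      have "wf_prog c" using HFor.prems(1) by simp
      from HFor.IH[OF this ra ba, of "Suc d"] obtain t b where
        b: "run (compile (Suc d) c) (?a, r) t (b, r)"
          "represents B cap lm (sem cap lm c (upd (H i) x 0 i)) b" "\<And>y. b y \<le> cap"
          "\<forall>j<2 * Suc d. b (?S j) = ?a (?S j)" "t \<le> L * hcost lm (Suc d) c" by blast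
      have aS: "?a (?S j) = s' (?S j)" for j
        using address_eq_iff[of 2 "x + 3" j 0] HFor.prems(1) by auto
      have b0: "b 0 = B" using b by (simp add: represents_def)
      have bS: "b (?S j) = s' (?S j)" if "j < 2 * Suc d" for j
        using b(4) aS[of j] that by metis
      have bc: "b (?S (2 * d)) = i" "b (?S (2 * d + 1)) = n"
        using bS[of "2 * d"] bS[of "2 * d + 1"] ctr by auto
      let ?c = "b(?S (2 * d) := i + 1)"
      have c: "\<exists>t. run (Store (loc 2 (Lit (2 * d))) (Add (stk (2 * d)) (Lit 1))) (b, r) t (?c, r) \<and> t \<le> L * T4"
        using store[where s = b and e = "loc 2 (Lit (2 * d))" and f = "Add (stk (2 * d)) (Lit 1)", OF b(3)] b0 bc
        by (simp add: T4_def)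
      have HS: "H (Suc i) = sem cap lm c (upd (H i) x 0 i)" by (simp add: H_def)
      have "I (Suc i) ?c" unfolding I_def HS
        using represents_stk[OF b(2), of "2 * d" "i + 1"] b(3) bc bS fr i nle by auto
      moreover obtain u where "run (Seq (Store (loc (x + 3) (Lit 0)) (stk (2 * d)))
        (Seq (compile (Suc d) c) (Store (loc 2 (Lit (2 * d))) (Add (stk (2 * d)) (Lit 1))))) (s', r) u (?c, r)"
        "u \<le> L * T3 + (L * hcost lm (Suc d) c + L * T4)"
        using a b(1,5) c by (meson run_Seq_bound)
      ultimately show ?thesis by (intro exI[of _ u] exI[of _ ?c]) (auto simp: algebra_simps)
    qed
    have w3: "(val (Sub (stk (2 * d + 1)) (stk (2 * d))) s' \<noteq> 0 \<longleftrightarrow> i < n) \<and>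
        cost (Sub (stk (2 * d + 1)) (stk (2 * d))) s' \<le> L * G" if "i \<le> n" and I: "I i s'" for i s'
      unfolding G_def
      using I that(1) by (intro conjI cst) (auto simp: I_def represents_def)
    from w1 w2 w3 have "\<exists>t s'. run (While (Sub (stk (2 * d + 1)) (stk (2 * d)))
        (Seq (Store (loc (x + 3) (Lit 0)) (stk (2 * d)))
        (Seq (compile (Suc d) c) (Store (loc 2 (Lit (2 * d))) (Add (stk (2 * d)) (Lit 1)))))) (?s2, r) t (s', r)
       \<and> I n s' \<and> t \<le> (n + 1) * (L * (T3 + hcost lm (Suc d) c + T4) + L * G)"
      by (rule run_while_count[where I = I])
    then obtain t s' where 3: "run (While (Sub (stk (2 * d + 1)) (stk (2 * d)))
        (Seq (Store (loc (x + 3) (Lit 0)) (stk (2 * d)))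
        (Seq (compile (Suc d) c) (Store (loc 2 (Lit (2 * d))) (Add (stk (2 * d)) (Lit 1)))))) (?s2, r) t (s', r)"
      "I n s'" and t: "t \<le> (n + 1) * (L * (T3 + hcost lm (Suc d) c + T4) + L * G)" by blast
    have "t \<le> (lm + 1) * (L * (T3 + hcost lm (Suc d) c + T4) + L * G)"
      using t by (rule order_trans) (auto intro!: mult_right_mono simp: n_def)
    with 1 2 3 obtain u where "run (compile d (HFor x e c)) (s, r) u (s', r)"
      "u \<le> L * T1 + (L * T2 + (lm + 1) * (L * (T3 + hcost lm (Suc d) c + T4) + L * G))"
      unfolding compile.simps by (meson run_Seq_bound)
    moreover have "L * T1 + (L * T2 + (lm + 1) * (L * (T3 + hcost lm (Suc d) c + T4) + L * G))
        = L * hcost lm d (HFor x e c)"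
      unfolding hcost.simps T1_def[symmetric] T2_def[symmetric] T3_def[symmetric] T4_def[symmetric]
        G_def[symmetric] by (simp add: algebra_simps)
    moreover have "sem cap lm (HFor x e c) h = H n" by (simp add: H_def n_def)
    ultimately show ?case using 3(2) unfolding I_def by auto
  qed
qed


section \<open>Local search\<close>

text \<open>This is \<open>(1 + 1 / M) ^ e\<close>, scaled by \<open>M ^ (3 * m + 3)\<close> to an
  integer. The scale covers all exponents that occur: up to \<open>2 * m\<close> in the potential,
  \<open>m + 4 + m div M\<close> in \<open>target\<close>, and \<open>m + 1 + b\<close> in the tail
  bound.\<close>

definition pw :: "nat \<Rightarrow> nat \<Rightarrow> nat \<Rightarrow> nat" where
  "pw m M e = (M + 1) ^ e * M ^ (3 * m + 3 - e)"

lemma pw_Suc: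
  assumes "e < 3 * m + 3"
  shows "M * pw m M (Suc e) = (M + 1) * pw m M e"
proof -
  have "M ^ (3 * m + 3 - e) = M * M ^ (3 * m + 3 - Suc e)"
    using assms by (metis Suc_diff_Suc power_Suc)
  moreover have "(M + 1) ^ Suc e = (M + 1) * (M + 1) ^ e" by simp
  ultimately show ?thesis unfolding pw_def by (simp only: mult.assoc mult.left_commute)
qed

lemma pw_mono:
  assumes "e \<le> e'" "e' \<le> 3 * m + 3"
  shows "pw m M e \<le> pw m M e'"
proof -
  have "M ^ (3 * m + 3 - e) = M ^ (e' - e) * M ^ (3 * m + 3 - e')"
    using assms by (simp flip: power_add)
  also have "\<dots> \<le> (M + 1) ^ (e' - e) * M ^ (3 * m + 3 - e')"
    by (intro mult_right_mono power_mono) auto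
  finally have "pw m M e \<le> (M + 1) ^ e * ((M + 1) ^ (e' - e) * M ^ (3 * m + 3 - e'))"
    unfolding pw_def by (intro mult_left_mono) auto
  also have "\<dots> = pw m M e'" using assms by (simp add: pw_def mult.assoc flip: power_add)
  finally show ?thesis .
qed

lemma pw_real:
  assumes "e \<le> 3 * m + 3" "M \<ge> 1"
  shows "real (pw m M e) = real M ^ (3 * m + 3) * (1 + 1 / real M) ^ e"
proof -
  have "real M ^ (3 * m + 3) = real M ^ (3 * m + 3 - e) * real M ^ e"
    using assms(1) by (simp flip: power_add)
  moreover have "real M ^ e * (1 + 1 / real M) ^ e = (real M + 1) ^ e"
    using assms(2) by (simp add: field_simps flip: power_mult_distrib)
  ultimately show ?thesis by (simp add: pw_def mult.assoc) (simp add: algebra_simps)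
qed

text \<open>The tangent of an exponential function lies below its graph.\<close>

lemma pw_tangent:
  assumes "y \<le> 3 * m + 3" "z \<le> 3 * m + 3" "M \<ge> 1"
  shows "real (pw m M y) + real (pw m M y) * (real z - real y) * ln (1 + 1 / real M) \<le> real (pw m M z)"
proof -
  define b where "b = 1 + 1 / real M"
  have b: "b > 1" using assms(3) by (simp add: b_def)
  have "b ^ y * (1 + (real z - real y) * ln b) \<le> b ^ y * exp ((real z - real y) * ln b)"
    using b exp_ge_add_one_self[of "(real z - real y) * ln b"] by (intro mult_left_mono) auto
  also have "exp ((real z - real y) * ln b) = b ^ z / b ^ y"
  proof -
    have "exp ((real z - real y) * ln b) = exp (real z * ln b) / exp (real y * ln b)"
      by (simp add: left_diff_distrib exp_diff)
    then show ?thesis using b by (simp add: exp_of_nat_mult)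
  qed
  also have "b ^ y * (b ^ z / b ^ y) = b ^ z" using b by simp
  finally have "real M ^ (3 * m + 3) * (b ^ y * (1 + (real z - real y) * ln b))
      \<le> real M ^ (3 * m + 3) * b ^ z" by (intro mult_left_mono) auto
  then show ?thesis
    using assms by (simp add: pw_real b_def algebra_simps)
qed

section \<open>Potential, prices and local optima\<close>

locale search =
  fixes m k M :: nat and p :: "nat \<Rightarrow> nat"
  assumes m: "m \<ge> 1" and M: "M \<ge> 1"
begin

definition used :: "(nat \<Rightarrow> nat \<Rightarrow> nat) \<Rightarrow> nat \<Rightarrow> nat \<Rightarrow> nat" where
  "used C l t = (\<Sum>i\<in>{1..m}. of_bool (C i l \<le> t))"

text \<open>The prices offered to a candidate must not depend on its own present position; removing
  its own contribution achieves this.\<close>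

definition others :: "(nat \<Rightarrow> nat \<Rightarrow> nat) \<Rightarrow> nat \<Rightarrow> nat \<Rightarrow> nat \<Rightarrow> nat" where
  "others C i l t = used C l t - of_bool (C i l \<le> t)"

text \<open>The exponent measures by how much the other candidates overfill the positions up to
  \<open>t\<close>, shifted by \<open>m\<close> so that it stays a natural number.\<close>

definition phi :: "(nat \<Rightarrow> nat \<Rightarrow> nat) \<Rightarrow> nat \<Rightarrow> nat \<Rightarrow> nat \<Rightarrow> nat" where
  "phi C i l t = p l * pw m M (others C i l t + m - t)"

text \<open>A candidate at position \<open>j\<close> is counted for every threshold
  \<open>t >= j\<close>. The sum is \<open>M\<close> times the resulting increase of the
  potential.\<close>

definition price :: "(nat \<Rightarrow> nat \<Rightarrow> nat) \<Rightarrow> nat \<Rightarrow> nat \<Rightarrow> nat \<Rightarrow> nat" where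
  "price C i l j = (\<Sum>t\<in>{j..m}. phi C i l t)"

definition total :: "(nat \<Rightarrow> nat \<Rightarrow> nat) \<Rightarrow> nat \<Rightarrow> nat" where
  "total C i = (\<Sum>l<k. price C i l 0)"

definition expense :: "(nat \<Rightarrow> nat \<Rightarrow> nat) \<Rightarrow> nat \<Rightarrow> (nat \<Rightarrow> nat) \<Rightarrow> nat" where
  "expense C i c = (\<Sum>l<k. price C i l (c l))"

definition Psi :: "(nat \<Rightarrow> nat \<Rightarrow> nat) \<Rightarrow> nat" where
  "Psi C = (\<Sum>l<k. \<Sum>t\<le>m. p l * pw m M (used C l t + m - t))"

text \<open>The potential in the case that every exponent equals \<open>m + 4 + m div M\<close>,
  which will bound the weighted mean of the exponents at a local optimum.\<close>

definition target :: nat where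
  "target = (\<Sum>l<k. p l) * (m + 1) * pw m M (m + 4 + m div M)"

lemma used_le: "used C l t \<le> m"
proof -
  have "used C l t \<le> (\<Sum>i\<in>{1..m}. 1)" unfolding used_def by (intro sum_mono) auto
  then show ?thesis by simp
qed

lemma used_split:
  assumes "i \<in> {1..m}"
  shows "used C l t = (\<Sum>i'\<in>{1..m} - {i}. of_bool (C i' l \<le> t)) + of_bool (C i l \<le> t)"
  unfolding used_def using assms by (subst sum.remove[of _ i]) auto

lemma others_eq:
  assumes "i \<in> {1..m}"
  shows "others C i l t = (\<Sum>i'\<in>{1..m} - {i}. of_bool (C i' l \<le> t))"
  unfolding others_def used_split[OF assms] by simp

lemma used_others:
  assumes "i \<in> {1..m}"
  shows "used C l t = others C i l t + of_bool (C i l \<le> t)"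
  unfolding others_eq[OF assms] by (rule used_split[OF assms])

lemma others_update:
  assumes "i \<in> {1..m}"
  shows "others (C(i := nc)) i l t = others C i l t"
  unfolding others_eq[OF assms] by (intro sum.cong) auto

lemma phi_scaled:
  assumes "i \<in> {1..m}" "t \<le> m"
  shows "M * (p l * pw m M (used C l t + m - t)) = (M + of_bool (C i l \<le> t)) * phi C i l t"
proof (cases "C i l \<le> t")
  case True
  have "used C l t + m - t = Suc (others C i l t + m - t)"
    using used_others[OF assms(1), of C l t] True assms(2) by simp
  moreover have "others C i l t + m - t < 3 * m + 3" using used_le[of C l t] by (simp add: others_def)
  ultimately have "M * pw m M (used C l t + m - t) = (M + 1) * pw m M (others C i l t + m - t)"
    using pw_Suc by simp
  then have "p l * (M * pw m M (used C l t + m - t)) = p l * ((M + 1) * pw m M (others C i l t + m - t))"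
    by simp
  then show ?thesis using True by (simp only: phi_def mult.left_commute of_bool_eq)
next
  case False
  then show ?thesis by (simp add: phi_def others_def)
qed

lemma phi_le:
  assumes "i \<in> {1..m}" "t \<le> m"
  shows "phi C i l t \<le> p l * pw m M (used C l t + m - t)"
proof -
  have "M * phi C i l t \<le> M * (p l * pw m M (used C l t + m - t))"
    unfolding phi_scaled[OF assms] by simp
  then show ?thesis using M by simp
qed

lemma price_eq: "price C i l j = (\<Sum>t\<le>m. of_bool (j \<le> t) * phi C i l t)"
proof -
  have "price C i l j = (\<Sum>t\<in>{t \<in> {..m}. j \<le> t}. phi C i l t)"
    unfolding price_def by (intro sum.cong) auto
  also have "\<dots> = (\<Sum>t\<le>m. if j \<le> t then phi C i l t else 0)"
    by (rule sum.inter_filter) simp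
  also have "\<dots> = (\<Sum>t\<le>m. of_bool (j \<le> t) * phi C i l t)" by (intro sum.cong) auto
  finally show ?thesis .
qed

lemma price_le_0: "price C i l j \<le> price C i l 0"
  unfolding price_eq by (intro sum_mono) auto

lemma expense_le_total: "expense C i c \<le> total C i"
  unfolding expense_def total_def by (intro sum_mono price_le_0)

text \<open>Counting \<open>i\<close> for a threshold multiplies the term by
  \<open>1 + 1 / M\<close>. So with the other candidates fixed, the potential is an affine function
  of the expense of \<open>i\<close>; the factor \<open>M\<close> keeps the identity in the
  integers.\<close>

lemma Psi_split:
  assumes "i \<in> {1..m}"
  shows "M * Psi C = M * total C i + expense C i (C i)"
proof -
  have "M * Psi C = (\<Sum>l<k. \<Sum>t\<le>m. M * (p l * pw m M (used C l t + m - t)))"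
    unfolding Psi_def sum_distrib_left ..
  also have "\<dots> = (\<Sum>l<k. \<Sum>t\<le>m. M * phi C i l t + of_bool (C i l \<le> t) * phi C i l t)"
    using assms by (intro sum.cong refl) (auto simp: phi_scaled distrib_right)
  also have "\<dots> = M * total C i + expense C i (C i)"
    unfolding total_def expense_def price_eq by (simp add: sum.distrib sum_distrib_left)
  finally show ?thesis .
qed

lemma total_le_Psi: "i \<in> {1..m} \<Longrightarrow> total C i \<le> Psi C"
proof -
  assume "i \<in> {1..m}"
  then have "M * total C i \<le> M * Psi C" using Psi_split by simp
  then show ?thesis using M by simp
qed

definition rate :: real where "rate = 1 - 1 / (2 * real m * real M)"

text \<open>The potential falls by the gain divided by \<open>M\<close>, and the gain exceeds
  \<open>total / m\<close>. Since an expense is at most \<open>total\<close>, the potential is at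
  most \<open>2 * total\<close>, which gives the relative decrease
  \<open>1 / (2 * m * M)\<close>.\<close>

lemma Psi_decrease:
  assumes i: "i \<in> {1..m}" and gain: "total C i < (expense C i (C i) - expense C i nc) * m"
  shows "real (Psi (C(i := nc))) \<le> rate * real (Psi C)"
proof -
  let ?D = "C(i := nc)"
  have same: "total ?D i = total C i" "expense ?D i (?D i) = expense C i nc"
    unfolding total_def expense_def price_def phi_def others_update[OF i] by auto
  have 1: "M * Psi C = M * total C i + expense C i (C i)" "M * Psi ?D = M * total C i + expense C i nc"
    using Psi_split[OF i] same by metis+
  have le: "expense C i nc \<le> expense C i (C i)" 
  proof (rule ccontr)
    assume "\<not> expense C i nc \<le> expense C i (C i)"
    then show False using gain by simp
  qed
  have "1 * expense C i (C i) \<le> M * total C i"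
    using expense_le_total[of C i "C i"] M by (intro mult_mono) auto
  then have 2: "M * Psi C \<le> 2 * (M * total C i)" using 1 by simp
  have "M * Psi C \<le> M * (2 * total C i)" using 2 by (simp only: mult.left_commute)
  then have "Psi C \<le> 2 * total C i" using M by simp
  also have "2 * total C i \<le> 2 * ((expense C i (C i) - expense C i nc) * m)" using gain by simp
  finally have "real (Psi C) \<le> real (2 * ((expense C i (C i) - expense C i nc) * m))"
    by (simp only: of_nat_le_iff)
  also have "\<dots> = 2 * ((real (expense C i (C i)) - real (expense C i nc)) * real m)"
    by (simp add: of_nat_diff[OF le])
  also have "real (expense C i (C i)) - real (expense C i nc) = real M * real (Psi C) - real M * real (Psi ?D)"
    unfolding of_nat_mult[symmetric] 1 by simp
  finally have "real (Psi C) \<le> 2 * real m * real M * (real (Psi C) - real (Psi ?D))"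
    by (simp only: right_diff_distrib mult.assoc mult.commute mult.left_commute)
  moreover have "real m > 0" "real M > 0" using m M by auto
  ultimately have "real (Psi C) / (2 * real m * real M) \<le> real (Psi C) - real (Psi ?D)"
    by (simp add: divide_le_eq mult.commute)
  then show ?thesis by (simp add: rate_def algebra_simps)
qed

lemma rate_bounds: "0 \<le> rate" "rate < 1"
proof -
  have "1 * 1 \<le> real m * real M" using m M by (intro mult_mono) auto
  then show "0 \<le> rate" "rate < 1" unfolding rate_def by (auto simp: field_simps)
qed

text \<open>For the same manipulator and threshold, the exponents of two configurations differ by at
  most \<open>2 * m\<close>.\<close>

lemma Psi_ratio:
  "real (Psi C) \<le> (1 + 1 / real M) ^ (2 * m) * real (Psi D)"
proof -
  have "real (p l * pw m M (used C l t + m - t))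
      \<le> (1 + 1 / real M) ^ (2 * m) * real (p l * pw m M (used D l t + m - t))" if "t \<le> m" for l t
  proof -
    have u: "used C l t \<le> m" "used D l t \<le> m" by (rule used_le)+
    have "real (pw m M (used C l t + m - t)) = real M ^ (3 * m + 3) * (1 + 1 / real M) ^ (used C l t + m - t)"
      using u M by (intro pw_real) auto
    also have "\<dots> \<le> real M ^ (3 * m + 3) * (1 + 1 / real M) ^ (2 * m + (used D l t + m - t))"
      using u M that by (intro mult_left_mono power_increasing) auto
    also have "\<dots> = (1 + 1 / real M) ^ (2 * m) * real (pw m M (used D l t + m - t))"
      using u M by (subst pw_real) (auto simp: power_add)
    finally have "real (p l) * real (pw m M (used C l t + m - t))
        \<le> real (p l) * ((1 + 1 / real M) ^ (2 * m) * real (pw m M (used D l t + m - t)))"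
      by (intro mult_left_mono) auto
    then show ?thesis by (simp add: algebra_simps)
  qed
  then show ?thesis unfolding Psi_def of_nat_sum sum_distrib_left by (intro sum_mono) auto
qed

text \<open>After \<open>n\<close> improvements the potential has shrunk by
  \<open>exp (- n / (2 * m * M))\<close>, whereas its whole range spans a factor of at most
  \<open>exp (2 * m / M)\<close>. So \<open>n <= 4 * m^2\<close> unless the potential vanishes;
  neither \<open>k\<close> nor the weights enter.\<close>

lemma few_improvements:
  assumes "real (Psi D) \<le> rate ^ n * real (Psi C)" "n > 4 * m ^ 2"
  shows "Psi D = 0"
proof (rule ccontr)
  assume "Psi D \<noteq> 0"
  then have pos: "real (Psi D) > 0" by simp
  have mM: "real m > 0" "real M > 0" using m M by auto
  define x where "x = 1 / (2 * real m * real M)"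
  have x: "x > 0" using mM by (simp add: x_def)
  have "rate \<le> exp (- x)" using exp_ge_add_one_self[of "- x"] by (simp add: rate_def x_def)
  then have "rate ^ n \<le> exp (- x) ^ n" using rate_bounds by (intro power_mono) auto
  also have "\<dots> = exp (- (x * n))" by (simp add: exp_of_nat_mult[symmetric] mult.commute)
  finally have r: "rate ^ n \<le> exp (- (x * n))" .
  have "(1 + 1 / real M) ^ (2 * m) \<le> exp (1 / real M) ^ (2 * m)"
    using mM by (intro power_mono) (auto intro: order_trans)
  also have "\<dots> = exp (2 * m / real M)" by (simp add: exp_of_nat_mult[symmetric])
  finally have s: "(1 + 1 / real M) ^ (2 * m) \<le> exp (2 * m / real M)" .
  have "real (Psi D) \<le> rate ^ n * ((1 + 1 / real M) ^ (2 * m) * real (Psi D))"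
    using assms(1) Psi_ratio[of C D] rate_bounds by (meson mult_left_mono order_trans zero_le_power)
  also have "\<dots> \<le> exp (- (x * n)) * (exp (2 * m / real M) * real (Psi D))"
    using r s rate_bounds mM by (intro mult_mono) auto
  also have "\<dots> = exp (2 * m / real M - x * n) * real (Psi D)" by (simp flip: exp_add)
  finally have "1 \<le> exp (2 * m / real M - x * n)" using pos by simp
  then have "x * n \<le> 2 * m / real M" by simp
  then have "real n \<le> 4 * real m ^ 2"
    using mM by (simp add: x_def field_simps power2_eq_square)
  with assms(2) show False by (metis of_nat_le_iff of_nat_mult of_nat_numeral of_nat_power not_less)
qed

text \<open>\<open>D\<close> stands for an optimal strategy. Adding the optimality conditions over
  all candidates turns expenses into prefix counts of \<open>C\<close> and of \<open>D\<close>, both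
  averaged with the same exponential weights, those of the potential of \<open>C\<close>.\<close>

lemma local_optimum:
  assumes opt: "\<And>i. i \<in> {1..m} \<Longrightarrow> m * expense C i (C i) \<le> m * expense C i (D i) + 2 * total C i"
    and D: "\<And>l t. l < k \<Longrightarrow> t \<le> m \<Longrightarrow> used D l t \<le> t + 1"
  shows "Psi C \<le> target"
proof -
  define f where "f l t = p l * pw m M (used C l t + m - t)" for l t
  have Psi: "Psi C = (\<Sum>l<k. \<Sum>t\<le>m. f l t)" by (simp add: Psi_def f_def)
  define U where "U = (\<Sum>l<k. \<Sum>t\<le>m. used C l t * f l t)"
  define V where "V = (\<Sum>l<k. \<Sum>t\<le>m. (t + 1) * f l t)"
  define q where "q = m div M"
  have "m * (\<Sum>i\<in>{1..m}. expense C i (C i)) \<le> m * (\<Sum>i\<in>{1..m}. expense C i (D i)) + (\<Sum>i\<in>{1..m}. 2 * total C i)"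
    unfolding sum_distrib_left sum.distrib[symmetric] using opt by (intro sum_mono) auto
  also have "(\<Sum>i\<in>{1..m}. 2 * total C i) \<le> (\<Sum>i\<in>{1..m}. 2 * Psi C)"
    using total_le_Psi by (intro sum_mono) auto
  also have "\<dots> = m * (2 * Psi C)" by simp
  finally have "m * (\<Sum>i\<in>{1..m}. expense C i (C i)) \<le> m * ((\<Sum>i\<in>{1..m}. expense C i (D i)) + 2 * Psi C)"
    by (simp add: algebra_simps)
  then have 1: "(\<Sum>i\<in>{1..m}. expense C i (C i)) \<le> (\<Sum>i\<in>{1..m}. expense C i (D i)) + 2 * Psi C"
    using m by simp
  have swap: "(\<Sum>i\<in>{1..m}. \<Sum>l<k. \<Sum>t\<le>m. g i l t) = (\<Sum>l<k. \<Sum>t\<le>m. \<Sum>i\<in>{1..m}. g i l t)" for g :: "nat \<Rightarrow> nat \<Rightarrow> nat \<Rightarrow> nat"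
  proof -
    have "(\<Sum>i\<in>{1..m}. \<Sum>l<k. \<Sum>t\<le>m. g i l t) = (\<Sum>l<k. \<Sum>i\<in>{1..m}. \<Sum>t\<le>m. g i l t)" by (rule sum.swap)
    also have "\<dots> = (\<Sum>l<k. \<Sum>t\<le>m. \<Sum>i\<in>{1..m}. g i l t)" by (intro sum.cong refl sum.swap)
    finally show ?thesis .
  qed
  have "(\<Sum>i\<in>{1..m}. expense C i (D i)) \<le> (\<Sum>i\<in>{1..m}. \<Sum>l<k. \<Sum>t\<le>m. of_bool (D i l \<le> t) * f l t)"
    unfolding expense_def price_eq f_def by (intro sum_mono mult_left_mono phi_le) auto
  also have "\<dots> = (\<Sum>l<k. \<Sum>t\<le>m. used D l t * f l t)"
    unfolding swap used_def sum_distrib_right ..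
  also have "\<dots> \<le> V" unfolding V_def using D by (intro sum_mono mult_right_mono) auto
  finally have 2: "(\<Sum>i\<in>{1..m}. expense C i (D i)) \<le> V" .
  \<comment> \<open>Here the correction is exact: the price of a counted candidate omits its own
    factor \<open>(M + 1) / M\<close>, which is present in \<open>f\<close>.\<close>
  have "(M + 1) * (\<Sum>i\<in>{1..m}. expense C i (C i))
      = (\<Sum>i\<in>{1..m}. \<Sum>l<k. \<Sum>t\<le>m. of_bool (C i l \<le> t) * (M * f l t))"
    unfolding expense_def price_eq f_def sum_distrib_left
    by (intro sum.cong refl) (auto simp: phi_scaled)
  also have "\<dots> = M * U"
    unfolding swap U_def used_def sum_distrib_left sum_distrib_right
    by (intro sum.cong refl) (simp add: algebra_simps)
  finally have 3: "(M + 1) * (\<Sum>i\<in>{1..m}. expense C i (C i)) = M * U" .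
  have "M * U \<le> (M + 1) * (V + 2 * Psi C)"
    unfolding 3[symmetric] using 1 2 by (intro mult_left_mono) auto
  \<comment> \<open>One more \<open>U\<close> is needed to complete the coefficient \<open>M\<close>
    to \<open>M + 1\<close>. The crude bound \<open>m * Psi C\<close> for it is the origin of
    \<open>m div M\<close> in \<open>target\<close>.\<close>
  moreover have "U \<le> m * Psi C"
    unfolding U_def Psi sum_distrib_left using used_le by (intro sum_mono mult_right_mono) auto
  moreover have "m * Psi C \<le> (M + 1) * (q + 1) * Psi C"
  proof (rule mult_right_mono)
    have "m = M * q + m mod M" by (simp add: q_def)
    moreover have "m mod M < M" using M by simp
    ultimately have "m \<le> M * q + M" by linarith
    then show "m \<le> (M + 1) * (q + 1)" by (simp add: algebra_simps)
  qed simp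
  ultimately have "(M + 1) * U \<le> (M + 1) * (V + 2 * Psi C) + (M + 1) * (q + 1) * Psi C"
    by (simp add: distrib_right)
  also have "\<dots> = (M + 1) * (V + (q + 3) * Psi C)" by (simp add: algebra_simps)
  finally have "(M + 1) * U \<le> (M + 1) * (V + (q + 3) * Psi C)" .
  then have 4: "U \<le> V + (q + 3) * Psi C" by (subst (asm) mult_le_cancel1) simp
  define y where "y l t = used C l t + m - t" for l t
  have f_y: "f l t = p l * pw m M (y l t)" for l t by (simp add: f_def y_def)
  define G where "G = m + 4 + q"
  have "(\<Sum>l<k. \<Sum>t\<le>m. y l t * f l t) = U + (\<Sum>l<k. \<Sum>t\<le>m. (m - t) * f l t)"
    unfolding U_def sum.distrib[symmetric] y_def by (intro sum.cong refl) (simp flip: distrib_right)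
  also have "\<dots> \<le> V + (\<Sum>l<k. \<Sum>t\<le>m. (m - t) * f l t) + (q + 3) * Psi C" using 4 by simp
  also have "V + (\<Sum>l<k. \<Sum>t\<le>m. (m - t) * f l t) = (m + 1) * Psi C"
    unfolding V_def Psi sum.distrib[symmetric] sum_distrib_left
    by (intro sum.cong refl) (simp flip: distrib_right)
  also have "(m + 1) * Psi C + (q + 3) * Psi C = (\<Sum>l<k. \<Sum>t\<le>m. G * f l t)"
    unfolding Psi sum_distrib_left[symmetric] G_def by (simp add: algebra_simps)
  finally have 5: "(\<Sum>l<k. \<Sum>t\<le>m. y l t * f l t) \<le> (\<Sum>l<k. \<Sum>t\<le>m. G * f l t)" .
  have q: "q \<le> m" by (simp add: q_def)
  \<comment> \<open>Tangents at \<open>y l t\<close>, evaluated at \<open>G\<close>. By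
    \<open>5\<close> the weighted mean of \<open>y\<close> is at most \<open>G\<close>, so the
    linear terms add up to a nonnegative number.\<close>
  have "real (\<Sum>l<k. \<Sum>t\<le>m. f l t) + ln (1 + 1 / real M) *
      (real (\<Sum>l<k. \<Sum>t\<le>m. G * f l t) - real (\<Sum>l<k. \<Sum>t\<le>m. y l t * f l t))
    = (\<Sum>l<k. \<Sum>t\<le>m. real (p l) * (real (pw m M (y l t)) + real (pw m M (y l t)) * (real G - real (y l t)) * ln (1 + 1 / real M)))"
    unfolding of_nat_sum sum_subtractf[symmetric] sum_distrib_left sum.distrib[symmetric]
    by (intro sum.cong refl) (simp add: f_y algebra_simps)
  also have "\<dots> \<le> (\<Sum>l<k. \<Sum>t\<le>m. real (p l) * real (pw m M G))"
  proof (intro sum_mono mult_left_mono pw_tangent)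
    fix l t show "y l t \<le> 3 * m + 3" using used_le[of C l t] by (simp add: y_def)
    show "G \<le> 3 * m + 3" using q m by (simp add: G_def)
  qed (use M in auto)
  also have "\<dots> = real target"
    by (simp add: target_def G_def q_def sum_distrib_right sum_distrib_left algebra_simps)
  finally have "real (Psi C) + ln (1 + 1 / real M) *
      (real (\<Sum>l<k. \<Sum>t\<le>m. G * f l t) - real (\<Sum>l<k. \<Sum>t\<le>m. y l t * f l t)) \<le> real target"
    unfolding Psi .
  moreover have "0 \<le> ln (1 + 1 / real M) *
      (real (\<Sum>l<k. \<Sum>t\<le>m. G * f l t) - real (\<Sum>l<k. \<Sum>t\<le>m. y l t * f l t))"
    using 5 by (intro mult_nonneg_nonneg) (simp_all del: of_nat_sum)
  ultimately show ?thesis by linarith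
qed

text \<open>Markov's inequality for the potential: a single threshold overloaded by \<open>b\<close>
  already contributes \<open>p l * pw m M (m + 1 + b)\<close>.\<close>

lemma heavy_weight:
  assumes "Psi C \<le> target" "b \<le> m"
    and Fl: "Fl \<subseteq> {..<k}" "\<And>l. l \<in> Fl \<Longrightarrow> \<exists>t\<le>m. t + 1 + b \<le> used C l t"
  shows "(\<Sum>l\<in>Fl. p l) * pw m M (m + 1 + b) \<le> target"
proof -
  have "(\<Sum>l\<in>Fl. p l) * pw m M (m + 1 + b) = (\<Sum>l\<in>Fl. p l * pw m M (m + 1 + b))"
    by (rule sum_distrib_right)
  also have "\<dots> \<le> (\<Sum>l\<in>Fl. \<Sum>t\<le>m. p l * pw m M (used C l t + m - t))"
  proof (rule sum_mono)
    fix l assume "l \<in> Fl"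
    with Fl obtain t where t: "t \<le> m" "t + 1 + b \<le> used C l t" by blast
    have "p l * pw m M (m + 1 + b) \<le> p l * pw m M (used C l t + m - t)"
      using t used_le[of C l t] by (intro mult_left_mono pw_mono) auto
    also have "\<dots> \<le> (\<Sum>t\<le>m. p l * pw m M (used C l t + m - t))"
      using t by (intro member_le_sum) auto
    finally show "p l * pw m M (m + 1 + b) \<le> \<dots>" .
  qed
  also have "\<dots> \<le> Psi C" unfolding Psi_def using Fl(1) by (intro sum_mono2) auto
  finally show ?thesis using assms(1) by simp
qed

end


section \<open>Knapsack\<close>

text \<open>\<open>F l P\<close> is meant as the least load that the manipulators from
  \<open>l\<close> on can have at rounded price at most \<open>P\<close>. The recursion is used in
  two halves: the inequality, here, against every choice; the equation, next, along the recorded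
  choices.\<close>

lemma knapsack_lower_bound:
  fixes F :: "nat \<Rightarrow> nat \<Rightarrow> nat"
  assumes base: "\<And>P. P \<le> Q \<Longrightarrow> F k P = 0"
    and step: "\<And>l P j. l < k \<Longrightarrow> P \<le> Q \<Longrightarrow> j \<le> m \<Longrightarrow> q l j \<le> P \<Longrightarrow> F l P \<le> F (Suc l) (P - q l j) + w l * a j"
    and c: "\<And>l. l < k \<Longrightarrow> c l \<le> m"
    and "l \<le> k" "P \<le> Q" "(\<Sum>l'\<in>{l..<k}. q l' (c l')) \<le> P"
  shows "F l P \<le> (\<Sum>l'\<in>{l..<k}. w l' * a (c l'))"
  using assms(4-6)
proof (induction "k - l" arbitrary: l P)
  case 0
  then show ?case using base by simp
next
  case (Suc n)
  then have l: "l < k" by simp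
  have split: "(\<Sum>l'\<in>{l..<k}. g l') = g l + (\<Sum>l'\<in>{Suc l..<k}. g l')" for g :: "nat \<Rightarrow> nat"
    using l by (simp add: sum.atLeast_Suc_lessThan)
  have "q l (c l) + (\<Sum>l'\<in>{Suc l..<k}. q l' (c l')) \<le> P" using Suc.prems split by simp
  then have "F (Suc l) (P - q l (c l)) \<le> (\<Sum>l'\<in>{Suc l..<k}. w l' * a (c l'))"
    using Suc.hyps l Suc.prems by (intro Suc.hyps(1)) auto
  moreover have "F l P \<le> F (Suc l) (P - q l (c l)) + w l * a (c l)"
    using l Suc.prems c split by (intro step) auto
  ultimately show ?case unfolding split by simp
qed

text \<open>\<open>R l\<close> is the rounded price still available at manipulator \<open>l\<close>.
  Table values do not increase along the path, so a path that starts below \<open>big\<close> never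
  meets an entry standing for infinity.\<close>

lemma knapsack_trace:
  fixes F J :: "nat \<Rightarrow> nat \<Rightarrow> nat"
  assumes base: "F k (R k) = 0"
    and step: "\<And>l P. l < k \<Longrightarrow> P \<le> Q \<Longrightarrow> F l P \<ge> big \<or> J l P \<le> m \<and> q l (J l P) \<le> P \<and>
        F l P = F (Suc l) (P - q l (J l P)) + w l * a (J l P)"
    and R: "\<And>l. l < k \<Longrightarrow> R (Suc l) = R l - q l (J l (R l))"
    and R0: "R 0 \<le> Q" "F 0 (R 0) < big"
  defines "c \<equiv> \<lambda>l. J l (R l)"
  shows "(\<Sum>l<k. w l * a (c l)) = F 0 (R 0)" "(\<Sum>l<k. q l (c l)) \<le> R 0" "\<And>l. l < k \<Longrightarrow> c l \<le> m"
proof -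
  have "R l + (\<Sum>l'<l. q l' (c l')) = R 0 \<and> F l (R l) + (\<Sum>l'<l. w l' * a (c l')) = F 0 (R 0) \<and>
      (\<forall>l'<l. c l' \<le> m)" if "l \<le> k" for l
    using that
  proof (induction l)
    case (Suc l)
    then have IH: "R l + (\<Sum>l'<l. q l' (c l')) = R 0"
        "F l (R l) + (\<Sum>l'<l. w l' * a (c l')) = F 0 (R 0)" "\<forall>l'<l. c l' \<le> m" by auto
    have "F l (R l) < big" "R l \<le> Q" using IH R0 by linarith+
    with step[of l "R l"] Suc.prems have "c l \<le> m" "q l (c l) \<le> R l"
      "F l (R l) = F (Suc l) (R l - q l (c l)) + w l * a (c l)" by (auto simp: c_def)
    with IH R[of l] Suc.prems show ?case by (auto simp: less_Suc_eq c_def)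
  qed simp
  from this[of k] base show "(\<Sum>l<k. w l * a (c l)) = F 0 (R 0)" "(\<Sum>l<k. q l (c l)) \<le> R 0"
    "\<And>l. l < k \<Longrightarrow> c l \<le> m" by auto
qed

lemma sum_div_le:
  fixes x :: "nat \<Rightarrow> nat"
  shows "(\<Sum>l<k. x l div z) \<le> (\<Sum>l<k. x l) div z"
proof (induction k)
  case (Suc k)
  have "(\<Sum>l<k. x l) div z + x k div z \<le> ((\<Sum>l<k. x l) + x k) div z"
    unfolding div_add1_eq[of "\<Sum>l<k. x l"] by simp
  with Suc show ?case by simp
qed simp

text \<open>Prices are rounded to multiples of \<open>Z / (k * m)\<close>, so that the table has polynomial size.\<close>

lemma knapsack_response:
  fixes F J pr :: "nat \<Rightarrow> nat \<Rightarrow> nat"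
  assumes base: "\<And>P. P \<le> k * m \<Longrightarrow> F k P = 0"
    and upper: "\<And>l P j. l < k \<Longrightarrow> P \<le> k * m \<Longrightarrow> j \<le> m \<Longrightarrow> q l j \<le> P \<Longrightarrow> F l P \<le> F (Suc l) (P - q l j) + w l * a j"
    and exact: "\<And>l P. l < k \<Longrightarrow> P \<le> k * m \<Longrightarrow> F l P \<ge> big \<or> J l P \<le> m \<and> q l (J l P) \<le> P \<and>
        F l P = F (Suc l) (P - q l (J l P)) + w l * a (J l P)"
    and R: "\<And>l. l < k \<Longrightarrow> R (Suc l) = R l - q l (J l (R l))"
    and least: "R 0 \<le> k * m" "\<And>P. P < R 0 \<Longrightarrow> bud < F 0 P"
      "(\<exists>P\<le>k * m. F 0 P \<le> bud) \<Longrightarrow> F 0 (R 0) \<le> bud"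
    and bud: "bud < big" "(\<Sum>l<k. w l * a 0) \<le> bud"
    and q: "\<And>l j. q l j = pr l j * (k * m) div Z"
    and Z: "Z = (\<Sum>l<k. pr l 0)" and pr: "\<And>l j. pr l j \<le> pr l 0" "\<And>l. l < k \<Longrightarrow> pr l 0 > 0"
  defines "c \<equiv> \<lambda>l. J l (R l)"
  shows "(\<forall>l<k. c l \<le> m) \<and> (\<Sum>l<k. w l * a (c l)) \<le> bud \<and>
    (\<forall>c'. (\<forall>l<k. c' l \<le> m) \<longrightarrow> (\<Sum>l<k. w l * a (c' l)) \<le> bud \<longrightarrow>
      m * (\<Sum>l<k. pr l (c l)) \<le> m * (\<Sum>l<k. pr l (c' l)) + Z)"
proof -
  have qsum: "(\<Sum>l<k. q l (c' l)) \<le> k * m" for c'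
  proof -
    have "(\<Sum>l<k. q l (c' l)) \<le> (\<Sum>l<k. pr l (c' l) * (k * m)) div Z"
      unfolding q by (rule sum_div_le)
    also have "\<dots> \<le> (\<Sum>l<k. pr l 0 * (k * m)) div Z"
      by (intro div_le_mono sum_mono mult_right_mono pr) auto
    also have "(\<Sum>l<k. pr l 0 * (k * m)) = Z * (k * m)" by (simp add: Z sum_distrib_right)
    also have "Z * (k * m) div Z \<le> k * m" by (cases "Z = 0") auto
    finally show ?thesis .
  qed
  have lower: "F 0 (\<Sum>l<k. q l (c' l)) \<le> (\<Sum>l<k. w l * a (c' l))" if "\<And>l. l < k \<Longrightarrow> c' l \<le> m" for c'
    using knapsack_lower_bound[where l = 0 and P = "\<Sum>l<k. q l (c' l)" and c = c' and F = F and k = k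
        and Q = "k * m" and q = q and w = w and a = a and m = m] base upper that qsum[of c']
    by (simp add: atLeast0LessThan)
  \<comment> \<open>Position 0 everywhere has the least load and lies within the budget, so some
    entry of the first row does.\<close>
  have "F 0 (\<Sum>l<k. q l 0) \<le> bud" using lower[of "\<lambda>_. 0"] bud by simp
  with qsum[of "\<lambda>_. 0"] have FR: "F 0 (R 0) \<le> bud" by (intro least(3)) blast
  have Rk: "R l \<le> k * m" if "l \<le> k" for l
    using that
  proof (induction l)
    case (Suc l)
    then show ?case using R[of l] by simp
  qed (use least in simp)
  from FR bud have FRb: "F 0 (R 0) < big" by simp
  note tr = knapsack_trace[where F = F and J = J and R = R and Q = "k * m" and k = k and big = big
      and m = m and q = q and w = w and a = a]
  have tr1: "(\<Sum>l<k. w l * a (c l)) = F 0 (R 0)"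
    unfolding c_def by (rule tr(1)) (fact base[OF Rk[OF order_refl]] exact R least(1) FRb)+
  have tr2: "(\<Sum>l<k. q l (c l)) \<le> R 0"
    unfolding c_def by (rule tr(2)) (fact base[OF Rk[OF order_refl]] exact R least(1) FRb)+
  have tr3: "c l \<le> m" if "l < k" for l
    unfolding c_def by (rule tr(3)) (fact base[OF Rk[OF order_refl]] exact R least(1) FRb that)+
  have cost: "(\<Sum>l<k. w l * a (c l)) \<le> bud" using tr1 FR by simp
  have "m * (\<Sum>l<k. pr l (c l)) \<le> m * (\<Sum>l<k. pr l (c' l)) + Z"
    if c': "\<And>l. l < k \<Longrightarrow> c' l \<le> m" "(\<Sum>l<k. w l * a (c' l)) \<le> bud" for c'
  proof -
    have "(\<Sum>l<k. q l (c l)) \<le> R 0" by (rule tr2)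
    also have "R 0 \<le> (\<Sum>l<k. q l (c' l))"
      using least(2)[of "\<Sum>l<k. q l (c' l)"] lower[OF c'(1)] c'(2) by (meson not_le order_trans leD)
    finally have le: "(\<Sum>l<k. q l (c l)) \<le> (\<Sum>l<k. q l (c' l))" .
    show "m * (\<Sum>l<k. pr l (c l)) \<le> m * (\<Sum>l<k. pr l (c' l)) + Z"
    proof (cases "k = 0")
      case False
      then have Zpos: "Z > 0" using pr(2)[of 0] member_le_sum[of 0 "{..<k}" "\<lambda>l. pr l 0"] by (simp add: Z)
      have up: "pr l j * (k * m) \<le> Z * q l j + Z" for l j
      proof -
        have "pr l j * (k * m) = Z * q l j + pr l j * (k * m) mod Z" unfolding q by simp
        moreover have "pr l j * (k * m) mod Z < Z" using Zpos by simp
        ultimately show ?thesis by linarith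
      qed
      have dn: "Z * q l j \<le> pr l j * (k * m)" for l j unfolding q by simp
      \<comment> \<open>Each of the \<open>k\<close> roundings loses at most one unit
        \<open>Z / (k * m)\<close>, together at most \<open>Z / m\<close>; the calculation is
        multiplied out by \<open>k * m\<close>.\<close>
      have "k * (m * (\<Sum>l<k. pr l (c l))) = (\<Sum>l<k. pr l (c l) * (k * m))"
        by (simp add: sum_distrib_left mult.commute mult.assoc)
      also have "\<dots> \<le> (\<Sum>l<k. Z * q l (c l) + Z)" by (intro sum_mono up)
      also have "\<dots> = Z * (\<Sum>l<k. q l (c l)) + k * Z" by (simp add: sum.distrib sum_distrib_left)
      also have "\<dots> \<le> Z * (\<Sum>l<k. q l (c' l)) + k * Z" using le by simp
      also have "Z * (\<Sum>l<k. q l (c' l)) = (\<Sum>l<k. Z * q l (c' l))" by (simp add: sum_distrib_left)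
      also have "\<dots> \<le> (\<Sum>l<k. pr l (c' l) * (k * m))" by (intro sum_mono dn)
      also have "\<dots> = k * (m * (\<Sum>l<k. pr l (c' l)))"
        by (simp add: sum_distrib_left mult.commute mult.assoc)
      finally have "k * (m * (\<Sum>l<k. pr l (c l))) \<le> k * (m * (\<Sum>l<k. pr l (c' l)) + Z)"
        by (simp add: distrib_left)
      then show ?thesis using False by simp
    qed simp
  qed
  with tr3 cost show ?thesis by blast
qed


section \<open>Ranks\<close>

lemma bij_betw_rank:
  assumes "finite A"
    and irr: "\<And>x. x \<in> A \<Longrightarrow> \<not> r x x"
    and trans: "\<And>x y z. x \<in> A \<Longrightarrow> y \<in> A \<Longrightarrow> z \<in> A \<Longrightarrow> r x y \<Longrightarrow> r y z \<Longrightarrow> r x z"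
    and total: "\<And>x y. x \<in> A \<Longrightarrow> y \<in> A \<Longrightarrow> x \<noteq> y \<Longrightarrow> r x y \<or> r y x"
  shows "bij_betw (\<lambda>x. card {y \<in> A. r y x}) A {..<card A}"
proof -
  let ?f = "\<lambda>x. card {y \<in> A. r y x}"
  have less: "?f x < ?f y" if "x \<in> A" "y \<in> A" "r x y" for x y
  proof (rule psubset_card_mono)
    show "{z \<in> A. r z x} \<subset> {z \<in> A. r z y}" using that trans irr by blast
  qed (use assms in simp)
  have inj: "inj_on ?f A"
  proof (rule inj_onI, rule ccontr)
    fix x y assume "x \<in> A" "y \<in> A" "?f x = ?f y" "x \<noteq> y"
    then show False using less[of x y] less[of y x] total[of x y] by auto
  qed
  have "?f ` A \<subseteq> {..<card A}"
  proof safe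
    fix x assume "x \<in> A"
    then have "{y \<in> A. r y x} \<subset> A" using irr by blast
    with assms(1) show "?f x < card A" by (intro psubset_card_mono)
  qed
  then have "?f ` A = {..<card A}"
    by (intro card_subset_eq) (simp_all add: card_image[OF inj])
  with inj show ?thesis by (simp add: bij_betw_def)
qed

lemma sum_of_bool_eq_card:
  assumes "finite A"
  shows "(\<Sum>x\<in>A. of_bool (P x)) = card {x \<in> A. P x}"
  using assms by (simp add: of_bool_def sum.If_cases Int_def)

section \<open>Order of the weights, favoured candidates and weights of the potential\<close>

definition wkey :: "nat \<Rightarrow> (nat \<Rightarrow> nat) \<Rightarrow> nat \<Rightarrow> nat" where
  "wkey k w l = w l * k + l"

text \<open>Rank 0 belongs to the heaviest manipulator; the index in \<open>wkey\<close> breaks ties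
  between equal weights.\<close>

definition wrank :: "nat \<Rightarrow> (nat \<Rightarrow> nat) \<Rightarrow> nat \<Rightarrow> nat" where
  "wrank k w l = (\<Sum>l'<k. of_bool (wkey k w l < wkey k w l'))"

definition favourite :: "nat \<Rightarrow> nat \<Rightarrow> (nat \<Rightarrow> nat) \<Rightarrow> nat \<Rightarrow> nat" where
  "favourite m k w l = 1 + wrank k w l mod m"

definition light :: "nat \<Rightarrow> nat \<Rightarrow> (nat \<Rightarrow> nat) \<Rightarrow> nat" where
  "light m k w = (\<Sum>l<k. w l * of_bool (m \<le> wrank k w l))"

text \<open>The protected weight \<open>light + 1\<close> exceeds the total weight of all lighter
  manipulators, so that protected ones cannot fail. The sum of all weights still is at most
  \<open>(m + 1) * (light + 1)\<close>.\<close>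

definition pweight :: "nat \<Rightarrow> nat \<Rightarrow> (nat \<Rightarrow> nat) \<Rightarrow> nat \<Rightarrow> nat" where
  "pweight m k w l = (if wrank k w l < m then light m k w + 1 else w l)"

lemma mult_add_less:
  fixes a b c d n :: nat
  assumes "a < b" "c < n"
  shows "a * n + c < b * n + d"
proof -
  have "a * n + c < Suc a * n" using assms(2) by simp
  also have "\<dots> \<le> b * n" using assms(1) by (intro mult_right_mono) auto
  finally show ?thesis by simp
qed

lemma mult_add_inj:
  fixes a b c d n :: nat
  assumes "a * n + c = b * n + d" "c < n" "d < n"
  shows "a = b \<and> c = d"
  using mult_add_less[of a b c n d] mult_add_less[of b a d n c] assms
  by (metis add_left_cancel linorder_neqE_nat less_irrefl)

lemma wkey_inj: "l < k \<Longrightarrow> l' < k \<Longrightarrow> wkey k w l = wkey k w l' \<Longrightarrow> l = l'"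
  unfolding wkey_def using mult_add_inj by blast

lemma wkey_mono: "l < k \<Longrightarrow> l' < k \<Longrightarrow> wkey k w l \<le> wkey k w l' \<Longrightarrow> w l \<le> w l'"
  unfolding wkey_def using mult_add_less[of "w l'" "w l" l' k l] by (meson leD le_less_linear)

lemma wrank_card: "wrank k w l = card {l' \<in> {..<k}. wkey k w l < wkey k w l'}"
  unfolding wrank_def by (rule sum_of_bool_eq_card) simp

lemma wrank_bij: "bij_betw (wrank k w) {..<k} {..<k}"
proof -
  have "bij_betw (\<lambda>l. card {l' \<in> {..<k}. wkey k w l < wkey k w l'}) {..<k} {..<card {..<k}}"
  proof (rule bij_betw_rank)
    fix x y assume "x \<in> {..<k}" "y \<in> {..<k}" "x \<noteq> y"
    then show "wkey k w y < wkey k w x \<or> wkey k w x < wkey k w y"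
      using wkey_inj[of x k y w] by (metis lessThan_iff linorder_neqE_nat)
  qed auto
  then show ?thesis by (simp add: wrank_card[abs_def])
qed

lemma wrank_antimono:
  assumes "l < k" "l' < k" "wrank k w l \<le> wrank k w l'"
  shows "w l' \<le> w l"
proof (rule ccontr)
  assume "\<not> w l' \<le> w l"
  then have lt: "wkey k w l < wkey k w l'"
    using wkey_mono[OF assms(2,1)] by (meson not_le)
  have "{x \<in> {..<k}. wkey k w l' < wkey k w x} \<subset> {x \<in> {..<k}. wkey k w l < wkey k w x}"
    using lt assms(2) by auto
  then have "wrank k w l' < wrank k w l" unfolding wrank_card by (intro psubset_card_mono) auto
  with assms(3) show False by simp
qed

lemma favourite_range: "m \<ge> 1 \<Longrightarrow> favourite m k w l \<in> {1..m}"
  unfolding favourite_def by (simp add: Suc_leI)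

text \<open>
  In the order of decreasing weights, each block of \<open>m\<close> consecutive manipulators contains one that
  favours candidate \<open>i\<close>, and it outweighs all those of the next block.
\<close>

lemma light_le:
  assumes "i \<in> {1..m}"
  shows "light m k w \<le> m * (\<Sum>l | l < k \<and> favourite m k w l = i. w l)"
proof -
  define u where "u = inv_into {..<k} (wrank k w)"
  have u: "u r < k" "wrank k w (u r) = r" if "r < k" for r
    using wrank_bij[of k w] that unfolding u_def
    by (metis bij_betw_def inv_into_into lessThan_iff, metis bij_betw_def f_inv_into_f lessThan_iff)
  define v where "v r = w (u r)" for r
  have v: "v r' \<le> v r" if "r \<le> r'" "r' < k" for r r'
  proof -
    have "r < k" using that by simp
    with that u(1)[OF this] u(1)[of r'] u(2)[OF this] u(2)[of r'] show ?thesis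
      unfolding v_def by (intro wrank_antimono[of "u r" k "u r'"]) simp_all
  qed
  have vw: "v (wrank k w l) = w l" if "l < k" for l
    using wrank_bij[of k w] that unfolding v_def u_def
    by (metis bij_betw_imp_inj_on inv_into_f_f lessThan_iff)
  have reindex: "(\<Sum>l | l < k \<and> P (wrank k w l). w l) = (\<Sum>r | r < k \<and> P r. v r)" for P
  proof -
    have "bij_betw (wrank k w) {l. l < k \<and> P (wrank k w l)} {r. r < k \<and> P r}"
      using wrank_bij[of k w] unfolding bij_betw_def inj_on_def by auto
    from sum.reindex_bij_betw[OF this, of v]
    have "(\<Sum>l | l < k \<and> P (wrank k w l). v (wrank k w l)) = (\<Sum>r | r < k \<and> P r. v r)" .
    moreover have "(\<Sum>l | l < k \<and> P (wrank k w l). v (wrank k w l)) = (\<Sum>l | l < k \<and> P (wrank k w l). w l)"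
      using vw by (intro sum.cong) auto
    ultimately show ?thesis by simp
  qed
  \<comment> \<open>\<open>f r\<close> is the rank in the preceding block of \<open>m\<close> at
    which \<open>i\<close> is favoured; \<open>S\<close> consists of the ranks after the first
    block.\<close>
  define f where "f r = m * (r div m - 1) + (i - 1)" for r
  define T where "T = {r. r < k \<and> 1 + r mod m = i}"
  define S where "S = {r. r < k \<and> m \<le> r}"
  have m: "m \<ge> 1" using assms by auto
  have f: "f r \<le> r" "f r \<in> T" "m * (f r div m + 1) \<le> r \<and> r < m * (f r div m + 1) + m" if "r \<in> S" for r
  proof -
    have d: "r div m \<ge> 1" using that m by (simp add: S_def div_greater_zero_iff Suc_leI)
    obtain j where "i = Suc j" "j < m" using assms by (cases i) auto
    then have fd: "f r div m = r div m - 1" and fm: "f r mod m = i - 1" by (simp_all add: f_def)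
    have r: "r = m * (r div m) + r mod m" "r mod m < m" using m by auto
    have s: "m * (r div m - 1) + m = m * (r div m)" using d by (metis mult_Suc_right Suc_diff_1 add.commute less_eq_Suc_le One_nat_def)
    show 1: "f r \<le> r"
      using r(1) s assms unfolding f_def atLeastAtMost_iff by linarith
    show "f r \<in> T" using 1 that fm assms unfolding T_def S_def by auto
    show "m * (f r div m + 1) \<le> r \<and> r < m * (f r div m + 1) + m"
      using r fd d by (simp only: le_add_diff_inverse2) linarith
  qed
  have "light m k w = (\<Sum>l | l < k \<and> m \<le> wrank k w l. w l)"
    unfolding light_def
    by (rule sum.mono_neutral_cong_right) auto
  also have "\<dots> = (\<Sum>r\<in>S. v r)" unfolding reindex S_def ..
  also have "\<dots> \<le> (\<Sum>r\<in>S. v (f r))" using f v by (intro sum_mono) (auto simp: S_def)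
  also have "\<dots> = (\<Sum>y\<in>T. \<Sum>r\<in>{r \<in> S. f r = y}. v (f r))"
    by (rule sum.group[symmetric]) (use f in \<open>auto simp: S_def T_def\<close>)
  also have "\<dots> \<le> (\<Sum>y\<in>T. m * v y)"
  proof (rule sum_mono)
    fix y
    have "(\<Sum>r\<in>{r \<in> S. f r = y}. v (f r)) = card {r \<in> S. f r = y} * v y" by simp
    also have "card {r \<in> S. f r = y} \<le> card {m * (y div m + 1)..<m * (y div m + 1) + m}"
      using f by (intro card_mono) auto
    finally show "(\<Sum>r\<in>{r \<in> S. f r = y}. v (f r)) \<le> m * v y" by simp
  qed
  also have "\<dots> = m * (\<Sum>l | l < k \<and> favourite m k w l = i. w l)"
    unfolding sum_distrib_left[symmetric] T_def favourite_def reindex[of "\<lambda>r. 1 + r mod m = i"] ..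
  finally show ?thesis .
qed

lemma card_top_le: "card {l \<in> {..<k}. wrank k w l < m} \<le> m"
proof -
  have "card {l \<in> {..<k}. wrank k w l < m} = card (wrank k w ` {l \<in> {..<k}. wrank k w l < m})"
  proof (rule card_image[symmetric])
    have "inj_on (wrank k w) {..<k}" using wrank_bij[of k w] by (simp add: bij_betw_def)
    then show "inj_on (wrank k w) {l \<in> {..<k}. wrank k w l < m}" by (rule inj_on_subset) auto
  qed
  also have "\<dots> \<le> card {..<m}" by (intro card_mono) auto
  finally show ?thesis by simp
qed

lemma sum_pweight_le: "(\<Sum>l<k. pweight m k w l) \<le> (m + 1) * (light m k w + 1)"
proof -
  have "pweight m k w l \<le> of_bool (wrank k w l < m) * (light m k w + 1) + w l * of_bool (m \<le> wrank k w l)" for l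
    by (simp add: pweight_def)
  then have "(\<Sum>l<k. pweight m k w l)
      \<le> (\<Sum>l<k. of_bool (wrank k w l < m) * (light m k w + 1) + w l * of_bool (m \<le> wrank k w l))"
    by (intro sum_mono)
  also have "\<dots> = (\<Sum>l<k. of_bool (wrank k w l < m)) * (light m k w + 1) + light m k w"
    by (simp only: sum.distrib light_def sum_distrib_right)
  also have "(\<Sum>l<k. of_bool (wrank k w l < m)) = card {l \<in> {..<k}. wrank k w l < m}"
    by (rule sum_of_bool_eq_card) simp
  also have "card {l \<in> {..<k}. wrank k w l < m} * (light m k w + 1) + light m k w
      \<le> m * (light m k w + 1) + (light m k w + 1)"
    using card_top_le[of k w m] by (intro add_mono mult_right_mono) auto
  finally show ?thesis by simp
qed


section \<open>From configurations to permutations\<close>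

definition ckey :: "nat \<Rightarrow> (nat \<Rightarrow> nat) \<Rightarrow> nat \<Rightarrow> nat" where
  "ckey m c i = c i * (m + 1) + i"

definition crank :: "nat \<Rightarrow> nat \<Rightarrow> (nat \<Rightarrow> nat) \<Rightarrow> nat \<Rightarrow> nat" where
  "crank m f c i = (\<Sum>i'<m + 1. of_bool (ckey m c i' < ckey m c i) * of_bool (i' \<noteq> f))"

text \<open>The favoured candidate \<open>f\<close> receives exactly \<open>c f\<close>. All others
  are sorted by configuration, with ties broken by the index, and skip that position.\<close>

definition position :: "nat \<Rightarrow> nat \<Rightarrow> (nat \<Rightarrow> nat) \<Rightarrow> nat \<Rightarrow> nat" where
  "position m f c i = (if i = f then c f else crank m f c i + of_bool (c f \<le> crank m f c i))"

lemma ckey_inj: "i \<le> m \<Longrightarrow> i' \<le> m \<Longrightarrow> ckey m c i = ckey m c i' \<Longrightarrow> i = i'"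
  unfolding ckey_def using mult_add_inj[of "c i" "m + 1" i "c i'" i'] by auto

lemma crank_card: "crank m f c i = card {i' \<in> {0..m} - {f}. ckey m c i' < ckey m c i}"
proof -
  have "crank m f c i = (\<Sum>i'<m + 1. of_bool (ckey m c i' < ckey m c i \<and> i' \<noteq> f))"
    unfolding crank_def by (intro sum.cong) auto
  also have "\<dots> = card {i' \<in> {..<m + 1}. ckey m c i' < ckey m c i \<and> i' \<noteq> f}"
    by (rule sum_of_bool_eq_card) simp
  also have "{i' \<in> {..<m + 1}. ckey m c i' < ckey m c i \<and> i' \<noteq> f} = {i' \<in> {0..m} - {f}. ckey m c i' < ckey m c i}"
    by auto
  finally show ?thesis .
qed

lemma crank_bij:
  assumes "f \<le> m"
  shows "bij_betw (crank m f c) ({0..m} - {f}) {..<m}"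
proof -
  have "bij_betw (\<lambda>x. card {y \<in> {0..m} - {f}. ckey m c y < ckey m c x}) ({0..m} - {f})
      {..<card ({0..m} - {f})}"
  proof (rule bij_betw_rank)
    fix x y assume "x \<in> {0..m} - {f}" "y \<in> {0..m} - {f}" "x \<noteq> y"
    then show "ckey m c x < ckey m c y \<or> ckey m c y < ckey m c x"
      using ckey_inj[of x m y c] by (metis DiffD1 atLeastAtMost_iff linorder_neqE_nat)
  qed auto
  then show ?thesis using assms by (simp add: crank_card[abs_def])
qed

lemma position_bij:
  assumes "f \<le> m" "c f \<le> m"
  shows "bij_betw (position m f c) {0..m} {0..m}"
proof -
  have rk: "crank m f c i < m" if "i \<le> m" "i \<noteq> f" for i
    using crank_bij[OF assms(1), of c] that by (auto simp: bij_betw_def)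
  have inj: "crank m f c i \<noteq> crank m f c j" if "i \<le> m" "j \<le> m" "i \<noteq> f" "j \<noteq> f" "i \<noteq> j" for i j
    using crank_bij[OF assms(1), of c] that by (auto simp: bij_betw_def inj_on_def)
  have "inj_on (position m f c) {0..m}"
  proof (rule inj_onI, rule ccontr)
    fix i j assume "i \<in> {0..m}" "j \<in> {0..m}" and eq: "position m f c i = position m f c j" and "i \<noteq> j"
    then show False
      using inj[of i j] unfolding position_def by (auto simp: of_bool_def split: if_splits)
  qed
  moreover have "position m f c ` {0..m} \<subseteq> {0..m}"
    using rk assms(2) by (auto simp: position_def of_bool_def Suc_le_eq)
  ultimately show ?thesis
    unfolding bij_betw_def by (metis endo_inj_surj finite_atLeastAtMost)
qed

text \<open>The count on the right includes \<open>i\<close> itself, which makes up for the possible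
  shift past the favoured position. Candidate 0 sorts behind \<open>i\<close> and does not push it
  up.\<close>

lemma position_le:
  assumes "i \<in> {1..m}" "i \<noteq> f" "c i < c 0"
  shows "position m f c i \<le> (\<Sum>i'\<in>{1..m}. of_bool (c i' \<le> c i))"
proof -
  have "c i' \<le> c i" if "ckey m c i' < ckey m c i" "i' \<le> m" for i'
    using mult_add_less[of "c i" "c i'" i "m + 1" i'] that assms(1) unfolding ckey_def by (auto simp: not_le[symmetric])
  then have "{i' \<in> {0..m} - {f}. ckey m c i' < ckey m c i} \<subseteq> {i' \<in> {1..m}. c i' \<le> c i} - {i}"
    using assms(3) by (auto simp: Suc_le_eq) (metis gr0I leD)
  then have "crank m f c i \<le> card ({i' \<in> {1..m}. c i' \<le> c i} - {i})"
    unfolding crank_card by (intro card_mono) auto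
  also have "\<dots> = card {i' \<in> {1..m}. c i' \<le> c i} - 1" using assms(1) by simp
  finally have "crank m f c i \<le> card {i' \<in> {1..m}. c i' \<le> c i} - 1" .
  moreover have "card {i' \<in> {1..m}. c i' \<le> c i} > 0" using assms(1) by (auto simp: card_gt_0_iff)
  ultimately have "position m f c i \<le> card {i' \<in> {1..m}. c i' \<le> c i}"
    using assms(2) by (auto simp: position_def of_bool_def)
  also have "\<dots> = (\<Sum>i'\<in>{1..m}. of_bool (c i' \<le> c i))"
    by (rule sum_of_bool_eq_card[symmetric]) simp
  finally show ?thesis .
qed

text \<open>
  \<open>Fl\<close> consists of the manipulators on which the search was not successful.  Their weight is
  negligible against the weight of the manipulators that favour a given candidate.
\<close>

lemma score_bound:
  fixes a w :: "nat \<Rightarrow> nat" and C :: "nat \<Rightarrow> nat \<Rightarrow> nat"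
  assumes mono: "mono_on {0..m} a" and "i \<in> {1..m}"
    and g: "\<And>j. j + b \<le> m \<Longrightarrow> a (j + b) \<le> a j + g" and b: "1 \<le> b" "b \<le> m"
    and C0: "\<And>l. l < k \<Longrightarrow> C 0 l = m + 1" and C: "\<And>l. l < k \<Longrightarrow> C i l \<le> m"
    and fav: "\<And>l. l < k \<Longrightarrow> fav l \<in> {1..m}" "\<And>l. l < k \<Longrightarrow> C (fav l) l \<le> m"
    and good: "\<And>l. l < k \<Longrightarrow> l \<notin> Fl \<Longrightarrow> (\<Sum>i'\<in>{1..m}. of_bool (C i' l \<le> C i l)) \<le> C i l + b"
    and Fl: "Fl \<subseteq> {..<k}" "m * (\<Sum>l\<in>Fl. w l) \<le> (\<Sum>l | l < k \<and> fav l = i. w l)"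
  shows "(\<Sum>l<k. w l * a (position m (fav l) (\<lambda>i. C i l) i)) \<le> (\<Sum>l<k. w l * a (C i l)) + g * (\<Sum>l<k. w l)"
proof -
  have am: "a x \<le> a y" if "x \<le> y" "y \<le> m" for x y
    using mono that by (auto simp: mono_on_def)
  have shift: "a y \<le> a x + g" if "y \<le> x + b" "y \<le> m" "x \<le> m" for x y
  proof (cases "x + b \<le> m")
    case True
    then show ?thesis using am[of y "x + b"] g[of x] that by linarith
  next
    case False
    have "a m \<le> a (m - b) + g" using g[of "m - b"] b by simp
    moreover have "a y \<le> a m" using am that by simp
    moreover have "a (m - b) \<le> a x" using False that by (intro am) auto
    ultimately show ?thesis by linarith
  qed
  \<comment> \<open>At most \<open>x\<close> steps of length \<open>b >= 1\<close> lead from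
    \<open>x\<close> down to 0. Thus \<open>m * g\<close> bounds the whole spread of the
    scores.\<close>
  have climb: "a x \<le> a 0 + x * g" if "x \<le> m" for x
    using that
  proof (induction x rule: less_induct)
    case (less x)
    show ?case
    proof (cases "x = 0")
      case False
      then have "a x \<le> a (x - b) + g" using less.prems by (intro shift) auto
      moreover have "a (x - b) \<le> a 0 + (x - b) * g" using less False b by auto
      moreover have "(x - b) * g + g \<le> x * g"
      proof (cases "b \<le> x")
        case True
        then have "(x - b) * g + g = (x - b + 1) * g" by simp
        also have "\<dots> \<le> x * g" using b True by (intro mult_right_mono) auto
        finally show ?thesis .
      next
        case False
        then show ?thesis using \<open>x \<noteq> 0\<close> by (cases x) auto
      qed
      ultimately show ?thesis by linarith
    qed simp
  qed
  let ?pos = "\<lambda>l. position m (fav l) (\<lambda>i. C i l) i"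
  have pos_le: "?pos l \<le> m" if "l < k" for l
    using position_bij[of "fav l" m "\<lambda>i. C i l"] fav that assms(2) by (auto simp: bij_betw_def)
  \<comment> \<open>The credit \<open>g\<close> at the manipulators that favour \<open>i\<close>
    will pay for the losses \<open>m * g\<close> at the failing ones.\<close>
  have each: "a (?pos l) + g * of_bool (fav l = i) \<le> a (C i l) + g + m * g * of_bool (l \<in> Fl)" if l: "l < k" for l
  proof (cases "fav l = i")
    case True
    then show ?thesis by (simp add: position_def)
  next
    case False
    show ?thesis
    proof (cases "l \<in> Fl")
      case True
      have "a (?pos l) \<le> a m" using pos_le[OF l] by (intro am) auto
      also have "\<dots> \<le> a 0 + m * g" by (rule climb) simp
      also have "a 0 \<le> a (C i l)" using C[OF l] by (intro am) auto
      finally show ?thesis using False True by simp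
    next
      case nf: False
      have "?pos l \<le> C i l + b"
        using position_le[of i m "fav l" "\<lambda>i. C i l"] False good[OF l nf] C0[OF l] C[OF l] assms(2)
        by (auto intro: order_trans)
      from shift[OF this pos_le[OF l] C[OF l]] show ?thesis using False by simp
    qed
  qed
  have "(\<Sum>l<k. w l * a (?pos l)) + g * (\<Sum>l | l < k \<and> fav l = i. w l)
      = (\<Sum>l<k. w l * (a (?pos l) + g * of_bool (fav l = i)))"
  proof -
    have "(\<Sum>l | l < k \<and> fav l = i. w l) = (\<Sum>l<k. w l * of_bool (fav l = i))"
      by (rule sum.mono_neutral_cong_left) auto
    then show ?thesis by (simp only: sum.distrib sum_distrib_left distrib_left mult_ac)
  qed
  also have "\<dots> \<le> (\<Sum>l<k. w l * (a (C i l) + g + m * g * of_bool (l \<in> Fl)))"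
    using each by (intro sum_mono mult_left_mono) auto
  also have "\<dots> = (\<Sum>l<k. w l * a (C i l)) + g * (\<Sum>l<k. w l) + g * (m * (\<Sum>l\<in>Fl. w l))"
  proof -
    have "(\<Sum>l\<in>Fl. w l) = (\<Sum>l<k. w l * of_bool (l \<in> Fl))"
      using Fl(1) by (intro sum.mono_neutral_cong_left) auto
    then show ?thesis by (simp only: sum.distrib sum_distrib_left distrib_left mult_ac)
  qed
  also have "\<dots> \<le> (\<Sum>l<k. w l * a (C i l)) + g * (\<Sum>l<k. w l) + g * (\<Sum>l | l < k \<and> fav l = i. w l)"
    using Fl(2) by (intro add_left_mono mult_left_mono) auto
  finally show ?thesis by simp
qed

text \<open>The four factors \<open>m + 1\<close> are spent on the thresholds in
  \<open>target\<close>, on \<open>sum_pweight_le\<close>, on \<open>light_le\<close>, and on the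
  factor \<open>m\<close> in the conclusion. The factor 2 replaces \<open>light + 1\<close> by
  \<open>light\<close>.\<close>

lemma failure_weight:
  assumes m: "m \<ge> 1" and M: "M \<ge> 1" and w: "\<And>l. l < k \<Longrightarrow> w l > 0"
    and Psi: "search.Psi m k M (pweight m k w) C \<le> search.target m k M (pweight m k w)"
    and b: "b \<le> m" "2 * (m + 1) ^ 4 * pw m M (m + 4 + m div M) \<le> pw m M (m + 1 + b)"
    and i: "i \<in> {1..m}"
  defines "Fl \<equiv> {l. l < k \<and> (\<exists>t\<le>m. t + 1 + b \<le> search.used m C l t)}"
  shows "m * (\<Sum>l\<in>Fl. w l) \<le> (\<Sum>l | l < k \<and> favourite m k w l = i. w l)"
proof -
  interpret search m k M "pweight m k w" using m M by unfold_locales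
  let ?p = "pweight m k w" and ?L = "light m k w" and ?G = "pw m M (m + 4 + m div M)"
  have fin: "finite Fl" by (simp add: Fl_def)
  have G: "?G > 0" using M by (simp add: pw_def)
  have "(\<Sum>l\<in>Fl. ?p l) * (2 * (m + 1) ^ 4) * ?G \<le> (\<Sum>l\<in>Fl. ?p l) * pw m M (m + 1 + b)"
    unfolding mult.assoc using b(2) by (intro mult_left_mono) (auto simp: mult.assoc)
  also have "\<dots> \<le> target" by (rule heavy_weight[OF Psi b(1)]) (auto simp: Fl_def)
  also have "\<dots> \<le> (m + 1) * (?L + 1) * (m + 1) * ?G"
    unfolding target_def using sum_pweight_le[of m k w] by (intro mult_right_mono) auto
  finally have "(\<Sum>l\<in>Fl. ?p l) * (2 * (m + 1) ^ 4) \<le> (m + 1) * (?L + 1) * (m + 1)" using G by (subst (asm) mult_le_cancel2) simp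
  moreover have "(m + 1) ^ 4 = (m + 1) ^ 2 * (m + 1) ^ 2" by (simp only: flip: power_add) simp
  ultimately have "(m + 1) ^ 2 * ((\<Sum>l\<in>Fl. ?p l) * (2 * (m + 1) ^ 2)) \<le> (m + 1) ^ 2 * (?L + 1)"
    by (simp only: power2_eq_square mult_ac)
  then have F: "(\<Sum>l\<in>Fl. ?p l) * (2 * (m + 1) ^ 2) \<le> ?L + 1" by (subst (asm) mult_le_cancel1) simp
  have one: "2 \<le> 2 * (m + 1) ^ 2" by simp
  \<comment> \<open>A single protected manipulator in \<open>Fl\<close> would contribute
    \<open>light + 1\<close>, more than \<open>F\<close> permits.\<close>
  have notop: "\<not> wrank k w l < m" if "l \<in> Fl" for l
  proof
    assume "wrank k w l < m"
    then have "?L + 1 \<le> (\<Sum>l\<in>Fl. ?p l)"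
      using member_le_sum[OF that _ fin, of ?p] by (simp add: pweight_def)
    then have "(?L + 1) * 2 \<le> (\<Sum>l\<in>Fl. ?p l) * (2 * (m + 1) ^ 2)" using one by (intro mult_mono) auto
    with F show False by simp
  qed
  then have pw: "(\<Sum>l\<in>Fl. ?p l) = (\<Sum>l\<in>Fl. w l)" by (intro sum.cong) (auto simp: pweight_def)
  show ?thesis
  proof (cases "?L = 0")
    \<comment> \<open>The right-hand side of \<open>F\<close> is 1 here, and one positive integer
      weight in \<open>Fl\<close> would exceed it.\<close>
    case True
    have "Fl = {}"
    proof (rule ccontr)
      assume "Fl \<noteq> {}"
      then obtain l where l: "l \<in> Fl" by blast
      then have "w l \<le> (\<Sum>l\<in>Fl. w l)" using fin by (intro member_le_sum) auto
      moreover have "w l > 0" using l w by (simp add: Fl_def)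
      ultimately have "1 * 2 \<le> (\<Sum>l\<in>Fl. ?p l) * (2 * (m + 1) ^ 2)" unfolding pw using one by (intro mult_mono) auto
      with F True show False by linarith
    qed
    then show ?thesis by simp
  next
    case False
    with F have "(\<Sum>l\<in>Fl. w l) * (2 * (m + 1) ^ 2) \<le> 2 * ?L" unfolding pw by simp
    then have "(\<Sum>l\<in>Fl. w l) * (m + 1) ^ 2 \<le> ?L" by simp
    moreover have "m * (m * (\<Sum>l\<in>Fl. w l)) \<le> (\<Sum>l\<in>Fl. w l) * (m + 1) ^ 2"
      by (simp add: power2_eq_square algebra_simps)
    ultimately have "m * (m * (\<Sum>l\<in>Fl. w l)) \<le> m * (\<Sum>l | l < k \<and> favourite m k w l = i. w l)"
      using light_le[OF i, of k w] by linarith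
    then show ?thesis using m by simp
  qed
qed


section \<open>The learning rate\<close>

text \<open>With \<open>x = ln m\<close> and \<open>s = sqrt (m * x)\<close>, the two conditions on
  \<open>M\<close> give \<open>M * x <= s\<close> and \<open>m / M <= 4 * s\<close>. The exponents
  then differ by at least \<open>9 * x * (M + 1)\<close>, over which the powers of
  \<open>1 + 1 / M\<close> grow by \<open>m ^ 9\<close> or more.\<close>

lemma numeric_bound:
  fixes m M b L :: nat
  assumes m: "m \<ge> 2" and L: "2 ^ L > m" "2 ^ L \<le> 2 * m" and M: "M \<ge> 1" "M\<^sup>2 * L \<le> m" "m < (M + 1)\<^sup>2 * L"
    and b: "b \<le> m" "30 * sqrt (real m * ln (real m)) \<le> real b"
  shows "2 * (m + 1) ^ 4 * pw m M (m + 4 + m div M) \<le> pw m M (m + 1 + b)"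
proof -
  define x where "x = ln (real m)"
  define s where "s = sqrt (real m * x)"
  have ln2: "ln 2 \<le> (1::real)" "ln 2 > (1/2::real)" using ln_2_less_1 ln2_ge_two_thirds by simp_all
  have x2: "ln 2 \<le> x" using m by (simp add: x_def)
  have xm: "x \<le> m" unfolding x_def using m by (intro order_trans[OF ln_le_minus_one]) auto
  have x0: "x > 0" using x2 ln2 by linarith
  have Lx: "x \<le> L"
  proof -
    have "real m \<le> real (2 ^ L)" using L(1) unfolding of_nat_le_iff by simp
    then have "x \<le> ln (2 ^ L)" unfolding x_def using m by simp
    also have "\<dots> = L * ln 2" by (simp add: ln_realpow)
    also have "\<dots> \<le> real L * 1" using ln2(1) by (intro mult_left_mono) auto
    finally show ?thesis by simp
  qed
  have L4: "real L \<le> 4 * x"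
  proof -
    have "L * ln 2 = ln (2 ^ L)" by (simp add: ln_realpow)
    also have "\<dots> \<le> ln (2 * real m)"
    proof -
      have "real (2 ^ L) \<le> real (2 * m)" using L(2) unfolding of_nat_le_iff .
      then show ?thesis using m by simp
    qed
    also have "\<dots> = ln 2 + x" using m by (simp add: x_def ln_mult)
    finally have "L * ln 2 \<le> 2 * x" using x2 by simp
    moreover have "real L * (1/2) \<le> L * ln 2" using ln2 by (intro mult_left_mono) auto
    ultimately show ?thesis by simp
  qed
  have Mx: "real M * x \<le> s"
  proof -
    have "(real M)\<^sup>2 * x \<le> (real M)\<^sup>2 * L" using Lx by (intro mult_left_mono) auto
    also have "\<dots> \<le> m" using M(2) by (metis of_nat_le_iff of_nat_mult of_nat_power)
    finally have "(real M)\<^sup>2 * x * x \<le> m * x" using x0 by (intro mult_right_mono) auto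
    then have "(real M * x)\<^sup>2 \<le> m * x" by (simp add: power2_eq_square algebra_simps)
    then show ?thesis unfolding s_def by (rule real_le_rsqrt)
  qed
  have xs: "x \<le> s"
  proof -
    have "1 * x \<le> real M * x" using M x0 by (intro mult_right_mono) auto
    with Mx show ?thesis by simp
  qed
  have s1: "1 \<le> s"
  proof -
    have "1 \<le> real m * x" using m x2 ln2 mult_mono[of 2 "real m" "1/2" x] by simp
    then show ?thesis by (simp add: s_def)
  qed
  have mM: "m / M \<le> 4 * s"
  proof -
    have "real m \<le> (real M + 1)\<^sup>2 * L"
      using M(3) by (metis less_imp_le of_nat_1 of_nat_add of_nat_le_iff of_nat_mult of_nat_power)
    also have "\<dots> \<le> (2 * real M)\<^sup>2 * (4 * x)" using M L4 by (intro mult_mono power_mono) auto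
    finally have "real m * m \<le> (2 * real M)\<^sup>2 * (4 * x) * m" by (intro mult_right_mono) auto
    then have "(m / M)\<^sup>2 \<le> 16 * (m * x)" using M by (simp add: power2_eq_square field_simps)
    also have "\<dots> = (4 * s)\<^sup>2" using x0 m by (simp add: s_def power_mult_distrib)
    finally show ?thesis by (rule power2_le_imp_le) (use s1 in simp)
  qed
  define e where "e = m + 4 + m div M"
  define n where "n = m + 1 + b - e"
  have dM: "real (m div M) \<le> m / M"
  proof -
    have "real (m div M * M) \<le> real m" unfolding of_nat_le_iff by simp
    then show ?thesis using M(1) by (simp add: le_divide_eq)
  qed
  have "real (m div M) + 3 \<le> b" using dM mM s1 b(2) unfolding s_def x_def by linarith
  then have le: "e \<le> m + 1 + b" by (simp add: e_def)
  then have en: "m + 1 + b = e + n" by (simp add: n_def)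
  have rn: "real n = b - 3 - m div M" using en unfolding e_def by linarith
  \<comment> \<open>Of the \<open>30 * s\<close> positions, at most \<open>4 * s\<close> are lost to
    \<open>m div M\<close> and \<open>3 <= 3 * s\<close> to the constants. Twice the needed
    \<open>9 * x * M\<close> makes it possible to pass from \<open>M\<close> to
    \<open>M + 1\<close>.\<close>
  have "18 * x * M \<le> real n"
  proof -
    have "18 * x * M \<le> 18 * s" using Mx by (simp add: mult.commute)
    also have "\<dots> \<le> 30 * s - 3 - 4 * s" using s1 by simp
    also have "\<dots> \<le> real n" using dM mM b(2) unfolding s_def x_def rn by simp
    finally show ?thesis .
  qed
  moreover have "9 * x * 1 \<le> 9 * x * real M" using M(1) x0 by (intro mult_left_mono) auto
  ultimately have "9 * x * (M + 1) \<le> real n" by (simp add: distrib_left)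
  then have nx: "9 * x \<le> real n / (M + 1)" by (simp add: le_divide_eq)
  \<comment> \<open>From \<open>2 <= m\<close> and \<open>m + 1 <= m^2\<close>; this is where the
    exponent \<open>9 = 1 + 2 * 4\<close> comes from.\<close>
  have "2 * (real m + 1) ^ 4 \<le> real m * ((real m)\<^sup>2) ^ 4"
  proof (intro mult_mono power_mono)
    have "2 * real m \<le> real m * real m" using m by (intro mult_right_mono) auto
    then show "real m + 1 \<le> (real m)\<^sup>2" using m unfolding power2_eq_square by linarith
  qed (use m in auto)
  also have "\<dots> = exp (9 * x)"
  proof -
    have "exp (9 * x) = real m ^ 9" using m exp_of_nat_mult[of 9 x] by (simp add: x_def)
    then show ?thesis by (simp add: power_mult[symmetric] flip: power_Suc)
  qed
  also have "\<dots> \<le> exp (n / (M + 1))" using nx by simp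
  also have "\<dots> = exp (1 / (M + 1)) ^ n" by (simp add: exp_of_nat_mult[symmetric])
  also have "\<dots> \<le> (1 + 1 / M) ^ n"
  proof (intro power_mono)
    have "1 - 1 / (real M + 1) \<le> exp (- (1 / (real M + 1)))"
      using exp_ge_add_one_self[of "- (1 / (real M + 1))"] by simp
    moreover have "1 - 1 / (real M + 1) = real M / (real M + 1)" using M by (simp add: field_simps)
    ultimately have "real M / (real M + 1) \<le> inverse (exp (1 / (real M + 1)))" by (simp add: exp_minus)
    then have "exp (1 / (real M + 1)) \<le> (real M + 1) / real M" using M by (simp add: field_simps)
    then show "exp (1 / (M + 1)) \<le> 1 + 1 / M" using M by (simp add: field_simps add.commute)
  qed simp
  finally have "2 * (real m + 1) ^ 4 \<le> (1 + 1 / M) ^ n" .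
  then have "2 * (real m + 1) ^ 4 * (real M ^ (3 * m + 3) * (1 + 1 / M) ^ e)
      \<le> (1 + 1 / M) ^ n * (real M ^ (3 * m + 3) * (1 + 1 / M) ^ e)"
    by (intro mult_right_mono) auto
  also have "\<dots> = real M ^ (3 * m + 3) * (1 + 1 / M) ^ (m + 1 + b)" unfolding en power_add by (simp only: mult_ac)
  finally have "2 * (real m + 1) ^ 4 * real (pw m M e) \<le> real (pw m M (m + 1 + b))"
    using M(1) b(1) le by (subst (1 2) pw_real) auto
  then have "real (2 * (m + 1) ^ 4 * pw m M e) \<le> real (pw m M (m + 1 + b))" by (simp add: add_ac)
  then show ?thesis unfolding e_def of_nat_le_iff .
qed


section \<open>The program\<close>

declare sem.simps(4) [simp del] sum.lessThan_Suc [simp del]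

text \<open>
  Arrays of the program; a scalar is an array of which only entry 0 matters.
  Array 0 is the input.  Loop counters: 1 and 2 manipulators (2 also candidates), 3 thresholds \<open>t\<close>,
  4 candidates (less one inside the search), 5 positions, 6 rounded prices, 7 sweeps, 8 bisection steps.
  Scalars: 10 light weight, 11 sum of the weights, 12 sum of the initial scores, 13 sum of the
  potential weights, 14 and 15 a number \<open>L\<close> and \<open>2 ^ L\<close>, 16 \<open>M\<close>, 17 accumulator, 18 total price,
  19 and 20 the budget of rounded prices and its residue, 21 and 22 new and old expense, 23 potential,
  24 to 26 bounds and midpoint of the bisection, 27 an upper bound standing for infinity,
  28 favoured candidate, 29 dummy.
  Arrays: 30 ranks of the manipulators, 31 potential weights, 32 powers, 33 configurations,
  34 prices, 35 and 36 knapsack table and its choices, 37 response of the current candidate,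
  38 saved configurations, 39 output.
  Row 0 of the configurations is constantly \<open>m + 1\<close>, which sorts the preferred candidate last.
\<close>

abbreviation vr :: "nat \<Rightarrow> hexp" where "vr x \<equiv> HA x (HN 0)"
abbreviation setv :: "nat \<Rightarrow> hexp \<Rightarrow> hprog" where "setv x e \<equiv> HSet x (HN 0) e"
abbreviation noop :: hprog where "noop \<equiv> setv 29 (HN 0)"

definition vm :: hexp where "vm = HA 0 (HN 0)"
definition vk :: hexp where "vk = HA 0 (HN 1)"
definition aE :: "hexp \<Rightarrow> hexp" where "aE j = HA 0 (j [+] HN 2)"
definition sE :: "hexp \<Rightarrow> hexp" where "sE i = HA 0 (i [+] (vm [+] HN 3))"
definition wE :: "hexp \<Rightarrow> hexp" where "wE l = HA 0 (l [+] (HN 2 [*] vm [+] HN 4))"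

text \<open>The language has no Boolean expressions; truncated subtraction yields comparisons with
  values 0 and 1.\<close>

definition leE :: "hexp \<Rightarrow> hexp \<Rightarrow> hexp" where "leE x y = HN 1 [-] (x [-] y)"
definition ltE :: "hexp \<Rightarrow> hexp \<Rightarrow> hexp" where "ltE x y = HN 1 [-] (HN 1 [-] (y [-] x))"
definition neE :: "hexp \<Rightarrow> hexp \<Rightarrow> hexp" where
  "neE x y = HN 1 [-] (HN 1 [-] ((x [-] y) [+] (y [-] x)))"

lemma hval_leE [simp]: "hval (leE x y) h = of_bool (hval x h \<le> hval y h)"
  by (simp add: leE_def)

lemma hval_ltE [simp]: "hval (ltE x y) h = of_bool (hval x h < hval y h)"
  by (simp add: ltE_def)

lemma hval_neE [simp]: "hval (neE x y) h = of_bool (hval x h \<noteq> hval y h)"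
  by (auto simp add: neE_def of_bool_def)

definition hsum :: "nat \<Rightarrow> nat \<Rightarrow> hexp \<Rightarrow> hexp \<Rightarrow> hprog" where
  "hsum x v n e = setv x (HN 0) ;; HFor v n (setv x (vr x [+] e))"

lemma mods_hsum [simp]: "mods (hsum x v n e) = {x, v}"
  by (auto simp: hsum_def)

lemma wf_hsum [simp]: "wf_prog (hsum x v n e) \<longleftrightarrow> x < 61 \<and> v < 61 \<and> wf_exp n \<and> wf_exp e"
  by (auto simp: hsum_def)

lemma wf_exps [simp]:
  "wf_exp vm" "wf_exp vk" "wf_exp (aE e) = wf_exp e" "wf_exp (sE e) = wf_exp e"
  "wf_exp (wE e) = wf_exp e" "wf_exp (leE e f) \<longleftrightarrow> wf_exp e \<and> wf_exp f"
  "wf_exp (ltE e f) \<longleftrightarrow> wf_exp e \<and> wf_exp f" "wf_exp (neE e f) \<longleftrightarrow> wf_exp e \<and> wf_exp f"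
  by (auto simp: vm_def vk_def aE_def sE_def wE_def leE_def ltE_def neE_def)

text \<open>For loops whose iteration count respects \<open>lm\<close>, so that the cap leaves no
  trace in the conclusion.\<close>

lemma sem_for_le:
  assumes "hval e h = n" "n \<le> lm" "I 0 h"
    and "\<And>i g. i < n \<Longrightarrow> I i g \<Longrightarrow> (\<And>A. A \<notin> insert x (mods c) \<Longrightarrow> g A = h A) \<Longrightarrow>
           I (Suc i) (sem cap lm c (upd g x 0 i))"
  shows "I n (sem cap lm (HFor x e c) h)"
proof -
  have n: "min lm (hval e h) = n" using assms(1,2) by simp
  show ?thesis
    using sem_for[where I = I and h = h and cap = cap and lm = lm and x = x and e = e and c = c] assms(3,4)
    unfolding n by blast
qed

lemma sem_hsum:
  assumes "x \<noteq> v" and n: "\<And>g. (\<And>A. A \<noteq> x \<Longrightarrow> g A = h A) \<Longrightarrow> hval nE g = n" "n \<le> lm"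
    and e: "\<And>i g. i < n \<Longrightarrow> (\<And>A. A \<noteq> x \<Longrightarrow> A \<noteq> v \<Longrightarrow> g A = h A) \<Longrightarrow> g v 0 = i \<Longrightarrow> hval e g = f i"
    and le: "(\<Sum>i<n. f i) \<le> cap"
  shows "sem cap lm (hsum x v nE e) h x 0 = (\<Sum>i<n. f i)"
proof -
  let ?h = "upd h x 0 0"
  have part: "(\<Sum>j<Suc i. f j) \<le> cap" if "i < n" for i
    using that by (intro order_trans[OF sum_mono2 le]) auto
  have "sem cap lm (HFor v nE (setv x (vr x [+] e))) ?h x 0 = (\<Sum>i<n. f i)"
  proof (rule sem_for_le[where I = "\<lambda>i g. g x 0 = (\<Sum>j<i. f j)"])
    show "hval nE ?h = n" by (rule n(1)) simp
    fix i g assume i: "i < n" "g x 0 = (\<Sum>j<i. f j)"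
      and fr: "\<And>A. A \<notin> insert v (mods (setv x (vr x [+] e))) \<Longrightarrow> g A = ?h A"
    have "hval e (upd g v 0 i) = f i"
      by (rule e) (use i fr in auto)
    then show "sem cap lm (setv x (vr x [+] e)) (upd g v 0 i) x 0 = (\<Sum>j<Suc i. f j)"
      using i part[of i] assms(1) by (simp add: sum.lessThan_Suc)
  qed (use n in simp_all)
  then show ?thesis by (simp add: hsum_def)
qed


section \<open>Program text: preprocessing\<close>

definition keyE :: "nat \<Rightarrow> hexp" where "keyE x = wE (vr x) [*] vk [+] vr x"

definition rank_prog :: hprog where
  "rank_prog = HFor 1 vk (hsum 17 2 vk (ltE (keyE 1) (keyE 2)) ;; HSet 30 (vr 1) (vr 17))"

definition weight_prog :: hprog where
  "weight_prog =
     hsum 10 1 vk (wE (vr 1) [*] leE vm (HA 30 (vr 1))) ;;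
     HFor 1 vk (HSet 31 (vr 1) (ltE (HA 30 (vr 1)) vm [*] (vr 10 [+] HN 1) [+] leE vm (HA 30 (vr 1)) [*] wE (vr 1))) ;;
     hsum 11 1 vk (wE (vr 1)) ;;
     hsum 12 1 (vm [+] HN 1) (sE (vr 1)) ;;
     hsum 13 1 vk (HA 31 (vr 1))"

text \<open>\<open>L\<close>, the least number with \<open>2 ^ L > m\<close>, replaces the
  logarithm; \<open>M\<close> is then the greatest number with \<open>M^2 * L <= m\<close>. Once
  they have found these values, the loops idle for their remaining rounds.\<close>

definition rate_prog :: hprog where
  "rate_prog =
     setv 14 (HN 0) ;; setv 15 (HN 1) ;;
     HFor 1 (vm [+] HN 1) (HIf (leE (vr 15) vm) (setv 14 (vr 14 [+] HN 1) ;; setv 15 (HN 2 [*] vr 15)) noop) ;;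
     setv 16 (HN 1) ;;
     HFor 1 vm (HIf (leE ((vr 16 [+] HN 1) [*] (vr 16 [+] HN 1) [*] vr 14) vm) (setv 16 (vr 16 [+] HN 1)) noop)"

text \<open>Successive entries have the ratio \<open>(M + 1) / M\<close>. The division is exact,
  since the earlier entry still contains a factor \<open>M\<close>.\<close>

definition power_prog :: hprog where
  "power_prog =
     setv 17 (HN 1) ;;
     HFor 1 (HN 3 [*] vm [+] HN 3) (setv 17 (vr 17 [*] vr 16)) ;;
     HSet 32 (HN 0) (vr 17) ;;
     HFor 1 (HN 3 [*] vm [+] HN 3) (HSet 32 (vr 1 [+] HN 1) (HA 32 (vr 1) [div] vr 16 [*] (vr 16 [+] HN 1)))"

text \<open>Adding a truncated difference computes a maximum: the least score that the worst placed
  candidate can have when all manipulators give it the lowest position.\<close>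

definition bounds_prog :: hprog where
  "bounds_prog =
     setv 27 (HN 2 [*] (vr 12 [+] vr 11 [*] aE vm) [+] HN 1) ;;
     setv 25 (vr 27 [-] HN 1) ;;
     setv 24 (HN 0) ;;
     HFor 4 vm (setv 24 (vr 24 [+] ((sE (vr 4 [+] HN 1) [+] vr 11 [*] aE (HN 0)) [-] vr 24)))"

section \<open>Program text: local search\<close>

definition cE :: "hexp \<Rightarrow> hexp \<Rightarrow> hexp" where "cE i l = HA 33 (i [*] vk [+] l)"
text \<open>A row has \<open>m + 2\<close> entries: the one at \<open>m + 1\<close> holds the empty
  sum from which the suffix sums start.\<close>

definition prE :: "hexp \<Rightarrow> hexp \<Rightarrow> hexp" where "prE l j = HA 34 (l [*] (vm [+] HN 2) [+] j)"
definition kmE :: hexp where "kmE = vk [*] vm"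
definition tabE :: "hexp \<Rightarrow> hexp \<Rightarrow> hexp" where "tabE l x = l [*] (kmE [+] HN 1) [+] x"
definition qE :: "hexp \<Rightarrow> hexp \<Rightarrow> hexp" where "qE l j = prE l j [*] kmE [div] vr 18"
definition cand :: hexp where "cand = vr 4 [+] HN 1"

definition used_prog :: "hexp \<Rightarrow> hprog" where
  "used_prog t = hsum 17 2 vm (leE (cE (vr 2 [+] HN 1) (vr 1)) t)"

text \<open>Thresholds run downwards, so that each price arises from its successor by one
  addition.\<close>

definition price_prog :: hprog where
  "price_prog =
     HFor 1 vk
       (HSet 34 (vr 1 [*] (vm [+] HN 2) [+] (vm [+] HN 1)) (HN 0) ;;
        HFor 3 (vm [+] HN 1)
          (used_prog (vm [-] vr 3) ;;
           HSet 34 (vr 1 [*] (vm [+] HN 2) [+] (vm [-] vr 3))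
             (prE (vr 1) (vm [-] vr 3 [+] HN 1) [+] HA 31 (vr 1) [*]
              HA 32 (vr 17 [-] leE (cE cand (vr 1)) (vm [-] vr 3) [+] vm [-] (vm [-] vr 3))))) ;;
     hsum 18 1 vk (prE (vr 1) (HN 0))"

definition entry_prog :: hprog where
  "entry_prog =
     HSet 35 (tabE (vr 1) (vr 6)) (vr 27) ;;
     HSet 36 (tabE (vr 1) (vr 6)) (HN 0) ;;
     HFor 5 (vm [+] HN 1)
       (HIf (leE (qE (vr 1) (vr 5)) (vr 6) [*]
             ltE (HA 35 (tabE (vr 1 [+] HN 1) (vr 6 [-] qE (vr 1) (vr 5))) [+] wE (vr 1) [*] aE (vr 5))
                 (HA 35 (tabE (vr 1) (vr 6))))
          (HSet 35 (tabE (vr 1) (vr 6))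
             (HA 35 (tabE (vr 1 [+] HN 1) (vr 6 [-] qE (vr 1) (vr 5))) [+] wE (vr 1) [*] aE (vr 5)) ;;
           HSet 36 (tabE (vr 1) (vr 6)) (vr 5))
          noop)"

text \<open>Loops only count upwards; counter 2 is reversed because a row needs that of the next
  manipulator.\<close>

definition table_prog :: hprog where
  "table_prog =
     HFor 6 (kmE [+] HN 1) (HSet 35 (tabE vk (vr 6)) (HN 0)) ;;
     HFor 2 vk (setv 1 (vk [-] HN 1 [-] vr 2) ;; HFor 6 (kmE [+] HN 1) entry_prog)"

text \<open>The budgets of rounded prices are scanned downwards, so the last hit is the least
  one.\<close>

definition trace_prog :: hprog where
  "trace_prog =
     setv 19 kmE ;;
     HFor 6 (kmE [+] HN 1)
       (HIf (leE (HA 35 (kmE [-] vr 6)) (vr 26 [-] sE cand)) (setv 19 (kmE [-] vr 6)) noop) ;;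
     setv 20 (vr 19) ;;
     HFor 1 vk (HSet 37 (vr 1) (HA 36 (tabE (vr 1) (vr 20))) ;; setv 20 (vr 20 [-] qE (vr 1) (HA 37 (vr 1))))"

text \<open>Gains of at most \<open>total / m\<close> are refused, since the number of improvements
  could not be bounded otherwise.\<close>

definition replace_prog :: hprog where
  "replace_prog =
     hsum 21 1 vk (prE (vr 1) (HA 37 (vr 1))) ;;
     hsum 22 1 vk (prE (vr 1) (cE cand (vr 1))) ;;
     HIf (ltE (vr 18) ((vr 22 [-] vr 21) [*] vm))
       (HFor 1 vk (HSet 33 (cand [*] vk [+] vr 1) (HA 37 (vr 1)))) noop"

definition step_prog :: hprog where
  "step_prog = price_prog ;; table_prog ;; trace_prog ;; replace_prog"

text \<open>Candidates start on the lowest position, which respects every bound that is at least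
  \<open>low\<close>. The factor \<open>1 - i\<close> is nonzero only in row 0.\<close>

definition init_prog :: hprog where
  "init_prog = HFor 4 (vm [+] HN 1) (HFor 1 vk
     (HSet 33 (vr 4 [*] vk [+] vr 1) ((HN 1 [-] vr 4) [*] (vm [+] HN 1))))"

definition psi_prog :: hprog where
  "psi_prog =
     setv 23 (HN 0) ;;
     HFor 1 vk (HFor 3 (vm [+] HN 1)
       (used_prog (vr 3) ;;
        setv 23 (vr 23 [+] HA 31 (vr 1) [*] HA 32 (vr 17 [+] vm [-] vr 3))))"

text \<open>One sweep more than the number of improvements that a positive potential
  permits.\<close>

definition search_prog :: hprog where
  "search_prog =
     init_prog ;;
     HFor 7 (HN 4 [*] (vm [*] vm) [+] HN 1) (HFor 4 vm step_prog) ;;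
     psi_prog"

section \<open>Program text: bisection and output\<close>

definition bisect_prog :: hprog where
  "bisect_prog =
     HFor 8 (vr 27)
       (setv 26 ((vr 24 [+] vr 25) [div] HN 2) ;;
        search_prog ;;
        HIf (leE (vr 23) (vr 13 [*] (vm [+] HN 1) [*] HA 32 (vm [+] HN 4 [+] vm [div] vr 16)))
          (setv 25 (vr 26) ;; HFor 1 ((vm [+] HN 1) [*] vk) (HSet 38 (vr 1) (HA 33 (vr 1))))
          (setv 24 (vr 26 [+] HN 1)))"

definition ckE :: "nat \<Rightarrow> hexp" where
  "ckE x = HA 38 (vr x [*] vk [+] vr 1) [*] (vm [+] HN 1) [+] vr x"

definition output_prog :: hprog where
  "output_prog =
     HFor 1 vk
       (setv 28 (HN 1 [+] (HA 30 (vr 1) [-] vm [*] (HA 30 (vr 1) [div] vm))) ;;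
        HFor 4 (vm [+] HN 1)
          (hsum 17 2 (vm [+] HN 1) (ltE (ckE 2) (ckE 4) [*] neE (vr 2) (vr 28)) ;;
           HIf (neE (vr 4) (vr 28))
             (HSet 39 (vr 1 [*] (vm [+] HN 1) [+] vr 4)
               (vr 17 [+] leE (HA 38 (vr 28 [*] vk [+] vr 1)) (vr 17)))
             (HSet 39 (vr 1 [*] (vm [+] HN 1) [+] vr 4) (HA 38 (vr 28 [*] vk [+] vr 1)))))"

definition main_prog :: hprog where
  "main_prog = rank_prog ;; weight_prog ;; rate_prog ;; power_prog ;; bounds_prog ;; bisect_prog ;; output_prog"

lemmas prog_defs = rank_prog_def weight_prog_def rate_prog_def power_prog_def bounds_prog_def
  price_prog_def used_prog_def entry_prog_def table_prog_def trace_prog_def replace_prog_def step_prog_def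
  init_prog_def psi_prog_def search_prog_def bisect_prog_def output_prog_def main_prog_def
  keyE_def cE_def prE_def kmE_def tabE_def qE_def cand_def ckE_def

lemma wf_main_prog: "wf_prog main_prog"
  by (simp add: prog_defs)

lemma mods_progs:
  "mods rank_prog = {1, 2, 17, 30}"
  "mods weight_prog = {1, 10, 11, 12, 13, 31}"
  "mods rate_prog = {1, 14, 15, 16, 29}"
  "mods power_prog = {1, 17, 32}"
  "mods bounds_prog = {4, 24, 25, 27}"
  "mods price_prog = {1, 2, 3, 17, 18, 34}"
  "mods table_prog = {1, 2, 5, 6, 29, 35, 36}"
  "mods trace_prog = {1, 6, 19, 20, 29, 37}"
  "mods replace_prog = {1, 21, 22, 29, 33}"
  "mods init_prog = {1, 4, 33}"
  "mods psi_prog = {1, 2, 3, 17, 23}"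
  by (auto simp: prog_defs)

lemma mods_step_prog: "mods step_prog = {1, 2, 3, 5, 6, 17, 18, 19, 20, 21, 22, 29, 33, 34, 35, 36, 37}"
  by (auto simp: step_prog_def mods_progs)

lemma mods_search_prog:
  "mods search_prog = {1, 2, 3, 4, 5, 6, 7, 17, 18, 19, 20, 21, 22, 23, 29, 33, 34, 35, 36, 37}"
  by (auto simp: search_prog_def mods_progs mods_step_prog)

lemma mods_bisect_prog:
  "mods bisect_prog = {1, 2, 3, 4, 5, 6, 7, 8, 17, 18, 19, 20, 21, 22, 23, 24, 25, 26, 29, 33, 34, 35, 36, 37, 38}"
  by (auto simp: bisect_prog_def mods_search_prog)


text \<open>\<open>V\<close> exceeds each of the listed input quantities, and all values that are
  ever stored stay below \<open>V ^ (3 * m + 20)\<close>. The listed numbers are iteration counts of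
  loops; \<open>V ^ 5 < 2 ^ lm\<close> is for the bisection, whose nominal count is not
  polynomial.\<close>

locale election =
  fixes m k :: nat and a \<sigma> w :: "nat \<Rightarrow> nat" and V cap lm :: nat
  assumes m: "m \<ge> 1"
    and mono: "mono_on {0..m} a"
    and w: "\<And>l. l < k \<Longrightarrow> w l > 0"
    and V: "m + 2 \<le> V" "k + 2 \<le> V" "a m + 2 \<le> V" "(\<Sum>l<k. w l) + 2 \<le> V" "(\<Sum>i<m + 1. \<sigma> i) + 2 \<le> V"
    and cap: "V ^ (3 * m + 20) \<le> cap"
    and lm: "3 * m + 3 \<le> lm" "k \<le> lm" "k * m + 1 \<le> lm" "4 * (m * m) + 1 \<le> lm" "(m + 1) * k \<le> lm"
      "V ^ 5 < 2 ^ lm"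
begin

definition inp :: "store \<Rightarrow> bool" where
  "inp h \<longleftrightarrow> h 0 0 = m \<and> h 0 1 = k \<and> (\<forall>j\<le>m. h 0 (j + 2) = a j) \<and>
     (\<forall>i\<le>m. h 0 (i + (m + 3)) = \<sigma> i) \<and> (\<forall>l<k. h 0 (l + (2 * m + 4)) = w l)"

lemma inp_upd [simp]: "A \<noteq> 0 \<Longrightarrow> inp (upd h A i v) = inp h"
  by (simp add: inp_def)

lemma inp_cong: "inp h \<Longrightarrow> g 0 = h 0 \<Longrightarrow> inp g"
  by (simp add: inp_def)

lemma hval_input [simp]:
  assumes "inp h"
  shows "hval vm h = m" "hval vk h = k"
    "hval e h \<le> m \<Longrightarrow> hval (aE e) h = a (hval e h)"
    "hval e h \<le> m \<Longrightarrow> hval (sE e) h = \<sigma> (hval e h)"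
    "hval e h < k \<Longrightarrow> hval (wE e) h = w (hval e h)"
proof -
  show vm: "hval vm h = m" and "hval vk h = k" using assms by (auto simp: vm_def vk_def inp_def)
  show "hval e h \<le> m \<Longrightarrow> hval (aE e) h = a (hval e h)"
    "hval e h \<le> m \<Longrightarrow> hval (sE e) h = \<sigma> (hval e h)"
    "hval e h < k \<Longrightarrow> hval (wE e) h = w (hval e h)"
    using assms vm by (auto simp: aE_def sE_def wE_def inp_def)
qed

lemma V2: "V \<ge> 2" using V by linarith

lemma power_cap: "x \<le> V ^ n \<Longrightarrow> n \<le> 3 * m + 20 \<Longrightarrow> x \<le> cap"
proof -
  assume x: "x \<le> V ^ n" and n: "n \<le> 3 * m + 20"
  have "V ^ n \<le> V ^ (3 * m + 20)" using V2 n by (intro power_increasing) auto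
  then show "x \<le> cap" using x cap by linarith
qed

lemma V_cap: "x \<le> V \<Longrightarrow> x \<le> cap"
  using power_cap[of x 1] by simp

lemma w_le: "l < k \<Longrightarrow> w l \<le> (\<Sum>l<k. w l)"
  by (intro member_le_sum) auto

lemma lm_simps [simp]: "k \<le> lm" "m \<le> lm" "m + 1 \<le> lm" "Suc m \<le> lm" "3 * m + 3 \<le> lm" "k * m + 1 \<le> lm"
  "k + m * k \<le> lm" "Suc (k * m) \<le> lm" "4 * (m * m) + 1 \<le> lm" "Suc (4 * (m * m)) \<le> lm" "(m + 1) * k \<le> lm"
  using lm by auto

section \<open>Semantics of the preprocessing\<close>

lemma sem_rank_prog:
  assumes "inp h" "l < k"
  shows "sem cap lm rank_prog h 30 l = wrank k w l"
proof -
  have "\<forall>l<k. sem cap lm rank_prog h 30 l = wrank k w l"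
    unfolding rank_prog_def
  proof (rule sem_for_le[where I = "\<lambda>i g. \<forall>l<i. g 30 l = wrank k w l"])
    fix i g assume i: "i < k" and IH: "\<forall>l<i. g 30 l = wrank k w l"
      and fr: "\<And>A. A \<notin> insert 1 (mods (hsum 17 2 vk (ltE (keyE 1) (keyE 2)) ;; HSet 30 (vr 1) (vr 17))) \<Longrightarrow> g A = h A"
    let ?c = "hsum 17 2 vk (ltE (keyE 1) (keyE 2))"
    let ?g = "upd g 1 0 i"
    have inp: "inp ?g" using assms(1) fr[of 0] inp_cong by simp
    have X: "sem cap lm ?c ?g 17 0 = wrank k w i"
      unfolding wrank_def
    proof (rule sem_hsum)
      fix g' assume "\<And>A. A \<noteq> 17 \<Longrightarrow> g' A = ?g A"
      then show "hval vk g' = k" using inp_cong[OF inp, of g'] by simp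
    next
      fix l' g' assume l': "l' < k" "g' 2 0 = l'" and f': "\<And>A. A \<noteq> 17 \<Longrightarrow> A \<noteq> 2 \<Longrightarrow> g' A = ?g A"
      have "inp g'" using inp_cong[OF inp] f' by simp
      moreover have "g' 1 0 = i" using f'[of 1] by simp
      ultimately show "hval (ltE (keyE 1) (keyE 2)) g' = of_bool (wkey k w i < wkey k w l')"
        using l' i by (simp add: keyE_def wkey_def)
    next
      have "(\<Sum>l'<k. of_bool (wkey k w i < wkey k w l')) \<le> (\<Sum>l'<k. 1::nat)" by (intro sum_mono) auto
      then show "(\<Sum>l'<k. of_bool (wkey k w i < wkey k w l')) \<le> cap" using V by (intro V_cap) simp
    qed simp_all
    have Xc: "wrank k w i \<le> cap" 
    proof -
      have "wrank k w i \<le> (\<Sum>l'<k. 1::nat)" unfolding wrank_def by (intro sum_mono) auto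
      then show ?thesis using V by (intro V_cap) simp
    qed
    have fr1: "sem cap lm ?c ?g A = ?g A" if "A \<noteq> 17" "A \<noteq> 2" for A
      by (rule sem_frame) (use that in simp)
    show "\<forall>l<Suc i. sem cap lm (?c ;; HSet 30 (vr 1) (vr 17)) ?g 30 l = wrank k w l"
      using X Xc IH fr1[of 1] fr1[of 30] by (auto simp: less_Suc_eq)
  qed (use assms in simp_all)
  with assms show ?thesis by blast
qed

lemma sem_hsum_inp:
  assumes "x \<noteq> v" "x \<noteq> 0" "v \<noteq> 0" and inp: "inp h" and nE: "\<And>g. inp g \<Longrightarrow> hval nE g = n" and n: "n \<le> lm"
    and e: "\<And>i g. i < n \<Longrightarrow> inp g \<Longrightarrow> (\<And>A. A \<noteq> x \<Longrightarrow> A \<noteq> v \<Longrightarrow> g A = h A) \<Longrightarrow> g v 0 = i \<Longrightarrow> hval e g = f i"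
    and le: "(\<Sum>i<n. f i) \<le> cap"
  shows "sem cap lm (hsum x v nE e) h x 0 = (\<Sum>i<n. f i)"
proof (rule sem_hsum)
  fix g assume "\<And>A. A \<noteq> x \<Longrightarrow> g A = h A"
  then show "hval nE g = n" using inp_cong[OF inp, of g] assms(2) nE by simp
next
  fix i g assume "i < n" "\<And>A. A \<noteq> x \<Longrightarrow> A \<noteq> v \<Longrightarrow> g A = h A" "g v 0 = i"
  then show "hval e g = f i" using inp_cong[OF inp, of g] assms(2,3) by (intro e) auto
qed fact+

lemma light_le_sum: "light m k w \<le> (\<Sum>l<k. w l)"
  unfolding light_def by (intro sum_mono) auto

lemma pweight_V: "l < k \<Longrightarrow> pweight m k w l \<le> V"
  using light_le_sum w_le[of l] V unfolding pweight_def by auto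

lemma sum_pweight_V: "(\<Sum>l<k. pweight m k w l) \<le> V ^ 2"
proof -
  have "(\<Sum>l<k. pweight m k w l) \<le> (\<Sum>l<k. V)" by (intro sum_mono pweight_V) auto
  also have "\<dots> \<le> V * V" using V by (simp add: mult_right_mono)
  finally show ?thesis by (simp add: power2_eq_square)
qed

lemma sem_weight_prog:
  assumes inp: "inp h" and rk: "\<And>l. l < k \<Longrightarrow> h 30 l = wrank k w l"
  defines "h' \<equiv> sem cap lm weight_prog h"
  shows "l < k \<Longrightarrow> h' 31 l = pweight m k w l" "h' 11 0 = (\<Sum>l<k. w l)" "h' 12 0 = (\<Sum>i<m + 1. \<sigma> i)"
    "h' 13 0 = (\<Sum>l<k. pweight m k w l)"
proof -
  let ?c1 = "hsum 10 1 vk (wE (vr 1) [*] leE vm (HA 30 (vr 1)))"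
  let ?b2 = "HSet 31 (vr 1) (ltE (HA 30 (vr 1)) vm [*] (vr 10 [+] HN 1) [+] leE vm (HA 30 (vr 1)) [*] wE (vr 1))"
  define h1 where "h1 = sem cap lm ?c1 h"
  define h2 where "h2 = sem cap lm (HFor 1 vk ?b2) h1"
  define h3 where "h3 = sem cap lm (hsum 11 1 vk (wE (vr 1))) h2"
  define h4 where "h4 = sem cap lm (hsum 12 1 (vm [+] HN 1) (sE (vr 1))) h3"
  have h': "h' = sem cap lm (hsum 13 1 vk (HA 31 (vr 1))) h4"
    by (simp add: h'_def weight_prog_def h1_def h2_def h3_def h4_def)
  have fr: "A \<notin> {10, 1} \<Longrightarrow> h1 A = h A" "A \<notin> {31, 1} \<Longrightarrow> h2 A = h1 A" "A \<notin> {11, 1} \<Longrightarrow> h3 A = h2 A"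
    "A \<notin> {12, 1} \<Longrightarrow> h4 A = h3 A" "A \<notin> {13, 1} \<Longrightarrow> h' A = h4 A" for A
    unfolding h1_def h2_def h3_def h4_def h' by (rule sem_frame, simp)+
  have inps: "inp h1" "inp h2" "inp h3" "inp h4"
    using inp by (auto intro!: inp_cong[OF inp] simp: fr)
  have 1: "h1 10 0 = light m k w"
    unfolding h1_def light_def
  proof (rule sem_hsum_inp[OF _ _ _ inp])
    show "(\<Sum>l<k. w l * of_bool (m \<le> wrank k w l)) \<le> cap"
      using light_le_sum V unfolding light_def by (intro V_cap) linarith
  qed (use rk in auto)
  have "\<forall>l<k. h2 31 l = pweight m k w l" unfolding h2_def
  proof (rule sem_for_le[where I = "\<lambda>i g. \<forall>l<i. g 31 l = pweight m k w l"])
    fix i g assume i: "i < k" and IH: "\<forall>l<i. g 31 l = pweight m k w l"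
      and f: "\<And>A. A \<notin> insert 1 (mods ?b2) \<Longrightarrow> g A = h1 A"
    have g: "inp g" "g 10 0 = light m k w" "g 30 i = wrank k w i"
      using inp_cong[OF inps(1)] f 1 fr(1) rk[OF i] by auto
    then show "\<forall>l<Suc i. sem cap lm ?b2 (upd g 1 0 i) 31 l = pweight m k w l"
      using i IH pweight_V[OF i] V_cap[of "pweight m k w i"] by (auto simp: less_Suc_eq pweight_def)
  qed (use inps in auto)
  then show "l < k \<Longrightarrow> h' 31 l = pweight m k w l" using fr by simp
  have 3: "h3 11 0 = (\<Sum>l<k. w l)" unfolding h3_def
    by (rule sem_hsum_inp[OF _ _ _ inps(2)]) (use V in \<open>auto intro: V_cap\<close>)
  then show "h' 11 0 = (\<Sum>l<k. w l)" using fr by simp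
  have "h4 12 0 = (\<Sum>i<m + 1. \<sigma> i)" unfolding h4_def
    by (rule sem_hsum_inp[OF _ _ _ inps(3)]) (use V V_cap in auto)
  then show "h' 12 0 = (\<Sum>i<m + 1. \<sigma> i)" using fr by simp
  show "h' 13 0 = (\<Sum>l<k. pweight m k w l)" unfolding h'
  proof (rule sem_hsum_inp[OF _ _ _ inps(4)])
    fix i g assume "i < k" "\<And>A. A \<noteq> 13 \<Longrightarrow> A \<noteq> 1 \<Longrightarrow> g A = h4 A" "g 1 0 = i"
    then show "hval (HA 31 (vr 1)) g = pweight m k w i"
      using \<open>\<forall>l<k. h2 31 l = pweight m k w l\<close> fr by simp
  qed (use sum_pweight_V in \<open>auto intro: power_cap[of _ 2]\<close>)
qed

text \<open>\<open>L\<close> plays the role of the binary logarithm of \<open>m\<close>. The bound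
  \<open>M <= m\<close> keeps the powers of \<open>M + 1\<close> below those of
  \<open>V\<close>.\<close>

definition good_rate :: "nat \<Rightarrow> bool" where
  "good_rate M \<longleftrightarrow> M \<ge> 1 \<and> M \<le> m \<and>
     (\<exists>L. m < 2 ^ L \<and> 2 ^ L \<le> 2 * m \<and> M\<^sup>2 * L \<le> m \<and> m < (M + 1)\<^sup>2 * L)"

lemma sem_rate_prog:
  assumes inp: "inp h"
  shows "good_rate (sem cap lm rate_prog h 16 0)"
proof -
  let ?b1 = "HIf (leE (vr 15) vm) (setv 14 (vr 14 [+] HN 1) ;; setv 15 (HN 2 [*] vr 15)) noop"
  let ?b2 = "HIf (leE ((vr 16 [+] HN 1) [*] (vr 16 [+] HN 1) [*] vr 14) vm) (setv 16 (vr 16 [+] HN 1)) noop"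
  let ?P = "\<lambda>g. g 15 0 = 2 ^ g 14 0 \<and> g 15 0 \<le> 2 * m \<and> g 14 0 \<le> m + 1"
  have capm: "2 * m \<le> cap" "m + 1 \<le> cap" "1 \<le> cap"
  proof -
    have "2 * m \<le> V * V" using V by (intro mult_mono) auto
    then show "2 * m \<le> cap" by (intro power_cap[of _ 2]) (auto simp: power2_eq_square)
    show "m + 1 \<le> cap" "1 \<le> cap" using V by (auto intro!: V_cap)
  qed
  define h0 where "h0 = sem cap lm (setv 14 (HN 0) ;; setv 15 (HN 1)) h"
  define h1 where "h1 = sem cap lm (HFor 1 (vm [+] HN 1) ?b1) h0"
  define h2 where "h2 = sem cap lm (setv 16 (HN 1)) h1"
  have res: "sem cap lm rate_prog h = sem cap lm (HFor 1 vm ?b2) h2"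
    by (simp add: rate_prog_def h0_def h1_def h2_def)
  have i0: "inp h0" "inp h1" "inp h2"
    using inp by (auto simp: h0_def h1_def h2_def intro!: inp_cong[OF inp] sem_frame trans[OF sem_frame])
  have "?P h1 \<and> (h1 14 0 = m + 1 \<or> m < h1 15 0)" unfolding h1_def
  proof (rule sem_for_le[where I = "\<lambda>i g. ?P g \<and> (g 14 0 = i \<or> m < g 15 0)"])
    fix i g assume i: "i < m + 1" and IH: "?P g \<and> (g 14 0 = i \<or> m < g 15 0)"
      and f: "\<And>A. A \<notin> insert 1 (mods ?b1) \<Longrightarrow> g A = h0 A"
    have "inp g" using inp_cong[OF i0(1)] f by auto
    then show "?P (sem cap lm ?b1 (upd g 1 0 i)) \<and>
        (sem cap lm ?b1 (upd g 1 0 i) 14 0 = Suc i \<or> m < sem cap lm ?b1 (upd g 1 0 i) 15 0)"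
      using IH i capm by auto
  qed (use i0 capm m in \<open>auto simp: h0_def\<close>)
  \<comment> \<open>The doubling ends before its loop does, because
    \<open>2 ^ m > m\<close>.\<close>
  moreover have "h1 14 0 \<noteq> m + 1"
  proof
    assume "h1 14 0 = m + 1"
    with \<open>?P h1 \<and> _\<close> have "2 ^ (m + 1) \<le> 2 * m" by simp
    then have "2 ^ m \<le> m" by simp
    then show False using less_exp[of m] by simp
  qed
  ultimately obtain L where L: "h1 14 0 = L" "m < 2 ^ L" "2 ^ L \<le> 2 * m" "L \<le> m"
    by auto
  have L1: "L \<ge> 1" using L(2) m by (cases L) auto
  let ?Q = "\<lambda>g. g 16 0 \<ge> 1 \<and> (g 16 0)\<^sup>2 * L \<le> m \<and> g 16 0 \<le> m + 1"
  let ?h = "sem cap lm (HFor 1 vm ?b2) h2"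
  have *: "?Q ?h \<and> (?h 16 0 = m + 1 \<or> m < (?h 16 0 + 1)\<^sup>2 * L)"
  proof (rule sem_for_le[where I = "\<lambda>i g. ?Q g \<and> (g 16 0 = i + 1 \<or> m < (g 16 0 + 1)\<^sup>2 * L)"])
    fix i g assume i: "i < m" and IH: "?Q g \<and> (g 16 0 = i + 1 \<or> m < (g 16 0 + 1)\<^sup>2 * L)"
      and f: "\<And>A. A \<notin> insert 1 (mods ?b2) \<Longrightarrow> g A = h2 A"
    have "inp g" "g 14 0 = L" using inp_cong[OF i0(3)] f L by (auto simp: h2_def)
    then show "?Q (sem cap lm ?b2 (upd g 1 0 i)) \<and> (sem cap lm ?b2 (upd g 1 0 i) 16 0 = Suc i + 1 \<or>
        m < (sem cap lm ?b2 (upd g 1 0 i) 16 0 + 1)\<^sup>2 * L)"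
      using IH i capm by (cases "(g 16 0 + 1)\<^sup>2 * L \<le> m") (auto simp: power2_eq_square)
  qed (use i0 capm m L in \<open>auto simp: h2_def\<close>)
  have sq: "(?h 16 0)\<^sup>2 * 1 \<le> (?h 16 0)\<^sup>2 * L" using L1 by (intro mult_left_mono) auto
  have le: "?h 16 0 \<le> m" 
  proof -
    have "?h 16 0 * 1 \<le> (?h 16 0)\<^sup>2" using * unfolding power2_eq_square by (intro mult_left_mono) auto
    with sq * show ?thesis by linarith
  qed
  then show ?thesis unfolding good_rate_def res using * L by auto
qed

lemma pw_V:
  assumes "M \<le> m" "e \<le> 3 * m + 3"
  shows "pw m M e \<le> V ^ (3 * m + 3)"
proof -
  have "pw m M e \<le> V ^ e * V ^ (3 * m + 3 - e)"
    unfolding pw_def using assms V by (intro mult_mono power_mono) auto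
  then show ?thesis using assms by (simp flip: power_add)
qed

lemma sem_power_prog:
  assumes inp: "inp h" and M: "h 16 0 = M" "M \<ge> 1" "M \<le> m" and e: "e \<le> 3 * m + 3"
  shows "sem cap lm power_prog h 32 e = pw m M e"
proof -
  let ?b1 = "setv 17 (vr 17 [*] vr 16)"
  let ?b2 = "HSet 32 (vr 1 [+] HN 1) (HA 32 (vr 1) [div] vr 16 [*] (vr 16 [+] HN 1))"
  let ?n = "HN 3 [*] vm [+] HN 3"
  define h0 where "h0 = sem cap lm (setv 17 (HN 1)) h"
  define h1 where "h1 = sem cap lm (HFor 1 ?n ?b1) h0"
  define h2 where "h2 = sem cap lm (HSet 32 (HN 0) (vr 17)) h1"
  have res: "sem cap lm power_prog h = sem cap lm (HFor 1 ?n ?b2) h2"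
    by (simp add: power_prog_def h0_def h1_def h2_def)
  have i0: "inp h0" "inp h1" "inp h2"
    using inp by (auto simp: h0_def h1_def h2_def intro!: inp_cong[OF inp] sem_frame trans[OF sem_frame])
  have Mh: "h0 16 0 = M" "h1 16 0 = M" "h2 16 0 = M"
    using M by (auto simp: h0_def h1_def h2_def sem_frame)
  have c1: "1 \<le> cap" using V by (auto intro!: V_cap)
  have Mc: "M ^ i \<le> cap" if "i \<le> 3 * m + 3" for i
  proof (rule power_cap)
    show "M ^ i \<le> V ^ i" using M V by (intro power_mono) auto
  qed (use that in simp)
  have "h1 17 0 = M ^ (3 * m + 3)" unfolding h1_def
  proof (rule sem_for_le[where I = "\<lambda>i g. g 17 0 = M ^ i"])
    fix i g assume i: "i < 3 * m + 3" and IH: "g 17 0 = M ^ i"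
      and f: "\<And>A. A \<notin> insert 1 (mods ?b1) \<Longrightarrow> g A = h0 A"
    then show "sem cap lm ?b1 (upd g 1 0 i) 17 0 = M ^ Suc i"
      using Mc[of "Suc i"] Mh by (simp add: mult.commute)
  qed (use i0 c1 in \<open>auto simp: h0_def\<close>)
  then have h20: "h2 32 0 = pw m M 0" using Mc[of "3 * m + 3"] by (simp add: h2_def pw_def)
  have "\<forall>e\<le>3 * m + 3. sem cap lm (HFor 1 ?n ?b2) h2 32 e = pw m M e"
  proof (rule sem_for_le[where I = "\<lambda>i g. \<forall>e\<le>i. g 32 e = pw m M e"])
    fix i g assume i: "i < 3 * m + 3" and IH: "\<forall>e\<le>i. g 32 e = pw m M e"
      and f: "\<And>A. A \<notin> insert 1 (mods ?b2) \<Longrightarrow> g A = h2 A"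
    have "pw m M i = M * ((M + 1) ^ i * M ^ (3 * m + 3 - Suc i))"
      using i unfolding pw_def by (metis Suc_diff_Suc mult.left_commute power_Suc)
    then have "pw m M i div M * (M + 1) = pw m M (Suc i)" using M(2) by (simp add: pw_def algebra_simps)
    moreover have "pw m M (Suc i) \<le> cap" using pw_V[OF M(3), of "Suc i"] i by (intro power_cap) auto
    moreover have "g 16 0 = M" using f Mh by simp
    ultimately show "\<forall>e\<le>Suc i. sem cap lm ?b2 (upd g 1 0 i) 32 e = pw m M e"
      using IH by (auto simp: le_Suc_eq)
  qed (use i0 h20 in auto)
  with e show ?thesis unfolding res by blast
qed

text \<open>Twice the largest conceivable score, plus one. It serves as infinity in the knapsack
  table, and the factor 2 makes the first midpoint of the bisection at least as large as the
  optimum.\<close>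

definition big :: nat where
  "big = 2 * ((\<Sum>i<m + 1. \<sigma> i) + (\<Sum>l<k. w l) * a m) + 1"

definition low :: nat where
  "low = Max ((\<lambda>i. \<sigma> i + (\<Sum>l<k. w l) * a 0) ` {1..m})"

lemma a_le: "i \<le> j \<Longrightarrow> j \<le> m \<Longrightarrow> a i \<le> a j"
  using mono by (auto simp: mono_on_def)

lemma sigma_le: "i \<le> m \<Longrightarrow> \<sigma> i \<le> (\<Sum>i<m + 1. \<sigma> i)"
  by (intro member_le_sum) auto

lemma big_V: "big + 1 \<le> V ^ 4"
proof -
  have "(\<Sum>i<m + 1. \<sigma> i) + (\<Sum>l<k. w l) * a m + 1 \<le> V + V * (a m)"
  proof -
    have "(\<Sum>l<k. w l) * a m \<le> V * a m" using V(4) by (intro mult_right_mono) auto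
    with V(5) show ?thesis by linarith
  qed
  also have "\<dots> \<le> V * V" using V mult_left_mono[of "a m + 1" V V] by simp
  finally have "big + 1 \<le> 2 * (V * V)" by (simp add: big_def)
  also have "\<dots> \<le> V * V * (V * V)" using V2 mult_mono[of 2 V 1 V] by (intro mult_right_mono) auto
  finally show ?thesis by (simp add: power4_eq_xxxx mult.assoc)
qed

lemma big_cap: "x \<le> big + 1 \<Longrightarrow> x \<le> cap"
  using big_V by (intro power_cap[of _ 4]) auto

lemma base_le: "i \<le> m \<Longrightarrow> \<sigma> i + (\<Sum>l<k. w l) * a 0 \<le> (\<Sum>i<m + 1. \<sigma> i) + (\<Sum>l<k. w l) * a m"
  using sigma_le[of i] a_le[of 0 m] by (intro add_mono mult_left_mono) auto

lemma base_big: "i \<le> m \<Longrightarrow> \<sigma> i + (\<Sum>l<k. w l) * a 0 \<le> big - 1"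
  using base_le[of i] by (simp add: big_def)

lemma sem_bounds_prog:
  assumes inp: "inp h" and h: "h 11 0 = (\<Sum>l<k. w l)" "h 12 0 = (\<Sum>i<m + 1. \<sigma> i)"
  defines "h' \<equiv> sem cap lm bounds_prog h"
  shows "h' 27 0 = big" "h' 25 0 = big - 1" "h' 24 0 = low"
proof -
  let ?b = "setv 24 (vr 24 [+] ((sE (vr 4 [+] HN 1) [+] vr 11 [*] aE (HN 0)) [-] vr 24))"
  define h1 where "h1 = sem cap lm (setv 27 (HN 2 [*] (vr 12 [+] vr 11 [*] aE vm) [+] HN 1) ;;
     setv 25 (vr 27 [-] HN 1) ;; setv 24 (HN 0)) h"
  have h1: "inp h1" "h1 27 0 = big" "h1 25 0 = big - 1" "h1 24 0 = 0" "h1 11 0 = (\<Sum>l<k. w l)"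
    using inp h big_cap[of big] big_cap[of "big - 1"] by (auto simp: h1_def big_def)
  have h': "h' = sem cap lm (HFor 4 vm ?b) h1" by (simp add: h'_def h1_def bounds_prog_def)
  show "h' 27 0 = big" "h' 25 0 = big - 1" using h1 by (auto simp: h' sem_frame)
  let ?f = "\<lambda>i. \<sigma> i + (\<Sum>l<k. w l) * a 0"
  \<comment> \<open>Inserting 0 gives the maximum a value before the first round; it disappears at
    the end since \<open>m >= 1\<close>.\<close>
  have "h' 24 0 = Max (insert 0 (?f ` {1..m}))" unfolding h'
  proof (rule sem_for_le[where I = "\<lambda>i g. g 24 0 = Max (insert 0 (?f ` {1..i}))"])
    fix i g assume i: "i < m" and IH: "g 24 0 = Max (insert 0 (?f ` {1..i}))"
      and f: "\<And>A. A \<notin> insert 4 (mods ?b) \<Longrightarrow> g A = h1 A"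
    have g: "inp g" "g 11 0 = (\<Sum>l<k. w l)" using inp_cong[OF h1(1)] f h1 by auto
    have "Max (insert 0 (?f ` {1..Suc i})) = max (?f (Suc i)) (Max (insert 0 (?f ` {1..i})))"
      by (subst Max_insert[symmetric]) (auto simp: atLeastAtMostSuc_conv insert_commute)
    also have "\<dots> = g 24 0 + (?f (Suc i) - g 24 0)" unfolding IH[symmetric] by (simp add: max_def)
    finally have eq: "Max (insert 0 (?f ` {1..Suc i})) = g 24 0 + (?f (Suc i) - g 24 0)" .
    have "Max (insert 0 (?f ` {1..Suc i})) \<le> big"
    proof (subst Max_le_iff; safe?)
      fix x assume "x \<in> {1..Suc i}"
      then show "?f x \<le> big" using base_big[of x] i by simp
    qed auto
    then have "g 24 0 + (?f (Suc i) - g 24 0) \<le> cap" unfolding eq by (intro big_cap) simp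
    then show "sem cap lm ?b (upd g 4 0 i) 24 0 = Max (insert 0 (?f ` {1..Suc i}))"
      unfolding eq using g i by simp
  qed (use h1 in auto)
  also have "\<dots> = low" unfolding low_def using m by (subst Max_insert) auto
  finally show "h' 24 0 = low" .
qed

end

section \<open>Semantics of one replacement step: prices, table, traceback\<close>

locale searching = election +
  fixes M :: nat
  assumes rate: "good_rate M"

sublocale searching \<subseteq> search m k M "pweight m k w"
  using m rate by unfold_locales (auto simp: good_rate_def)

context searching begin

lemma M_le: "M \<le> m" using rate by (simp add: good_rate_def)

text \<open>The results of the preprocessing that the later stages read but never write.\<close>

definition tabs :: "store \<Rightarrow> bool" where
  "tabs h \<longleftrightarrow> inp h \<and> h 13 0 = (\<Sum>l<k. pweight m k w l) \<and> h 16 0 = M \<and> h 27 0 = big \<and>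
     (\<forall>l<k. h 30 l = wrank k w l) \<and> (\<forall>l<k. h 31 l = pweight m k w l) \<and> (\<forall>e\<le>3 * m + 3. h 32 e = pw m M e)"

lemma tabs_cong:
  "tabs h \<Longrightarrow> g 0 = h 0 \<Longrightarrow> g 13 = h 13 \<Longrightarrow> g 16 = h 16 \<Longrightarrow> g 27 = h 27 \<Longrightarrow> g 30 = h 30 \<Longrightarrow>
    g 31 = h 31 \<Longrightarrow> g 32 = h 32 \<Longrightarrow> tabs g"
  by (simp add: tabs_def inp_def)

lemma tabs_upd [simp]: "A \<notin> {0, 13, 16, 27, 30, 31, 32} \<Longrightarrow> tabs (upd h A i v) = tabs h"
  by (simp add: tabs_def inp_def)

lemma tabs_inp: "tabs h \<Longrightarrow> inp h" by (simp add: tabs_def)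

text \<open>Set to 0 outside the table, so that equal tables give equal functions.\<close>

definition conf :: "store \<Rightarrow> nat \<Rightarrow> nat \<Rightarrow> nat" where
  "conf h i l = (if i \<le> m \<and> l < k then h 33 (i * k + l) else 0)"

lemma conf_cong: "g 33 = h 33 \<Longrightarrow> conf g = conf h"
  by (simp add: conf_def fun_eq_iff)

lemma hval_cE [simp]:
  "inp h \<Longrightarrow> hval i h \<le> m \<Longrightarrow> hval l h < k \<Longrightarrow> hval (cE i l) h = conf h (hval i h) (hval l h)"
  by (simp add: cE_def conf_def)

definition prc :: "store \<Rightarrow> nat \<Rightarrow> nat \<Rightarrow> nat" where
  "prc h l j = h 34 (l * (m + 2) + j)"

lemma hval_prE [simp]: "inp h \<Longrightarrow> hval (prE l j) h = prc h (hval l h) (hval j h)"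
  by (simp add: prE_def prc_def)

definition idx :: "nat \<Rightarrow> nat \<Rightarrow> nat" where "idx l x = l * (k * m + 1) + x"

lemma idx_inj: "x \<le> k * m \<Longrightarrow> y \<le> k * m \<Longrightarrow> idx l x = idx l' y \<longleftrightarrow> l = l' \<and> x = y"
  unfolding idx_def using mult_add_inj[of l "k * m + 1" x l' y] by auto

lemma hval_kmE [simp]: "inp h \<Longrightarrow> hval kmE h = k * m"
  by (simp add: kmE_def)

lemma hval_tabE [simp]: "inp h \<Longrightarrow> hval (tabE l x) h = idx (hval l h) (hval x h)"
  by (simp add: tabE_def idx_def)

definition qq :: "store \<Rightarrow> nat \<Rightarrow> nat \<Rightarrow> nat" where
  "qq h l j = prc h l j * (k * m) div h 18 0"

lemma hval_qE [simp]: "inp h \<Longrightarrow> hval (qE l j) h = qq h (hval l h) (hval j h)"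
  by (simp add: qE_def qq_def)

lemma qq_cong: "g 34 = h 34 \<Longrightarrow> g 18 = h 18 \<Longrightarrow> qq g = qq h"
  by (simp add: qq_def prc_def fun_eq_iff)

lemma hval_cand [simp]: "hval cand h = h 4 0 + 1"
  by (simp add: cand_def)

lemma mods_used_prog [simp]: "mods (used_prog t) = {17, 2}"
  by (simp add: used_prog_def)

lemma sem_used_prog:
  assumes inp: "inp h" and l: "h 1 0 = l" "l < k"
    and t: "\<And>g. inp g \<Longrightarrow> (\<And>A. A \<noteq> 17 \<Longrightarrow> A \<noteq> 2 \<Longrightarrow> g A = h A) \<Longrightarrow> hval te g = t"
  shows "sem cap lm (used_prog te) h 17 0 = used (conf h) l t"
proof -
  have eq: "used (conf h) l t = (\<Sum>i<m. of_bool (conf h (Suc i) l \<le> t))"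
    unfolding used_def One_nat_def by (rule sum.atLeast1_atMost_eq)
  show ?thesis unfolding eq used_prog_def
  proof (rule sem_hsum_inp[OF _ _ _ inp])
    fix i g assume *: "i < m" "inp g" "\<And>A. A \<noteq> 17 \<Longrightarrow> A \<noteq> 2 \<Longrightarrow> g A = h A" "g 2 0 = i"
    then have "conf g = conf h" by (intro conf_cong) auto
    then show "hval (leE (cE (vr 2 [+] HN 1) (vr 1)) te) g = of_bool (conf h (Suc i) l \<le> t)"
      using * l t[OF *(2,3)] by simp
  next
    have "(\<Sum>i<m. of_bool (conf h (Suc i) l \<le> t)) \<le> m" using used_le[of "conf h" l t] unfolding eq .
    then show "(\<Sum>i<m. of_bool (conf h (Suc i) l \<le> t)) \<le> cap" using V by (intro V_cap) linarith
  qed (use inp in auto)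
qed

lemma others_index: "others C i l t + m - t \<le> 3 * m + 3"
  using used_le[of C l t] by (simp add: others_def)

lemma price_V: "l < k \<Longrightarrow> price C i l j \<le> V ^ (3 * m + 5)"
proof -
  assume l: "l < k"
  have "price C i l j \<le> (\<Sum>t\<in>{j..m}. V * V ^ (3 * m + 3))"
    unfolding price_def phi_def by (intro sum_mono mult_mono pw_V M_le pweight_V l others_index) auto
  also have "\<dots> \<le> V * (V * V ^ (3 * m + 3))" using V by (simp add: mult_le_mono1)
  finally show ?thesis by (simp add: numeral_eq_Suc)
qed

lemma price_step: "t \<le> m \<Longrightarrow> price C i l t = phi C i l t + price C i l (Suc t)"
  unfolding price_def by (rule sum.atLeast_Suc_atMost)

lemma sum_price_V: "(\<Sum>l<k. price C i l (c l)) \<le> V ^ (3 * m + 6)"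
proof -
  have "(\<Sum>l<k. price C i l (c l)) \<le> (\<Sum>l<k. V ^ (3 * m + 5))" by (intro sum_mono price_V) auto
  also have "\<dots> \<le> V * V ^ (3 * m + 5)" using V by (simp add: mult_le_mono1)
  finally show ?thesis by (simp add: numeral_eq_Suc)
qed

lemma sem_price_prog:
  assumes tabs: "tabs h" and i: "h 4 0 = i" "i < m"
  defines "h' \<equiv> sem cap lm price_prog h"
  shows "\<And>l t. l < k \<Longrightarrow> t \<le> m \<Longrightarrow> prc h' l t = price (conf h) (Suc i) l t"
    "h' 18 0 = total (conf h) (Suc i)"
proof -
  let ?C = "conf h"
  let ?u = "used_prog (vm [-] vr 3)"
  let ?s = "HSet 34 (vr 1 [*] (vm [+] HN 2) [+] (vm [-] vr 3))
             (prE (vr 1) (vm [-] vr 3 [+] HN 1) [+] HA 31 (vr 1) [*]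
              HA 32 (vr 17 [-] leE (cE cand (vr 1)) (vm [-] vr 3) [+] vm [-] (vm [-] vr 3)))"
  let ?z = "HSet 34 (vr 1 [*] (vm [+] HN 2) [+] (vm [+] HN 1)) (HN 0)"
  let ?b = "?z ;; HFor 3 (vm [+] HN 1) (?u ;; ?s)"
  define h1 where "h1 = sem cap lm (HFor 1 vk ?b) h"
  have h': "h' = sem cap lm (hsum 18 1 vk (prE (vr 1) (HN 0))) h1"
    by (simp add: h'_def price_prog_def h1_def)
  have *: "\<forall>l<k. \<forall>t\<le>m + 1. prc h1 l t = price ?C (Suc i) l t" unfolding h1_def
  proof (rule sem_for_le[where I = "\<lambda>n g. \<forall>l<n. \<forall>t\<le>m + 1. prc g l t = price ?C (Suc i) l t"])
    fix l g assume l: "l < k" and IH: "\<forall>l'<l. \<forall>t\<le>m + 1. prc g l' t = price ?C (Suc i) l' t"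
      and f: "\<And>A. A \<notin> insert 1 (mods ?b) \<Longrightarrow> g A = h A"
    define g0 where "g0 = sem cap lm ?z (upd g 1 0 l)"
    have tg: "tabs g" by (rule tabs_cong[OF tabs]) (use f in auto)
    have g0: "tabs g0" "g0 1 0 = l" "g0 33 = h 33" "g0 4 0 = i"
      using tg tabs_inp[OF tg] f i by (auto simp: g0_def)
    have g0p: "prc g0 l (m + 1) = price ?C (Suc i) l (m + 1)" "\<forall>l'<l. \<forall>t\<le>m + 1. prc g0 l' t = price ?C (Suc i) l' t"
    proof -
      have ne: "l' * (m + 2) + t \<noteq> l * (m + 2) + (m + 1)" if "l' < l" "t \<le> m + 1" for l' t
        using mult_add_less[of l' l t "m + 2" "m + 1"] that by linarith
      show "prc g0 l (m + 1) = price ?C (Suc i) l (m + 1)"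
        using tabs_inp[OF tg] by (simp add: g0_def prc_def price_def)
      show "\<forall>l'<l. \<forall>t\<le>m + 1. prc g0 l' t = price ?C (Suc i) l' t"
      proof safe
        fix l' t assume "l' < l" "t \<le> m + 1"
        then show "prc g0 l' t = price ?C (Suc i) l' t"
          using IH ne[of l' t] tabs_inp[OF tg] by (simp add: g0_def prc_def)
      qed
    qed
    \<comment> \<open>After \<open>n\<close> rounds row \<open>l\<close> is correct from threshold
      \<open>m + 1 - n\<close> on; the rows before it are complete and must stay intact.\<close>
    let ?I = "\<lambda>n g. \<forall>l'\<le>l. \<forall>t\<le>m + 1. (l' = l \<longrightarrow> m + 1 - n \<le> t) \<longrightarrow> prc g l' t = price ?C (Suc i) l' t"
    have "?I (m + 1) (sem cap lm (HFor 3 (vm [+] HN 1) (?u ;; ?s)) g0)"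
    proof (rule sem_for_le[where I = ?I])
      fix n g1 assume n: "n < m + 1" and IH': "?I n g1"
        and f': "\<And>A. A \<notin> insert 3 (mods (?u ;; ?s)) \<Longrightarrow> g1 A = g0 A"
      define g2 where "g2 = sem cap lm ?u (upd g1 3 0 n)"
      have t1: "tabs g1" by (rule tabs_cong[OF g0(1)]) (use f' in auto)
      have f2: "A \<noteq> 17 \<Longrightarrow> A \<noteq> 2 \<Longrightarrow> g2 A = upd g1 3 0 n A" for A
        unfolding g2_def by (rule sem_frame) simp
      have t2: "tabs g2" by (rule tabs_cong[OF t1]) (use f2 in auto)
      have g2: "g2 1 0 = l" "g2 4 0 = i" "conf g2 = ?C" "g2 3 0 = n" "g2 34 = g1 34"
        using f2 f' g0 by (auto intro: conf_cong)
      have "conf (upd g1 3 0 n) = ?C" using f' g0 by (intro conf_cong) auto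
      then have u: "g2 17 0 = used ?C l (m - n)" unfolding g2_def
        by (subst sem_used_prog[where l = l and t = "m - n"]) (use tabs_inp[OF t1] f' g0 l in auto)
      have e: "hval (prE (vr 1) (vm [-] vr 3 [+] HN 1) [+] HA 31 (vr 1) [*]
              HA 32 (vr 17 [-] leE (cE cand (vr 1)) (vm [-] vr 3) [+] vm [-] (vm [-] vr 3))) g2
          = prc g1 l (Suc (m - n)) + phi ?C (Suc i) l (m - n)"
      proof -
        have "others ?C (Suc i) l (m - n) + m - (m - n) \<le> 3 * m + 3"
          using used_le[of ?C l "m - n"] by (simp add: others_def)
        then show ?thesis
          using t2 tabs_inp[OF t2] g2 u l i(2) by (simp add: phi_def others_def tabs_def prc_def)
      qed
      have "prc g1 l (Suc (m - n)) = price ?C (Suc i) l (Suc (m - n))" using IH' n by auto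
      then have v: "hval (prE (vr 1) (vm [-] vr 3 [+] HN 1) [+] HA 31 (vr 1) [*]
              HA 32 (vr 17 [-] leE (cE cand (vr 1)) (vm [-] vr 3) [+] vm [-] (vm [-] vr 3))) g2
          = price ?C (Suc i) l (m - n)" unfolding e using price_step[of "m - n"] by simp
      have "sem cap lm (?u ;; ?s) (upd g1 3 0 n) = upd g2 34 (l * (m + 2) + (m - n)) (price ?C (Suc i) l (m - n))"
      proof -
        have "price ?C (Suc i) l (m - n) \<le> cap" using price_V[OF l] by (rule power_cap) simp
        then show ?thesis
          using v tabs_inp[OF t2] g2 by (simp add: g2_def[symmetric] del: hval.simps(3-6)) (simp add: tabs_inp[OF t2] g2)
      qed
      define g3 where "g3 = sem cap lm (?u ;; ?s) (upd g1 3 0 n)"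
      have "g3 = upd g2 34 (l * (m + 2) + (m - n)) (price ?C (Suc i) l (m - n))"
        unfolding g3_def by fact
      then have new: "prc g3 l' t =
          (if l' = l \<and> t = m - n then price ?C (Suc i) l (m - n) else prc g1 l' t)" if "t \<le> m + 1" for l' t
        using mult_add_inj[of l' "m + 2" t l "m - n"] that g2(5) by (auto simp: prc_def)
      show "?I (Suc n) (sem cap lm (?u ;; ?s) (upd g1 3 0 n))"
        using IH' n unfolding g3_def[symmetric] by (auto simp: new Suc_diff_le)
    next
      show "?I 0 g0"
      proof (intro allI impI)
        fix l' t assume "l' \<le> l" "t \<le> m + 1" "l' = l \<longrightarrow> m + 1 - 0 \<le> t"
        then show "prc g0 l' t = price ?C (Suc i) l' t" using g0p by (cases "l' = l") auto
      qed
    qed (use tabs_inp[OF g0(1)] in auto)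
    then show "\<forall>l'<Suc l. \<forall>t\<le>m + 1. prc (sem cap lm ?b (upd g 1 0 l)) l' t = price ?C (Suc i) l' t"
      by (simp add: g0_def less_Suc_eq_le)
  qed (use tabs_inp[OF tabs] in auto)
  have "inp h1" using tabs by (auto intro!: inp_cong[OF tabs_inp[OF tabs]] sem_frame simp: h1_def)
  have "h' 34 = h1 34" unfolding h' by (rule sem_frame) simp
  then show "\<And>l t. l < k \<Longrightarrow> t \<le> m \<Longrightarrow> prc h' l t = price ?C (Suc i) l t" using * by (simp add: prc_def)
  show "h' 18 0 = total ?C (Suc i)" unfolding h' total_def
  proof (rule sem_hsum_inp[OF _ _ _ \<open>inp h1\<close>])
    fix l g assume "l < k" "inp g" "\<And>A. A \<noteq> 18 \<Longrightarrow> A \<noteq> 1 \<Longrightarrow> g A = h1 A" "g 1 0 = l"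
    then show "hval (prE (vr 1) (HN 0)) g = price ?C (Suc i) l 0"
      using *[rule_format, of l 0] by (simp add: prc_def)
  qed (use sum_price_V[of ?C "Suc i" "\<lambda>_. 0"] in \<open>auto intro: power_cap[of _ "3 * m + 6"]\<close>)
qed

text \<open>Both halves of the knapsack recursion at one entry: no choice beats it, and unless it is
  infinite the recorded choice attains it.\<close>

definition entry_ok :: "store \<Rightarrow> nat \<Rightarrow> nat \<Rightarrow> bool" where
  "entry_ok g l P \<longleftrightarrow> g 36 (idx l P) \<le> m \<and>
     (\<forall>j\<le>m. qq g l j \<le> P \<longrightarrow> g 35 (idx l P) \<le> g 35 (idx (Suc l) (P - qq g l j)) + w l * a j) \<and>
     (g 35 (idx l P) \<ge> big \<or> qq g l (g 36 (idx l P)) \<le> P \<and>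
        g 35 (idx l P) = g 35 (idx (Suc l) (P - qq g l (g 36 (idx l P)))) + w l * a (g 36 (idx l P)))"

lemma mods_entry_prog: "mods entry_prog = {5, 29, 35, 36}"
  by (auto simp: entry_prog_def)

lemma sem_entry_prog:
  assumes tabs: "tabs h" and l: "h 1 0 = l" "l < k" and P: "h 6 0 = P" "P \<le> k * m"
  defines "h' \<equiv> sem cap lm entry_prog h"
  shows "entry_ok h' l P" "\<And>z. z \<noteq> idx l P \<Longrightarrow> h' 35 z = h 35 z" "\<And>z. z \<noteq> idx l P \<Longrightarrow> h' 36 z = h 36 z"
proof -
  let ?q = "qq h l" and ?x = "idx l P"
  let ?F = "\<lambda>j. h 35 (idx (Suc l) (P - ?q j)) + w l * a j"
  let ?e = "HA 35 (tabE (vr 1 [+] HN 1) (vr 6 [-] qE (vr 1) (vr 5))) [+] wE (vr 1) [*] aE (vr 5)"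
  let ?b = "HIf (leE (qE (vr 1) (vr 5)) (vr 6) [*] ltE ?e (HA 35 (tabE (vr 1) (vr 6))))
          (HSet 35 (tabE (vr 1) (vr 6)) ?e ;; HSet 36 (tabE (vr 1) (vr 6)) (vr 5)) noop"
  define h1 where "h1 = sem cap lm (HSet 35 (tabE (vr 1) (vr 6)) (vr 27) ;; HSet 36 (tabE (vr 1) (vr 6)) (HN 0)) h"
  have h': "h' = sem cap lm (HFor 5 (vm [+] HN 1) ?b) h1"
    by (simp add: h'_def entry_prog_def h1_def)
  have bc: "big \<le> cap" by (rule big_cap) simp
  have h1: "tabs h1" "h1 35 = (h 35)(?x := big)" "h1 36 = (h 36)(?x := 0)"
    "A \<noteq> 35 \<Longrightarrow> A \<noteq> 36 \<Longrightarrow> h1 A = h A" for A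
    using tabs tabs_inp[OF tabs] l P bc by (auto simp: h1_def tabs_def)
  have ne: "idx (Suc l) y \<noteq> ?x" if "y \<le> k * m" for y using idx_inj[OF that P(2)] by simp
  \<comment> \<open>A running minimum over the choices tried so far, with a witness as soon as it is
    finite. Row \<open>Suc l\<close> is among the untouched entries, so the candidates for the
    minimum do not change during the loop.\<close>
  let ?I = "\<lambda>n g. (\<forall>z. z \<noteq> ?x \<longrightarrow> g 35 z = h 35 z \<and> g 36 z = h 36 z) \<and> g 35 ?x \<le> big \<and>
     (\<forall>j<n. ?q j \<le> P \<longrightarrow> g 35 ?x \<le> ?F j) \<and>
     g 36 ?x \<le> m \<and> (g 35 ?x = big \<or> ?q (g 36 ?x) \<le> P \<and> g 35 ?x = ?F (g 36 ?x))"
  have *: "?I (m + 1) h'" unfolding h'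
  proof (rule sem_for_le[where I = ?I])
    fix j g assume j: "j < m + 1" and IH: "?I j g" and f: "\<And>A. A \<notin> insert 5 (mods ?b) \<Longrightarrow> g A = h1 A"
    let ?g = "upd g 5 0 j"
    have tg: "tabs g" by (rule tabs_cong[OF h1(1)]) (use f in auto)
    have q: "qq ?g = qq h" using f h1(4) by (intro qq_cong) auto
    have v: "?g 1 0 = l" "?g 6 0 = P" "?g 5 0 = j" using f h1(4) l P by auto
    have inp: "inp ?g" using tabs_inp[OF tg] by simp
    have e: "hval ?e ?g = ?F j"
      using inp v q j l(2) IH ne[of "P - ?q j"] P(2) by simp
    have c: "hval (leE (qE (vr 1) (vr 5)) (vr 6) [*] ltE ?e (HA 35 (tabE (vr 1) (vr 6)))) ?g
        = of_bool (?q j \<le> P) * of_bool (?F j < g 35 ?x)"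
      using inp v q e by simp
    show "?I (Suc j) (sem cap lm ?b ?g)"
    proof (cases "?q j \<le> P \<and> ?F j < g 35 ?x")
      case True
      then have "?F j \<le> cap" "j \<le> cap" using IH bc j V_cap[of j] V by auto
      then have "sem cap lm ?b ?g = upd (upd ?g 35 ?x (?F j)) 36 ?x j"
        using True c e inp v by (simp del: hval.simps(3-6))
      then show ?thesis using True IH j by (auto simp: less_Suc_eq)
    next
      case False
      then have "sem cap lm ?b ?g = upd ?g 29 0 0" using c by auto
      then show ?thesis using False IH by (auto simp: less_Suc_eq)
    qed
  qed (use h1 tabs_inp[OF h1(1)] in auto)
  have "qq h' = qq h" unfolding h'_def by (intro qq_cong sem_frame) (auto simp: mods_entry_prog)
  then show "entry_ok h' l P" using * ne P(2) by (auto simp: entry_ok_def)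
  show "\<And>z. z \<noteq> ?x \<Longrightarrow> h' 35 z = h 35 z" "\<And>z. z \<noteq> ?x \<Longrightarrow> h' 36 z = h 36 z" using * by auto
qed

lemma entry_ok_cong:
  assumes "entry_ok g l P" "P \<le> k * m" "g' 34 = g 34" "g' 18 = g 18"
    and "\<And>x. x \<le> k * m \<Longrightarrow> g' 35 (idx (Suc l) x) = g 35 (idx (Suc l) x)"
    and "g' 35 (idx l P) = g 35 (idx l P)" "g' 36 (idx l P) = g 36 (idx l P)"
  shows "entry_ok g' l P"
proof -
  have "qq g' = qq g" using assms(3,4) by (rule qq_cong)
  then show ?thesis using assms unfolding entry_ok_def by (auto simp: le_diff_conv)
qed

text \<open>An entry depends only on the row of the next manipulator, which is complete when the
  entry is computed; later writes touch neither of them.\<close>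

lemma sem_table_prog:
  assumes tabs: "tabs h"
  defines "h' \<equiv> sem cap lm table_prog h"
  shows "\<And>P. P \<le> k * m \<Longrightarrow> h' 35 (idx k P) = 0" "\<And>l P. l < k \<Longrightarrow> P \<le> k * m \<Longrightarrow> entry_ok h' l P"
proof -
  let ?d = "HSet 35 (tabE vk (vr 6)) (HN 0)"
  let ?s = "setv 1 (vk [-] HN 1 [-] vr 2)"
  let ?b = "?s ;; HFor 6 (kmE [+] HN 1) entry_prog"
  define h1 where "h1 = sem cap lm (HFor 6 (kmE [+] HN 1) ?d) h"
  have h': "h' = sem cap lm (HFor 2 vk ?b) h1" by (simp add: h'_def table_prog_def h1_def)
  have t1: "tabs h1" unfolding h1_def by (rule tabs_cong[OF tabs]; rule sem_frame; simp)
  have base: "\<forall>P<k * m + 1. h1 35 (idx k P) = 0" unfolding h1_def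
  proof (rule sem_for_le[where I = "\<lambda>n g. \<forall>P<n. g 35 (idx k P) = 0"])
    fix n g assume n: "n < k * m + 1" and IH: "\<forall>P<n. g 35 (idx k P) = 0"
      and f: "\<And>A. A \<notin> insert 6 (mods ?d) \<Longrightarrow> g A = h A"
    have "inp g" using inp_cong[OF tabs_inp[OF tabs]] f by auto
    then show "\<forall>P<Suc n. sem cap lm ?d (upd g 6 0 n) 35 (idx k P) = 0"
      using IH by (auto simp: less_Suc_eq)
  qed (use tabs_inp[OF tabs] in auto)
  let ?I = "\<lambda>n g. (\<forall>P\<le>k * m. g 35 (idx k P) = 0) \<and>
      (\<forall>l P. l < k \<longrightarrow> P \<le> k * m \<longrightarrow> k - n \<le> l \<longrightarrow> entry_ok g l P)"
  have "?I k h'" unfolding h'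
  proof (rule sem_for_le[where I = ?I])
    fix n g assume n: "n < k" and IH: "?I n g" and f: "\<And>A. A \<notin> insert 2 (mods ?b) \<Longrightarrow> g A = h1 A"
    define g0 where "g0 = sem cap lm ?s (upd g 2 0 n)"
    define l where "l = k - 1 - n"
    have l: "l < k" "k - n = Suc l" "k - Suc n = l" using n by (auto simp: l_def)
    have tg: "tabs g" by (rule tabs_cong[OF t1]) (use f in \<open>auto simp: mods_entry_prog\<close>)
    have lc: "l \<le> cap" using l V by (intro V_cap) auto
    have g0: "tabs g0" "g0 1 0 = l" "g0 35 = g 35" "g0 36 = g 36" "g0 34 = g 34" "g0 18 = g 18"
      using tg tabs_inp[OF tg] lc by (auto simp: g0_def l_def)
    let ?J = "\<lambda>n g. (\<forall>P\<le>k * m. g 35 (idx k P) = 0) \<and>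
      (\<forall>l' P. l' < k \<longrightarrow> P \<le> k * m \<longrightarrow> l < l' \<or> (l' = l \<and> P < n) \<longrightarrow> entry_ok g l' P)"
    have "?J (k * m + 1) (sem cap lm (HFor 6 (kmE [+] HN 1) entry_prog) g0)"
    proof (rule sem_for_le[where I = ?J])
      show "?J 0 g0"
      proof safe
        fix P assume "P \<le> k * m" then show "g0 35 (idx k P) = 0" using IH g0 by simp
      next
        fix l' P assume a: "l' < k" "P \<le> k * m" "l < l'"
        then have ok: "entry_ok g l' P" using IH l by simp
        show "entry_ok g0 l' P" by (rule entry_ok_cong[of g]) (use ok a g0 in auto)
      qed
      fix P g1 assume P: "P < k * m + 1" and IH': "?J P g1"
        and f': "\<And>A. A \<notin> insert 6 (mods entry_prog) \<Longrightarrow> g1 A = g0 A"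
      let ?g = "upd g1 6 0 P"
      let ?h = "sem cap lm entry_prog ?g"
      have "tabs g1" by (rule tabs_cong[OF g0(1)]) (use f' in \<open>auto simp: mods_entry_prog\<close>)
      then have tt: "tabs ?g" "?g 1 0 = l" "?g 6 0 = P" "P \<le> k * m"
        using f' g0 P by (auto simp: mods_entry_prog)
      note E = sem_entry_prog[OF tt(1,2) l(1) tt(3,4)]
      have fr: "?h 34 = g1 34" "?h 18 = g1 18" using sem_frame[of _ entry_prog cap lm ?g] by (auto simp: mods_entry_prog)
      show "?J (Suc P) ?h"
      proof safe
        fix y assume y: "y \<le> k * m"
        have "idx k y \<noteq> idx l P" using idx_inj[OF y tt(4)] l by auto
        then show "?h 35 (idx k y) = 0" using E(2) IH' y by simp
      next
        fix l' y assume a: "l' < k" "y \<le> k * m" "l < l'"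
        have ne: "idx l' y \<noteq> idx l P" "\<And>z. z \<le> k * m \<Longrightarrow> idx (Suc l') z \<noteq> idx l P"
          using idx_inj[OF _ tt(4)] a by auto
        have ok: "entry_ok g1 l' y" using IH' a by simp
        show "entry_ok ?h l' y" by (rule entry_ok_cong[of g1]) (use ok ne E a fr in auto)
      next
        fix y assume a: "y \<le> k * m" "y < Suc P"
        show "entry_ok ?h l y"
        proof (cases "y = P")
          case False
          then have ne: "idx l y \<noteq> idx l P" "\<And>z. z \<le> k * m \<Longrightarrow> idx (Suc l) z \<noteq> idx l P"
            using idx_inj[OF _ tt(4)] a by auto
          have ok: "entry_ok g1 l y" using IH' a l False by auto
          show ?thesis by (rule entry_ok_cong[of g1]) (use ok ne E a fr in auto)
        qed (use E in simp)
      qed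
    qed (use tabs_inp[OF g0(1)] in auto)
    then have J: "?J (k * m + 1) (sem cap lm ?b (upd g 2 0 n))" unfolding g0_def sem.simps(2) .
    show "?I (Suc n) (sem cap lm ?b (upd g 2 0 n))"
    proof (intro conjI allI impI)
      fix l' P assume "l' < k" "P \<le> k * m" "k - Suc n \<le> l'"
      moreover from this have "l < l' \<or> l' = l \<and> P < k * m + 1" unfolding l(3) by auto
      ultimately show "entry_ok (sem cap lm ?b (upd g 2 0 n)) l' P" using J by blast
    qed (use J in blast)
  qed (use base tabs_inp[OF t1] in \<open>auto simp: less_Suc_eq_le\<close>)
  then show "\<And>P. P \<le> k * m \<Longrightarrow> h' 35 (idx k P) = 0" "\<And>l P. l < k \<Longrightarrow> P \<le> k * m \<Longrightarrow> entry_ok h' l P"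
    by auto
qed

text \<open>The sequence \<open>R\<close> of the abstract knapsack argument, read off the
  table.\<close>

primrec residue :: "store \<Rightarrow> nat \<Rightarrow> nat" where
  "residue h 0 = h 19 0"
| "residue h (Suc l) = residue h l - qq h l (h 36 (idx l (residue h l)))"

lemma sem_trace_prog:
  assumes tabs: "tabs h" and i: "h 4 0 = i" "i < m"
    and J: "\<And>l P. l < k \<Longrightarrow> P \<le> k * m \<Longrightarrow> h 36 (idx l P) \<le> cap"
  defines "h' \<equiv> sem cap lm trace_prog h" and "bud \<equiv> h 26 0 - \<sigma> (Suc i)"
  shows "h' 19 0 \<le> k * m" "\<And>P. P < h' 19 0 \<Longrightarrow> bud < h 35 (idx 0 P)"
    "(\<exists>P\<le>k * m. h 35 (idx 0 P) \<le> bud) \<Longrightarrow> h 35 (idx 0 (h' 19 0)) \<le> bud"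
    "\<And>l. l < k \<Longrightarrow> h' 37 l = h 36 (idx l (residue h' l))"
proof -
  let ?b = "HIf (leE (HA 35 (kmE [-] vr 6)) (vr 26 [-] sE cand)) (setv 19 (kmE [-] vr 6)) noop"
  let ?c = "HSet 37 (vr 1) (HA 36 (tabE (vr 1) (vr 20))) ;; setv 20 (vr 20 [-] qE (vr 1) (HA 37 (vr 1)))"
  have kmc: "x \<le> cap" if "x \<le> k * m" for x
  proof -
    have "k * m \<le> V * V" using V by (intro mult_mono) auto
    then show ?thesis using that by (intro power_cap[of _ 2]) (auto simp: power2_eq_square)
  qed
  define h1 where "h1 = sem cap lm (setv 19 kmE) h"
  define h2 where "h2 = sem cap lm (HFor 6 (kmE [+] HN 1) ?b) h1"
  define h3 where "h3 = sem cap lm (setv 20 (vr 19)) h2"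
  have h': "h' = sem cap lm (HFor 1 vk ?c) h3"
    by (simp add: h'_def trace_prog_def h1_def h2_def h3_def)
  have t1: "tabs h1" "h1 19 0 = k * m" "\<And>A. A \<noteq> 19 \<Longrightarrow> h1 A = h A"
    using tabs tabs_inp[OF tabs] kmc by (auto simp: h1_def)
  \<comment> \<open>The scan has seen the budgets from \<open>k * m + 1 - n\<close> up to
    \<open>k * m\<close>.\<close>
  let ?I = "\<lambda>n g. g 19 0 \<le> k * m \<and> (\<forall>P. k * m + 1 - n \<le> P \<and> P < g 19 0 \<longrightarrow> bud < h 35 (idx 0 P)) \<and>
     ((\<exists>P\<le>k * m. k * m + 1 - n \<le> P \<and> h 35 (idx 0 P) \<le> bud) \<longrightarrow> h 35 (idx 0 (g 19 0)) \<le> bud)"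
  have "?I (k * m + 1) h2" unfolding h2_def
  proof (rule sem_for_le[where I = ?I])
    fix n g assume n: "n < k * m + 1" and IH: "?I n g" and f: "\<And>A. A \<notin> insert 6 (mods ?b) \<Longrightarrow> g A = h1 A"
    let ?g = "upd g 6 0 n"
    have tg: "tabs g" by (rule tabs_cong[OF t1(1)]) (use f in auto)
    have c: "hval (leE (HA 35 (kmE [-] vr 6)) (vr 26 [-] sE cand)) ?g = of_bool (h 35 (idx 0 (k * m - n)) \<le> bud)"
      using tabs_inp[OF tg] f t1(3) i by (simp add: idx_def bud_def)
    have split: "k * m + 1 - Suc n \<le> P \<longleftrightarrow> k * m + 1 - n \<le> P \<or> P = k * m - n" for P using n by auto
    show "?I (Suc n) (sem cap lm ?b ?g)"
    proof (cases "h 35 (idx 0 (k * m - n)) \<le> bud")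
      case True
      then have "sem cap lm ?b ?g = sem cap lm (setv 19 (kmE [-] vr 6)) ?g"
        unfolding sem.simps(3) c by simp
      also have "\<dots> = upd ?g 19 0 (k * m - n)"
        using tabs_inp[OF tg] kmc[of "k * m - n"] by simp
      finally have "sem cap lm ?b ?g = upd ?g 19 0 (k * m - n)" .
      then show ?thesis using True n by auto
    next
      case False
      then have "sem cap lm ?b ?g = upd ?g 29 0 0" unfolding sem.simps(3) c by simp
      then show ?thesis using False IH unfolding split by auto
    qed
  qed (use t1 tabs_inp[OF t1(1)] in auto)
  moreover have "h' 19 0 = h2 19 0" unfolding h' h3_def by (simp add: sem_frame)
  ultimately show "h' 19 0 \<le> k * m" "\<And>P. P < h' 19 0 \<Longrightarrow> bud < h 35 (idx 0 P)"
    "(\<exists>P\<le>k * m. h 35 (idx 0 P) \<le> bud) \<Longrightarrow> h 35 (idx 0 (h' 19 0)) \<le> bud" by auto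
  have f2: "h2 A = h1 A" if "A \<notin> {6, 19, 29}" for A unfolding h2_def by (rule sem_frame) (use that in auto)
  have le: "h2 19 0 \<le> k * m" using \<open>?I (k * m + 1) h2\<close> by simp
  have f3: "h3 A = h A" if "A \<notin> {6, 19, 20, 29}" for A using that f2 t1(3) by (simp add: h3_def)
  have f': "h' A = h3 A" if "A \<notin> {1, 20, 37}" for A unfolding h' by (rule sem_frame) (use that in auto)
  have h3: "h3 20 0 = h' 19 0" using kmc[OF le] f'[of 19] by (simp add: h3_def)
  have t3: "tabs h3" by (rule tabs_cong[OF tabs]) (simp_all add: f3)
  have q3: "qq h3 = qq h" "qq h' = qq h" using f3 f' by (auto intro: qq_cong)
  have eq36: "h' 36 = h 36" using f' f3 by simp
  have R_le: "residue h' l \<le> k * m" for l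
    by (induction l) (use \<open>h' 19 0 \<le> k * m\<close> in auto)
  let ?J = "\<lambda>n g. g 20 0 = residue h' n \<and> (\<forall>l<n. g 37 l = h 36 (idx l (residue h' l)))"
  have "?J k (sem cap lm (HFor 1 vk ?c) h3)"
  proof (rule sem_for_le[where I = ?J])
    fix l g assume l: "l < k" and IH: "?J l g" and f: "\<And>A. A \<notin> insert 1 (mods ?c) \<Longrightarrow> g A = h3 A"
    let ?v = "h 36 (idx l (residue h' l))"
    let ?g = "upd (upd g 1 0 l) 37 l ?v"
    have tg: "tabs g" by (rule tabs_cong[OF t3]) (use f in auto)
    have "sem cap lm (HSet 37 (vr 1) (HA 36 (tabE (vr 1) (vr 20)))) (upd g 1 0 l) = ?g"
      using tabs_inp[OF tg] IH f f3 J[OF l R_le] by simp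
    moreover have "qq ?g = qq h" using f f3 by (intro qq_cong) auto
    moreover have "residue h' (Suc l) \<le> cap" using R_le kmc by blast
    ultimately show "?J (Suc l) (sem cap lm ?c (upd g 1 0 l))"
      using IH tabs_inp[OF tg] q3(2) eq36 by (auto simp: less_Suc_eq)
  qed (use h3 tabs_inp[OF t3] in auto)
  then show "\<And>l. l < k \<Longrightarrow> h' 37 l = h 36 (idx l (residue h' l))" unfolding h' by blast
qed

lemma sem_replace_prog:
  assumes tabs: "tabs h" and i: "h 4 0 = i" "i < m"
    and pr: "\<And>l t. l < k \<Longrightarrow> t \<le> m \<Longrightarrow> prc h l t = price (conf h) (Suc i) l t"
    and tot: "h 18 0 = total (conf h) (Suc i)"
    and nc: "\<And>l. l < k \<Longrightarrow> h 37 l \<le> m" and C: "\<And>l. l < k \<Longrightarrow> conf h (Suc i) l \<le> m"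
  defines "c \<equiv> \<lambda>l. if l < k then h 37 l else 0"
  shows "conf (sem cap lm replace_prog h) =
    (if total (conf h) (Suc i) < (expense (conf h) (Suc i) (conf h (Suc i)) - expense (conf h) (Suc i) c) * m
     then (conf h)(Suc i := c) else conf h)"
proof -
  let ?C = "conf h"
  let ?b = "HSet 33 (cand [*] vk [+] vr 1) (HA 37 (vr 1))"
  define h1 where "h1 = sem cap lm (hsum 21 1 vk (prE (vr 1) (HA 37 (vr 1)))) h"
  define h2 where "h2 = sem cap lm (hsum 22 1 vk (prE (vr 1) (cE cand (vr 1)))) h1"
  have f1: "A \<notin> {1, 21} \<Longrightarrow> h1 A = h A" for A unfolding h1_def by (rule sem_frame) simp
  have f2: "A \<notin> {1, 22} \<Longrightarrow> h2 A = h1 A" for A unfolding h2_def by (rule sem_frame) simp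
  have t: "tabs h1" "tabs h2" by (rule tabs_cong[OF tabs]; simp add: f1 f2)+
  have new: "h1 21 0 = expense ?C (Suc i) c" unfolding h1_def expense_def
  proof (rule sem_hsum_inp[OF _ _ _ tabs_inp[OF tabs]])
    fix l g assume "l < k" "inp g" "\<And>A. A \<noteq> 21 \<Longrightarrow> A \<noteq> 1 \<Longrightarrow> g A = h A" "g 1 0 = l"
    then show "hval (prE (vr 1) (HA 37 (vr 1))) g = price ?C (Suc i) l (c l)"
      using pr[of l "h 37 l"] nc[of l] by (simp add: prc_def c_def)
  qed (use sum_price_V in \<open>auto intro: power_cap[of _ "3 * m + 6"]\<close>)
  have old: "h2 22 0 = expense ?C (Suc i) (?C (Suc i))" unfolding h2_def expense_def
  proof (rule sem_hsum_inp[OF _ _ _ tabs_inp[OF t(1)]])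
    fix l g assume g: "l < k" "inp g" "\<And>A. A \<noteq> 22 \<Longrightarrow> A \<noteq> 1 \<Longrightarrow> g A = h1 A" "g 1 0 = l"
    then have "conf g = ?C" using f1 by (intro conf_cong) simp
    then show "hval (prE (vr 1) (cE cand (vr 1))) g = price ?C (Suc i) l (?C (Suc i) l)"
      using pr[of l "?C (Suc i) l"] C[of l] g f1 i by (simp add: prc_def)
  qed (use sum_price_V in \<open>auto intro: power_cap[of _ "3 * m + 6"]\<close>)
  let ?cond = "total ?C (Suc i) < (expense ?C (Suc i) (?C (Suc i)) - expense ?C (Suc i) c) * m"
  have g: "hval (ltE (vr 18) ((vr 22 [-] vr 21) [*] vm)) h2 = of_bool ?cond"
    using tabs_inp[OF t(2)] new old f2[of 21] f2[of 18] f1[of 18] tot by simp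
  have split: "sem cap lm replace_prog h = (if hval (ltE (vr 18) ((vr 22 [-] vr 21) [*] vm)) h2 \<noteq> 0
      then sem cap lm (HFor 1 vk ?b) h2 else sem cap lm noop h2)"
    by (simp only: replace_prog_def sem.simps(2,3) h1_def h2_def)
  have C2: "conf h2 = ?C" using f1 f2 by (intro conf_cong) simp
  show ?thesis
  proof (cases ?cond)
    case True
    have res: "sem cap lm replace_prog h = sem cap lm (HFor 1 vk ?b) h2"
      unfolding split g using True by simp
    let ?I = "\<lambda>n g. \<forall>j\<le>m. \<forall>l<k. g 33 (j * k + l) = (if j = Suc i \<and> l < n then h 37 l else h 33 (j * k + l))"
    have "?I k (sem cap lm (HFor 1 vk ?b) h2)"
    proof (rule sem_for_le[where I = ?I])
      fix l g assume l: "l < k" and IH: "?I l g" and f: "\<And>A. A \<notin> insert 1 (mods ?b) \<Longrightarrow> g A = h2 A"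
      have tg: "tabs g" by (rule tabs_cong[OF t(2)]) (use f in auto)
      have v: "g 37 l = h 37 l" "g 4 0 = i" using f f1 f2 i by auto
      have cp: "h 37 l \<le> cap" using nc[OF l] V by (intro V_cap) auto
      have s: "sem cap lm ?b (upd g 1 0 l) = upd (upd g 1 0 l) 33 (Suc i * k + l) (h 37 l)"
        using tabs_inp[OF tg] v cp by (simp add: add_ac)
      have inj: "j * k + l' = Suc i * k + l \<longleftrightarrow> j = Suc i \<and> l' = l" if "l' < k" for j l'
        using mult_add_inj[of j k l' "Suc i" l] that l by auto
      show "?I (Suc l) (sem cap lm ?b (upd g 1 0 l))"
      proof (intro allI impI)
        fix j l' assume "j \<le> m" "l' < k"
        then show "sem cap lm ?b (upd g 1 0 l) 33 (j * k + l') =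
            (if j = Suc i \<and> l' < Suc l then h 37 l' else h 33 (j * k + l'))"
          using IH inj[of l' j] unfolding s by (auto simp: less_Suc_eq simp del: mult_Suc)
      qed
    qed (use tabs_inp[OF t(2)] f1 f2 in auto)
    then show ?thesis unfolding res using True i(2) by (auto simp: conf_def c_def fun_eq_iff simp del: mult_Suc)
  next
    case False
    then have "sem cap lm replace_prog h = upd h2 29 0 0"
      unfolding split g by simp
    then show ?thesis using False C2 by (auto intro: trans[OF conf_cong])
  qed
qed

definition load_ok :: "(nat \<Rightarrow> nat \<Rightarrow> nat) \<Rightarrow> nat \<Rightarrow> bool" where
  "load_ok C T \<longleftrightarrow> (\<forall>i\<in>{1..m}. (\<forall>l<k. C i l \<le> m) \<and> \<sigma> i + (\<Sum>l<k. w l * a (C i l)) \<le> T)"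

definition feasible :: "(nat \<Rightarrow> nat \<Rightarrow> nat) \<Rightarrow> nat \<Rightarrow> bool" where
  "feasible C T \<longleftrightarrow> (\<forall>l<k. C 0 l = m + 1) \<and> load_ok C T"

text \<open>Of the tolerance \<open>2 * total\<close>, one half is the loss from rounding the prices
  and the other the gain that a replacement must exceed.\<close>

definition stable :: "(nat \<Rightarrow> nat \<Rightarrow> nat) \<Rightarrow> nat \<Rightarrow> nat \<Rightarrow> bool" where
  "stable C T i \<longleftrightarrow> (\<forall>c. (\<forall>l<k. c l \<le> m) \<longrightarrow> \<sigma> i + (\<Sum>l<k. w l * a (c l)) \<le> T \<longrightarrow>
     m * expense C i (C i) \<le> m * expense C i c + 2 * total C i)"

lemma low_le: "i \<in> {1..m} \<Longrightarrow> \<sigma> i + (\<Sum>l<k. w l) * a 0 \<le> low"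
  unfolding low_def by (intro Max_ge) auto

lemma price_pos: "l < k \<Longrightarrow> price C i l 0 > 0"
proof -
  assume "l < k"
  then have "pweight m k w l > 0" using w by (simp add: pweight_def)
  moreover have "pw m M e > 0" for e using rate by (simp add: pw_def good_rate_def)
  ultimately have "phi C i l 0 > 0" by (simp add: phi_def)
  then show ?thesis unfolding price_def using member_le_sum[of 0 "{0..m}" "phi C i l"] by simp
qed

text \<open>If the replacement is refused, the present expense is within \<open>total / m\<close> of
  that of the computed response, which in turn is within \<open>total / m\<close> of every
  admissible one.\<close>

lemma sem_step_prog:
  assumes tabs: "tabs h" and i: "h 4 0 = i" "i < m" and T: "h 26 0 = T" "low \<le> T" "T < big"
    and feas: "feasible (conf h) T"
  defines "h' \<equiv> sem cap lm step_prog h"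
  shows "feasible (conf h') T"
    "conf h' = conf h \<and> stable (conf h) T (Suc i) \<or> real (Psi (conf h')) \<le> rate * real (Psi (conf h))"
proof -
  let ?C = "conf h"
  have iI: "Suc i \<in> {1..m}" using i by simp
  define h1 where "h1 = sem cap lm price_prog h"
  define h2 where "h2 = sem cap lm table_prog h1"
  define h3 where "h3 = sem cap lm trace_prog h2"
  have h': "h' = sem cap lm replace_prog h3" by (simp add: h'_def step_prog_def h1_def h2_def h3_def)
  have f1: "h1 A = h A" if "A \<notin> {1, 2, 3, 17, 18, 34}" for A
    unfolding h1_def by (rule sem_frame) (use that in \<open>simp add: mods_progs\<close>)
  have f2: "h2 A = h1 A" if "A \<notin> {1, 2, 5, 6, 29, 35, 36}" for A
    unfolding h2_def by (rule sem_frame) (use that in \<open>simp add: mods_progs\<close>)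
  have f3: "h3 A = h2 A" if "A \<notin> {1, 6, 19, 20, 29, 37}" for A
    unfolding h3_def by (rule sem_frame) (use that in \<open>simp add: mods_progs\<close>)
  have t: "tabs h1" "tabs h2" "tabs h3" by (rule tabs_cong[OF tabs]; simp add: f1 f2 f3)+
  have C3: "conf h3 = ?C" by (rule conf_cong) (simp add: f1 f2 f3)
  note P = sem_price_prog[OF tabs i, folded h1_def]
  note Tb = sem_table_prog[OF t(1), folded h2_def]
  have tot: "h2 18 0 = total ?C (Suc i)" using P(2) f2 by simp
  have pr: "prc h2 l j = price ?C (Suc i) l j" if "l < k" "j \<le> m" for l j
    using P(1)[OF that] f2 by (simp add: prc_def)
  \<comment> \<open>The knapsack lemma wants prices that are largest at position 0 for all indices;
    the array guarantees this only at valid ones, hence the prices in mathematical form.\<close>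
  define q where "q l j = price ?C (Suc i) l j * (k * m) div total ?C (Suc i)" for l j
  have qq: "qq h2 l j = q l j" if "l < k" "j \<le> m" for l j
    using pr[OF that] tot by (simp add: qq_def q_def)
  have J: "h2 36 (idx l x) \<le> m" if "l < k" "x \<le> k * m" for l x
    using Tb(2)[OF that] by (simp add: entry_ok_def)
  have Jc: "h2 36 (idx l x) \<le> cap" if "l < k" "x \<le> k * m" for l x
    using J[OF that] V by (intro V_cap) auto
  have i2: "h2 4 0 = i" using i f1 f2 by simp
  note R = sem_trace_prog[OF t(2) i2 i(2) Jc, folded h3_def]
  define bud where "bud = T - \<sigma> (Suc i)"
  have T2: "h2 26 0 = T" using T f1 f2 by simp
  have R_le: "residue h3 l \<le> k * m" for l
    by (induction l) (use R(1) in auto)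
  have q3: "qq h3 = qq h2" by (rule qq_cong) (simp_all add: f3)
  have j36: "h3 36 = h2 36" by (simp add: f3)
  define c where "c l = h2 36 (idx l (residue h3 l))" for l
  have sT: "\<sigma> (Suc i) + (\<Sum>l<k. w l) * a 0 \<le> T" using low_le[OF iI] T(2) by simp
  have K0: "(\<forall>l<k. c l \<le> m) \<and> (\<Sum>l<k. w l * a (c l)) \<le> bud \<and>
    (\<forall>c'. (\<forall>l<k. c' l \<le> m) \<longrightarrow> (\<Sum>l<k. w l * a (c' l)) \<le> bud \<longrightarrow>
      m * (\<Sum>l<k. price ?C (Suc i) l (c l)) \<le> m * (\<Sum>l<k. price ?C (Suc i) l (c' l)) + total ?C (Suc i))"
    unfolding c_def
  proof (rule knapsack_response[where F = "\<lambda>l x. h2 35 (idx l x)" and J = "\<lambda>l x. h2 36 (idx l x)" and q = q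
        and big = big and R = "residue h3" and bud = bud and pr = "price ?C (Suc i)" and a = a and w = w
        and k = k and m = m and Z = "total ?C (Suc i)"])
    fix x assume "x \<le> k * m" then show "h2 35 (idx k x) = 0" by (rule Tb(1))
  next
    fix l x j assume a: "l < k" "x \<le> k * m" "j \<le> m" "q l j \<le> x"
    then show "h2 35 (idx l x) \<le> h2 35 (idx (Suc l) (x - q l j)) + w l * a j"
      using Tb(2)[OF a(1,2)] qq[OF a(1,3)] unfolding entry_ok_def by auto
  next
    fix l x assume a: "l < k" "x \<le> k * m"
    show "big \<le> h2 35 (idx l x) \<or> h2 36 (idx l x) \<le> m \<and> q l (h2 36 (idx l x)) \<le> x \<and>
        h2 35 (idx l x) = h2 35 (idx (Suc l) (x - q l (h2 36 (idx l x)))) + w l * a (h2 36 (idx l x))"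
      using Tb(2)[OF a] qq[OF a(1) J[OF a]] unfolding entry_ok_def by auto
  next
    fix l assume l: "l < k"
    show "residue h3 (Suc l) = residue h3 l - q l (h2 36 (idx l (residue h3 l)))"
      using qq[OF l J[OF l R_le]] by (simp add: q3 j36)
  next
    show "residue h3 0 \<le> k * m" using R(1) by simp
    show "bud < h2 35 (idx 0 x)" if "x < residue h3 0" for x using R(2)[of x] that T2 by (simp add: bud_def)
    show "h2 35 (idx 0 (residue h3 0)) \<le> bud" if "\<exists>x\<le>k * m. h2 35 (idx 0 x) \<le> bud"
      using R(3) that T2 by (simp add: bud_def)
    show "bud < big" using T by (simp add: bud_def)
    show "(\<Sum>l<k. w l * a 0) \<le> bud" using sT by (simp add: bud_def sum_distrib_right)
  qed (auto simp: q_def total_def price_le_0 price_pos)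
  then have K: "\<And>l. l < k \<Longrightarrow> c l \<le> m" "(\<Sum>l<k. w l * a (c l)) \<le> bud"
    "\<And>c'. \<forall>l<k. c' l \<le> m \<Longrightarrow> (\<Sum>l<k. w l * a (c' l)) \<le> bud \<Longrightarrow>
      m * (\<Sum>l<k. price ?C (Suc i) l (c l)) \<le> m * (\<Sum>l<k. price ?C (Suc i) l (c' l)) + total ?C (Suc i)"
    by blast+
  define nc where "nc l = (if l < k then c l else 0)" for l
  have c37: "h3 37 l = c l" if "l < k" for l using R(4)[where l = l] that by (simp add: c_def)
  have Ci: "?C (Suc i) l \<le> m" if "l < k" for l using feas iI that by (simp add: feasible_def load_ok_def)
  have "conf h' = (if total (conf h3) (Suc i) <
      (expense (conf h3) (Suc i) (conf h3 (Suc i)) - expense (conf h3) (Suc i) (\<lambda>l. if l < k then h3 37 l else 0)) * m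
     then (conf h3)(Suc i := (\<lambda>l. if l < k then h3 37 l else 0)) else conf h3)"
    unfolding h'
  proof (rule sem_replace_prog[OF t(3) _ i(2)])
    show "h3 4 0 = i" using i2 f3 by simp
    show "prc h3 l x = price (conf h3) (Suc i) l x" if "l < k" "x \<le> m" for l x
      using pr[OF that] f3 C3 by (simp add: prc_def)
    show "h3 18 0 = total (conf h3) (Suc i)" using tot f3 C3 by simp
  qed (use c37 K(1) Ci C3 in auto)
  also have "(\<lambda>l. if l < k then h3 37 l else 0) = nc" using c37 by (auto simp: nc_def)
  finally have res: "conf h' = (if total ?C (Suc i) <
      (expense ?C (Suc i) (?C (Suc i)) - expense ?C (Suc i) nc) * m then ?C(Suc i := nc) else ?C)"
    unfolding C3 .
  have nc_cost: "(\<Sum>l<k. w l * a (nc l)) = (\<Sum>l<k. w l * a (c l))" by (intro sum.cong) (auto simp: nc_def)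
  have nc_exp: "expense ?C (Suc i) nc = (\<Sum>l<k. price ?C (Suc i) l (c l))"
    unfolding expense_def by (intro sum.cong) (auto simp: nc_def)
  show "feasible (conf h') T"
    using feas K(1,2) sT nc_cost iI unfolding res feasible_def load_ok_def by (auto simp: bud_def nc_def)
  show "conf h' = ?C \<and> stable ?C T (Suc i) \<or> real (Psi (conf h')) \<le> rate * real (Psi ?C)"
  proof (cases "total ?C (Suc i) < (expense ?C (Suc i) (?C (Suc i)) - expense ?C (Suc i) nc) * m")
    case True
    then show ?thesis using res Psi_decrease[OF iI True] by simp
  next
    case False
    have "stable ?C T (Suc i)" unfolding stable_def
    proof (intro allI impI)
      fix c' assume c': "\<forall>l<k. c' l \<le> m" "\<sigma> (Suc i) + (\<Sum>l<k. w l * a (c' l)) \<le> T"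
      have 1: "m * expense ?C (Suc i) nc \<le> m * expense ?C (Suc i) c' + total ?C (Suc i)"
        unfolding nc_exp unfolding expense_def using c' by (intro K(3)) (auto simp: bud_def)
      have "m * expense ?C (Suc i) (?C (Suc i)) - m * expense ?C (Suc i) nc \<le> total ?C (Suc i)"
        using False by (simp add: diff_mult_distrib2 mult.commute)
      with 1 show "m * expense ?C (Suc i) (?C (Suc i)) \<le> m * expense ?C (Suc i) c' + 2 * total ?C (Suc i)"
        by linarith
    qed
    then show ?thesis using res False by simp
  qed
qed

section \<open>Semantics of the whole search\<close>

lemma sem_init_prog:
  assumes inp: "inp h"
  shows "conf (sem cap lm init_prog h) = (\<lambda>i l. if i \<le> m \<and> l < k then if i = 0 then m + 1 else 0 else 0)"
proof -
  let ?b = "HSet 33 (vr 4 [*] vk [+] vr 1) ((HN 1 [-] vr 4) [*] (vm [+] HN 1))"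
  let ?v = "\<lambda>i. if i = 0 then m + 1 else 0"
  have "\<forall>i<m + 1. \<forall>l<k. sem cap lm init_prog h 33 (i * k + l) = ?v i"
    unfolding init_prog_def
  proof (rule sem_for_le[where I = "\<lambda>n g. \<forall>i<n. \<forall>l<k. g 33 (i * k + l) = ?v i"])
    fix i g assume i: "i < m + 1" and IH: "\<forall>i'<i. \<forall>l<k. g 33 (i' * k + l) = ?v i'"
      and f: "\<And>A. A \<notin> insert 4 (mods (HFor 1 vk ?b)) \<Longrightarrow> g A = h A"
    have ig: "inp g" using inp_cong[OF inp] f by simp
    let ?I = "\<lambda>n g. (\<forall>i'<i. \<forall>l<k. g 33 (i' * k + l) = ?v i') \<and> (\<forall>l<n. g 33 (i * k + l) = ?v i)"
    have "?I k (sem cap lm (HFor 1 vk ?b) (upd g 4 0 i))"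
    proof (rule sem_for_le[where I = ?I])
      fix l g1 assume l: "l < k" and IH': "?I l g1"
        and f': "\<And>A. A \<notin> insert 1 (mods ?b) \<Longrightarrow> g1 A = upd g 4 0 i A"
      have ig1: "inp g1" using inp_cong[OF ig] f' by simp
      have "m + 1 \<le> cap" using V by (intro V_cap) simp
      moreover have "g1 4 0 = i" using f'[of 4] by simp
      ultimately have s: "sem cap lm ?b (upd g1 1 0 l) = upd (upd g1 1 0 l) 33 (i * k + l) (?v i)"
        using ig1 by (cases i) auto
      have inj: "i' * k + l' = i * k + l \<longleftrightarrow> i' = i \<and> l' = l" if "l' < k" for i' l'
        using mult_add_inj[of i' k l' i l] that l by auto
      show "?I (Suc l) (sem cap lm ?b (upd g1 1 0 l))"
        unfolding s using IH' inj l by (auto simp: less_Suc_eq)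
    qed (use ig IH in auto)
    then show "\<forall>i'<Suc i. \<forall>l<k. sem cap lm (HFor 1 vk ?b) (upd g 4 0 i) 33 (i' * k + l) = ?v i'"
      by (simp add: less_Suc_eq)
  qed (use inp in auto)
  then show ?thesis by (auto simp: conf_def fun_eq_iff)
qed

lemma Psi_V: "Psi C \<le> V ^ (3 * m + 6)"
proof -
  have "Psi C \<le> (\<Sum>l<k. \<Sum>t\<le>m. V * V ^ (3 * m + 3))"
    unfolding Psi_def
  proof (intro sum_mono mult_mono pweight_V pw_V M_le)
    fix l t show "used C l t + m - t \<le> 3 * m + 3" using used_le[of C l t] by simp
  qed auto
  also have "\<dots> = k * ((m + 1) * (V * V ^ (3 * m + 3)))" by simp
  also have "\<dots> \<le> V * (V * (V * V ^ (3 * m + 3)))" using V by (intro mult_mono) auto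
  finally show ?thesis by (simp add: numeral_eq_Suc)
qed

lemma sem_psi_prog:
  assumes tabs: "tabs h"
  shows "sem cap lm psi_prog h 23 0 = Psi (conf h)"
proof -
  let ?C = "conf h"
  let ?s = "setv 23 (vr 23 [+] HA 31 (vr 1) [*] HA 32 (vr 17 [+] vm [-] vr 3))"
  let ?c = "used_prog (vr 3) ;; ?s"
  let ?b = "HFor 3 (vm [+] HN 1) ?c"
  define f where "f l t = pweight m k w l * pw m M (used ?C l t + m - t)" for l t
  have part: "(\<Sum>l<l0. \<Sum>t\<le>m. f l t) + (\<Sum>t<n. f l0 t) \<le> Psi ?C" if "l0 < k" "n \<le> m + 1" for l0 n
  proof -
    have "(\<Sum>l<l0. \<Sum>t\<le>m. f l t) + (\<Sum>t<n. f l0 t) \<le> (\<Sum>l<l0. \<Sum>t\<le>m. f l t) + (\<Sum>t\<le>m. f l0 t)"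
      using that by (intro add_left_mono sum_mono2) auto
    also have "\<dots> = (\<Sum>l<Suc l0. \<Sum>t\<le>m. f l t)" by (simp add: sum.lessThan_Suc)
    also have "\<dots> \<le> Psi ?C" unfolding Psi_def f_def[symmetric] using that by (intro sum_mono2) auto
    finally show ?thesis .
  qed
  define h1 where "h1 = sem cap lm (setv 23 (HN 0)) h"
  have t1: "tabs h1" "h1 33 = h 33" "h1 23 0 = 0" using tabs by (auto simp: h1_def)
  have "sem cap lm (HFor 1 vk ?b) h1 23 0 = (\<Sum>l<k. \<Sum>t\<le>m. f l t)"
  proof (rule sem_for_le[where I = "\<lambda>n g. g 23 0 = (\<Sum>l<n. \<Sum>t\<le>m. f l t)"])
    fix l g assume l: "l < k" and IH: "g 23 0 = (\<Sum>l<l. \<Sum>t\<le>m. f l t)"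
      and fr: "\<And>A. A \<notin> insert 1 (mods ?b) \<Longrightarrow> g A = h1 A"
    have tg: "tabs g" by (rule tabs_cong[OF t1(1)]) (use fr in auto)
    have "sem cap lm ?b (upd g 1 0 l) 23 0 = (\<Sum>l<l. \<Sum>t\<le>m. f l t) + (\<Sum>t<m + 1. f l t)"
    proof (rule sem_for_le[where I = "\<lambda>n g. g 23 0 = (\<Sum>l<l. \<Sum>t\<le>m. f l t) + (\<Sum>t<n. f l t)"])
      fix t g1 assume t: "t < m + 1" and IH': "g1 23 0 = (\<Sum>l<l. \<Sum>t\<le>m. f l t) + (\<Sum>t<t. f l t)"
        and fr': "\<And>A. A \<notin> insert 3 (mods ?c) \<Longrightarrow> g1 A = upd g 1 0 l A"
      let ?g = "upd g1 3 0 t"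
      define g2 where "g2 = sem cap lm (used_prog (vr 3)) ?g"
      have tg1: "tabs ?g" by (simp, rule tabs_cong[OF tg]) (use fr' in auto)
      have f2: "A \<noteq> 17 \<Longrightarrow> A \<noteq> 2 \<Longrightarrow> g2 A = ?g A" for A unfolding g2_def by (rule sem_frame) simp
      have t2: "tabs g2" by (rule tabs_cong[OF tg1]) (use f2 in auto)
      have "conf ?g = ?C" using fr fr' t1(2) by (intro conf_cong) auto
      then have u: "g2 17 0 = used ?C l t"
        unfolding g2_def by (subst sem_used_prog[where l = l and t = t]) (use tabs_inp[OF tg1] fr' l in auto)
      have v: "g2 1 0 = l" "g2 3 0 = t" "g2 23 0 = g1 23 0" using f2 fr' by auto
      have "used ?C l t + m - t \<le> 3 * m + 3" using used_le[of ?C l t] by simp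
      then have e: "hval (vr 23 [+] HA 31 (vr 1) [*] HA 32 (vr 17 [+] vm [-] vr 3)) g2 =
          (\<Sum>l<l. \<Sum>t\<le>m. f l t) + (\<Sum>t<Suc t. f l t)"
        using t2 tabs_inp[OF t2] u v l IH' by (simp add: tabs_def f_def sum.lessThan_Suc)
      have "(\<Sum>l<l. \<Sum>t\<le>m. f l t) + (\<Sum>t<Suc t. f l t) \<le> cap"
        using part[OF l, of "Suc t"] t Psi_V[of ?C] by (intro power_cap[of _ "3 * m + 6"]) auto
      then show "sem cap lm ?c ?g 23 0 = (\<Sum>l<l. \<Sum>t\<le>m. f l t) + (\<Sum>t<Suc t. f l t)"
        unfolding sem.simps(1,2) g2_def[symmetric] e by simp
    qed (use tg tabs_inp[OF tg] IH in auto)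
    then show "sem cap lm ?b (upd g 1 0 l) 23 0 = (\<Sum>l<Suc l. \<Sum>t\<le>m. f l t)"
      unfolding sum.lessThan_Suc by (simp add: lessThan_Suc_atMost)
  qed (use t1 tabs_inp[OF t1(1)] in auto)
  then show ?thesis by (simp add: psi_prog_def h1_def Psi_def f_def)
qed

text \<open>A relaxation of strategies: permutations enter the comparison at a local optimum only
  through their prefix counts.\<close>

definition attainable :: "nat \<Rightarrow> bool" where
  "attainable T \<longleftrightarrow> (\<exists>D. load_ok D T \<and> (\<forall>l<k. \<forall>t\<le>m. used D l t \<le> t + 1))"

lemma load_ok_mono:
  assumes "load_ok C T" "T \<le> T'"
  shows "load_ok C T'"
  unfolding load_ok_def
proof (intro ballI conjI)
  fix i assume "i \<in> {1..m}"
  with assms(1) show "\<forall>l<k. C i l \<le> m" by (simp add: load_ok_def)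
  have "\<sigma> i + (\<Sum>l<k. w l * a (C i l)) \<le> T" using assms(1) \<open>i \<in> {1..m}\<close> unfolding load_ok_def by blast
  with assms(2) show "\<sigma> i + (\<Sum>l<k. w l * a (C i l)) \<le> T'" by linarith
qed

lemma attainable_mono: "attainable T \<Longrightarrow> T \<le> T' \<Longrightarrow> attainable T'"
  unfolding attainable_def using load_ok_mono by blast

lemma stable_target:
  assumes "attainable T" "\<And>i. i \<in> {1..m} \<Longrightarrow> stable C T i"
  shows "Psi C \<le> target"
proof -
  from assms(1) obtain D where D: "load_ok D T" "\<And>l t. l < k \<Longrightarrow> t \<le> m \<Longrightarrow> used D l t \<le> t + 1"
    unfolding attainable_def by blast
  show ?thesis
  proof (rule local_optimum[where D = D])
    fix i assume "i \<in> {1..m}"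
    then show "m * expense C i (C i) \<le> m * expense C i (D i) + 2 * total C i"
      using assms(2) D(1) unfolding stable_def load_ok_def by blast
  qed (use D in auto)
qed

text \<open>A sweep either improves the potential by the factor \<open>rate\<close> or leaves the
  configuration unchanged, and then all candidates are stable for one and the same configuration. No
  step increases the potential, so \<open>target\<close> is never lost once reached.\<close>

lemma sem_search_prog:
  assumes tabs: "tabs h" and T: "h 26 0 = T" "low \<le> T" "T < big"
  defines "h' \<equiv> sem cap lm search_prog h"
  shows "feasible (conf h') T" "h' 23 0 = Psi (conf h')" "attainable T \<Longrightarrow> Psi (conf h') \<le> target"
proof -
  define N where "N = 4 * (m * m) + 1"
  let ?s = "HFor 4 vm step_prog"
  define h1 where "h1 = sem cap lm init_prog h"
  define h2 where "h2 = sem cap lm (HFor 7 (HN 4 [*] (vm [*] vm) [+] HN 1) ?s) h1"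
  have h': "h' = sem cap lm psi_prog h2" by (simp add: h'_def search_prog_def h1_def h2_def)
  have f1: "h1 A = h A" if "A \<notin> {1, 4, 33}" for A
    unfolding h1_def by (rule sem_frame) (use that in \<open>simp add: mods_progs\<close>)
  have t1: "tabs h1" by (rule tabs_cong[OF tabs]; simp add: f1)
  have F1: "feasible (conf h1) T"
    unfolding h1_def sem_init_prog[OF tabs_inp[OF tabs]] feasible_def load_ok_def
  proof (intro conjI ballI allI impI)
    fix i assume i: "i \<in> {1..m}"
    show "\<sigma> i + (\<Sum>l<k. w l * a (if i \<le> m \<and> l < k then if i = 0 then m + 1 else 0 else 0)) \<le> T"
      using i low_le[OF i] T(2) by (simp add: sum_distrib_right)
  qed auto
  let ?A = "\<lambda>n C. attainable T \<longrightarrow> Psi C \<le> target \<or> real (Psi C) \<le> rate ^ n * real (Psi (conf h1))"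
  let ?I = "\<lambda>n g. tabs g \<and> g 26 0 = T \<and> feasible (conf g) T \<and> ?A n (conf g)"
  have decr: "?A n C'" if "?A n C" "real (Psi C') \<le> rate * real (Psi C)" for n C C'
  proof -
    have "rate * real (Psi C) \<le> 1 * real (Psi C)" using rate_bounds by (intro mult_right_mono) auto
    then have "Psi C' \<le> Psi C" using that(2) by simp
    then show ?thesis using that(1) by (auto intro: order_trans)
  qed
  have "?I N h2" unfolding h2_def
  proof (rule sem_for_le[where I = ?I])
    fix n g assume n: "n < N" and IH: "?I n g" and f: "\<And>A. A \<notin> insert 7 (mods ?s) \<Longrightarrow> g A = h1 A"
    let ?C = "conf g"
    let ?g = "upd g 7 0 n"
    \<comment> \<open>Inside a sweep, either the sweep has already achieved its claim, or nothing
      has changed and the candidates visited so far are stable.\<close>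
    let ?J = "\<lambda>i g'. tabs g' \<and> g' 26 0 = T \<and> feasible (conf g') T \<and>
        ((attainable T \<longrightarrow> Psi (conf g') \<le> target \<or> real (Psi (conf g')) \<le> rate ^ Suc n * real (Psi (conf h1))) \<or>
          conf g' = ?C \<and> (\<forall>i'<i. stable ?C T (Suc i')))"
    have "?J m (sem cap lm ?s ?g)"
    proof (rule sem_for_le[where I = ?J])
      fix i g' assume i: "i < m" and IH': "?J i g'" and f': "\<And>A. A \<notin> insert 4 (mods step_prog) \<Longrightarrow> g' A = ?g A"
      let ?h = "upd g' 4 0 i"
      let ?h' = "sem cap lm step_prog ?h"
      have th: "tabs ?h" "?h 4 0 = i" "?h 26 0 = T" "conf ?h = conf g'" using IH' by (auto intro: conf_cong)
      have feas: "feasible (conf ?h) T" using IH' th by simp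
      note S = sem_step_prog[OF th(1,2) i th(3) T(2,3) feas, unfolded th(4)]
      have fr: "?h' A = ?h A" if "A \<notin> mods step_prog" for A by (rule sem_frame) fact
      have "tabs ?h'" by (rule tabs_cong[OF th(1)]; rule fr; simp add: mods_step_prog)
      moreover have "?h' 26 0 = T" using fr[of 26] th by (simp add: mods_step_prog)
      moreover have "(attainable T \<longrightarrow> Psi (conf ?h') \<le> target \<or> real (Psi (conf ?h')) \<le> rate ^ Suc n * real (Psi (conf h1))) \<or>
          conf ?h' = ?C \<and> (\<forall>i'<Suc i. stable ?C T (Suc i'))"
        using S(2)
      proof
        assume "conf ?h' = conf g' \<and> stable (conf g') T (Suc i)"
        then show ?thesis using IH' by (auto simp: less_Suc_eq)
      next
        assume d: "real (Psi (conf ?h')) \<le> rate * real (Psi (conf g'))"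
        show ?thesis
        proof (cases "attainable T \<longrightarrow> Psi (conf g') \<le> target \<or> real (Psi (conf g')) \<le> rate ^ Suc n * real (Psi (conf h1))")
          case True
          then show ?thesis using decr[OF _ d, of "Suc n"] by blast
        next
          case False
          with IH' have "conf g' = ?C" by blast
          then have "attainable T \<longrightarrow> Psi (conf g') \<le> target \<or> real (Psi (conf g')) \<le> rate ^ n * real (Psi (conf h1))"
            using IH by simp
          with False have "real (Psi (conf g')) \<le> rate ^ n * real (Psi (conf h1))" by blast
          then have "rate * real (Psi (conf g')) \<le> rate * (rate ^ n * real (Psi (conf h1)))"
            using rate_bounds by (intro mult_left_mono) auto
          with d show ?thesis by simp
        qed
      qed
      ultimately show "?J (Suc i) ?h'" using S(1) by blast
    next
      show "?J 0 ?g" using IH conf_cong[of ?g g] by simp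
    qed (use IH tabs_inp in auto)
    moreover have "Psi ?C \<le> target" if "attainable T" "\<forall>i'<m. stable ?C T (Suc i')"
    proof (rule stable_target[OF that(1)])
      fix i assume "i \<in> {1..m}" then show "stable ?C T i" using that(2) by (cases i) auto
    qed
    ultimately show "?I (Suc n) (sem cap lm ?s ?g)" by auto
  qed (use t1 tabs_inp[OF t1] f1 T F1 in \<open>auto simp: N_def\<close>)
  note I = this
  have "conf h' = conf h2" unfolding h' by (intro conf_cong sem_frame) (simp add: mods_progs)
  then show "feasible (conf h') T" "h' 23 0 = Psi (conf h')"
    using I sem_psi_prog[of h2] by (auto simp: h')
  assume "attainable T"
  with I have "Psi (conf h2) \<le> target \<or> real (Psi (conf h2)) \<le> rate ^ N * real (Psi (conf h1))" by blast
  then have "Psi (conf h2) \<le> target"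
    using few_improvements[of "conf h2" N "conf h1"] by (auto simp: N_def power2_eq_square)
  with \<open>conf h' = conf h2\<close> show "Psi (conf h') \<le> target" by simp
qed

end

section \<open>Semantics of the bisection and of the output\<close>

context searching begin

definition saved :: "store \<Rightarrow> nat \<Rightarrow> nat \<Rightarrow> nat" where
  "saved h i l = (if i \<le> m \<and> l < k then h 38 (i * k + l) else 0)"

lemma low_le_attainable: "attainable T \<Longrightarrow> low \<le> T"
proof -
  assume "attainable T"
  then obtain D where D: "load_ok D T" unfolding attainable_def by blast
  show "low \<le> T" unfolding low_def
  proof (subst Max_le_iff; safe?)
    fix i assume i: "i \<in> {1..m}"
    have "(\<Sum>l<k. w l) * a 0 = (\<Sum>l<k. w l * a 0)" by (rule sum_distrib_right)
    also have "\<dots> \<le> (\<Sum>l<k. w l * a (D i l))"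
      using D i by (intro sum_mono mult_left_mono a_le) (auto simp: load_ok_def)
    finally have "\<sigma> i + (\<Sum>l<k. w l) * a 0 \<le> \<sigma> i + (\<Sum>l<k. w l * a (D i l))" by simp
    also have "\<dots> \<le> T" using D i unfolding load_ok_def by blast
    finally show "\<sigma> i + (\<Sum>l<k. w l) * a 0 \<le> T" .
  qed (use m in auto)
qed

text \<open>Success of the search need not be monotone in the bound. Failure however shows that the
  bound is not attainable and hence below the attainable \<open>\<tau>\<close>, so the lower end
  never passes \<open>\<tau>\<close>, while the saved configuration always belongs to the upper
  end.\<close>

lemma sem_bisect_prog:
  assumes tabs: "tabs h" and h: "h 24 0 = low" "h 25 0 = big - 1"
    and \<tau>: "attainable \<tau>" "2 * \<tau> \<le> big - 1"
  shows "\<exists>T\<le>\<tau>. feasible (saved (sem cap lm bisect_prog h)) T \<and> Psi (saved (sem cap lm bisect_prog h)) \<le> target"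
proof -
  let ?e = "leE (vr 23) (vr 13 [*] (vm [+] HN 1) [*] HA 32 (vm [+] HN 4 [+] vm [div] vr 16))"
  let ?cp = "HFor 1 ((vm [+] HN 1) [*] vk) (HSet 38 (vr 1) (HA 33 (vr 1)))"
  let ?y = "setv 25 (vr 26) ;; ?cp"
  let ?n = "setv 24 (vr 26 [+] HN 1)"
  let ?t = "setv 26 ((vr 24 [+] vr 25) [div] HN 2)"
  let ?b = "?t ;; search_prog ;; HIf ?e ?y ?n"
  have low: "low \<le> \<tau>" by (rule low_le_attainable) fact
  have tb: "\<tau> < big" using \<tau>(2) by (simp add: big_def)
  let ?good = "\<lambda>g. feasible (saved g) (g 25 0) \<and> Psi (saved g) \<le> target"
  let ?I = "\<lambda>n g. tabs g \<and> low \<le> g 24 0 \<and> g 24 0 \<le> \<tau> \<and> low \<le> g 25 0 \<and> g 25 0 < big \<and>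
      (g 25 0 - g 24 0) * 2 ^ n < big \<and> (n = 0 \<and> g 24 0 = low \<and> g 25 0 = big - 1 \<or> ?good g)"
  define N where "N = min lm (hval (vr 27) h)"
  have I: "?I N (sem cap lm (HFor 8 (vr 27) ?b) h)"
    unfolding N_def
  proof (rule sem_for[where I = ?I])
    have "low \<le> big - 1" using low \<tau>(2) by linarith
    moreover have "big - 1 < big" using tb by simp
    ultimately show "?I 0 h" using tabs h low by simp
    fix n g assume IH: "?I n g" and f: "\<And>A. A \<notin> insert 8 (mods ?b) \<Longrightarrow> g A = h A"
    define T where "T = (g 24 0 + g 25 0) div 2"
    have T: "low \<le> T" "T < big" using IH tb unfolding T_def by linarith+
    define g1 where "g1 = sem cap lm ?t (upd g 8 0 n)"
    have Tc: "T \<le> cap" using T by (intro big_cap) simp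
    have g1: "g1 = upd (upd g 8 0 n) 26 0 T" using Tc by (simp add: g1_def T_def)
    define g2 where "g2 = sem cap lm search_prog g1"
    have t1: "tabs g1" "g1 26 0 = T" using IH by (simp_all add: g1)
    note S = sem_search_prog[OF t1 T, folded g2_def]
    have f2: "g2 A = g1 A" if "A \<notin> mods search_prog" for A unfolding g2_def by (rule sem_frame) fact
    have t2: "tabs g2" by (rule tabs_cong[OF t1(1)]; rule f2; simp add: mods_search_prog)
    have v: "g2 24 = g 24" "g2 25 = g 25" "g2 38 = g 38" "g2 26 0 = T"
      using f2 t1 by (simp_all add: mods_search_prog g1)
    have step: "sem cap lm ?b (upd g 8 0 n) = (if hval ?e g2 \<noteq> 0 then sem cap lm ?y g2 else sem cap lm ?n g2)"
      by (simp only: sem.simps(2,3) g1_def g2_def)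
    have md: "m div M \<le> m" by simp
    have "m + 4 + m div M \<le> 3 * m + 3" using m md by linarith
    then have e: "hval ?e g2 = of_bool (Psi (conf g2) \<le> target)"
      using t2 tabs_inp[OF t2] S(2) by (simp add: tabs_def target_def)
    show "?I (Suc n) (sem cap lm ?b (upd g 8 0 n))"
    proof (cases "Psi (conf g2) \<le> target")
      case True
      define g3 where "g3 = sem cap lm (setv 25 (vr 26)) g2"
      have g3: "g3 = upd g2 25 0 T" using Tc v by (simp add: g3_def)
      have t3: "tabs g3" using t2 by (simp add: g3)
      have res: "sem cap lm ?b (upd g 8 0 n) = sem cap lm ?cp g3"
        unfolding step e using True by (simp add: g3_def)
      have "\<forall>x<(m + 1) * k. sem cap lm ?cp g3 38 x = g2 33 x"
      proof (rule sem_for_le[where I = "\<lambda>n g. \<forall>x<n. g 38 x = g2 33 x"])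
        fix x g' assume x: "x < (m + 1) * k" and IH': "\<forall>y<x. g' 38 y = g2 33 y"
          and f': "\<And>A. A \<notin> insert 1 (mods (HSet 38 (vr 1) (HA 33 (vr 1)))) \<Longrightarrow> g' A = g3 A"
        have k0: "k > 0" using x by (cases k) auto
        have xd: "x div k \<le> m" using less_mult_imp_div_less[OF x] by simp
        have xm: "x mod k < k" using k0 by simp
        have "conf g2 (x div k) (x mod k) = g2 33 x" using xd xm by (simp add: conf_def)
        moreover have "conf g2 (x div k) (x mod k) \<le> m + 1"
        proof (cases "x div k = 0")
          case False
          then have "x div k \<in> {1..m}" using xd by simp
          then have "conf g2 (x div k) (x mod k) \<le> m" using S(1) xm unfolding feasible_def load_ok_def by blast
          then show ?thesis by simp
        qed (use S(1) xm in \<open>simp add: feasible_def\<close>)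
        ultimately have "g2 33 x \<le> cap" using V by (intro V_cap) simp
        moreover have "g' 33 = g2 33" using f' by (simp add: g3)
        ultimately show "\<forall>y<Suc x. sem cap lm (HSet 38 (vr 1) (HA 33 (vr 1))) (upd g' 1 0 x) 38 y = g2 33 y"
          using IH' by (auto simp: less_Suc_eq)
      qed (use tabs_inp[OF t3] in auto)
      note cp = this
      let ?g4 = "sem cap lm ?cp g3"
      have "saved ?g4 = conf g2"
      proof (intro ext)
        fix i l show "saved ?g4 i l = conf g2 i l"
        proof (cases "i \<le> m \<and> l < k")
          case True
          then have "i * k + l < (m + 1) * k" using mult_add_less[of i "m + 1" l k 0] by simp
          with cp True show ?thesis by (simp add: saved_def conf_def)
        qed (auto simp: saved_def conf_def)
      qed
      moreover have f4: "?g4 A = g3 A" if "A \<notin> {1, 38}" for A by (rule sem_frame) (use that in simp)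
      moreover have "tabs ?g4" by (rule tabs_cong[OF t3]; rule f4; simp)
      moreover have "?g4 25 0 = T" "?g4 24 0 = g 24 0" using f4 v by (simp_all add: g3)
      moreover have "(T - g 24 0) * 2 ^ Suc n < big"
      proof -
        have "(T - g 24 0) * 2 \<le> g 25 0 - g 24 0" unfolding T_def by linarith
        then have "((T - g 24 0) * 2) * 2 ^ n \<le> (g 25 0 - g 24 0) * 2 ^ n" by (rule mult_right_mono) simp
        moreover have "(g 25 0 - g 24 0) * 2 ^ n < big" using IH by blast
        moreover have "(T - g 24 0) * 2 ^ Suc n = ((T - g 24 0) * 2) * 2 ^ n" by simp
        ultimately show ?thesis by linarith
      qed
      ultimately show ?thesis unfolding res using IH T S(1) True by simp
    next
      case False
      then have na: "\<not> attainable T" using S(3) by blast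
      then have T\<tau>: "T < \<tau>" using \<tau>(1) attainable_mono[of \<tau> T] by (meson not_le)
      \<comment> \<open>The first midpoint is at least \<open>\<tau>\<close>, so the first search
        succeeds; a failing search therefore always finds a saved configuration.\<close>
      have "n \<noteq> 0 \<or> \<not> (g 24 0 = low \<and> g 25 0 = big - 1)"
      proof (rule ccontr)
        assume "\<not> (n \<noteq> 0 \<or> \<not> (g 24 0 = low \<and> g 25 0 = big - 1))"
        then have "T = (low + (big - 1)) div 2" by (simp add: T_def)
        then have "\<tau> \<le> T" using \<tau>(2) by linarith
        with T\<tau> show False by simp
      qed
      then have gd: "?good g" using IH by blast
      have "T + 1 \<le> cap" using T by (intro big_cap) simp
      then have res: "sem cap lm ?b (upd g 8 0 n) = upd g2 24 0 (T + 1)"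
        unfolding step e using False v by simp
      have "saved g2 = saved g" using v by (simp add: saved_def fun_eq_iff)
      moreover have "(g 25 0 - (T + 1)) * 2 ^ Suc n < big"
      proof -
        have "(g 25 0 - (T + 1)) * 2 \<le> g 25 0 - g 24 0" unfolding T_def by linarith
        then have "((g 25 0 - (T + 1)) * 2) * 2 ^ n \<le> (g 25 0 - g 24 0) * 2 ^ n" by (rule mult_right_mono) simp
        moreover have "(g 25 0 - g 24 0) * 2 ^ n < big" using IH by blast
        moreover have "(g 25 0 - (T + 1)) * 2 ^ Suc n = ((g 25 0 - (T + 1)) * 2) * 2 ^ n" by simp
        ultimately show ?thesis by linarith
      qed
      moreover have "saved (upd g2 24 0 (T + 1)) = saved g2" by (simp add: saved_def fun_eq_iff)
      ultimately show ?thesis unfolding res using gd IH T T\<tau> t2 v by simp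
    qed
  qed
  let ?h = "sem cap lm (HFor 8 (vr 27) ?b) h"
  have N: "N = min lm big" using tabs by (simp add: N_def tabs_def)
  \<comment> \<open>The nominal number of rounds, \<open>big\<close>, may be exponential in the size
    of the input. Cut down to \<open>lm\<close>, it still halves the interval often enough.\<close>
  have "big \<le> 2 ^ N"
  proof (cases "lm \<le> big")
    case True
    have "big \<le> V ^ 4" using big_V by simp
    also have "\<dots> \<le> V ^ 5" using V2 by (intro power_increasing) auto
    finally show ?thesis using lm(6) True by (simp add: N)
  qed (use less_exp[of big] in \<open>simp add: N min_def\<close>)
  have "?h 25 0 - ?h 24 0 = 0"
  proof (rule ccontr)
    assume "?h 25 0 - ?h 24 0 \<noteq> 0"
    then have "1 * 2 ^ N \<le> (?h 25 0 - ?h 24 0) * 2 ^ N" by (intro mult_right_mono) auto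
    moreover have "(?h 25 0 - ?h 24 0) * 2 ^ N < big" using I by blast
    ultimately show False using \<open>big \<le> 2 ^ N\<close> by linarith
  qed
  then have "?h 25 0 \<le> \<tau>" using I by linarith
  moreover have "N \<noteq> 0"
  proof -
    have "lm > 0" "big > 0" using lm(1) unfolding big_def by linarith+
    then show ?thesis by (simp add: N)
  qed
  ultimately show ?thesis using I unfolding bisect_prog_def by blast
qed

lemma sem_output_prog:
  assumes tabs: "tabs h" and feas: "feasible (saved h) T" and l: "l < k" and i: "i \<le> m"
  shows "sem cap lm output_prog h 39 (l * (m + 1) + i) = position m (favourite m k w l) (\<lambda>i. saved h i l) i"
proof -
  let ?S = "\<lambda>l i. saved h i l"
  let ?f = "\<lambda>l. favourite m k w l"
  let ?s = "setv 28 (HN 1 [+] (HA 30 (vr 1) [-] vm [*] (HA 30 (vr 1) [div] vm)))"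
  let ?x = "hsum 17 2 (vm [+] HN 1) (ltE (ckE 2) (ckE 4) [*] neE (vr 2) (vr 28))"
  let ?A = "HSet 39 (vr 1 [*] (vm [+] HN 1) [+] vr 4) (vr 17 [+] leE (HA 38 (vr 28 [*] vk [+] vr 1)) (vr 17))"
  let ?B = "HSet 39 (vr 1 [*] (vm [+] HN 1) [+] vr 4) (HA 38 (vr 28 [*] vk [+] vr 1))"
  let ?c = "?x ;; HIf (neE (vr 4) (vr 28)) ?A ?B"
  let ?b = "?s ;; HFor 4 (vm [+] HN 1) ?c"
  let ?p = "\<lambda>l i. position m (?f l) (?S l) i"
  let ?ix = "\<lambda>l i. l * (m + 1) + i"
  have "\<forall>l<k. \<forall>i\<le>m. sem cap lm output_prog h 39 (?ix l i) = ?p l i"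
    unfolding output_prog_def
  proof (rule sem_for_le[where I = "\<lambda>n g. \<forall>l<n. \<forall>i\<le>m. g 39 (?ix l i) = ?p l i"])
    fix l g assume l: "l < k" and IH: "\<forall>l'<l. \<forall>i\<le>m. g 39 (?ix l' i) = ?p l' i"
      and f: "\<And>A. A \<notin> insert 1 (mods ?b) \<Longrightarrow> g A = h A"
    define F where "F = ?f l"
    have F: "F \<in> {1..m}" using favourite_range[OF m] by (simp add: F_def)
    have tg: "tabs g" by (rule tabs_cong[OF tabs]; rule f; simp)
    define g1 where "g1 = sem cap lm ?s (upd g 1 0 l)"
    have "F \<le> cap" using F V by (intro V_cap) auto
    moreover have "g 30 l = wrank k w l" using tg l by (simp add: tabs_def)
    ultimately have g1: "g1 = upd (upd g 1 0 l) 28 0 F"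
      using tabs_inp[OF tg] by (simp add: g1_def F_def favourite_def minus_mult_div_eq_mod)
    have t1: "tabs g1" using tg by (simp add: g1)
    have SF: "?S l F \<le> m" using feas F l unfolding feasible_def load_ok_def by blast
    let ?I = "\<lambda>n g. (\<forall>l'<l. \<forall>i\<le>m. g 39 (?ix l' i) = ?p l' i) \<and> (\<forall>i<n. g 39 (?ix l i) = ?p l i)"
    have "?I (m + 1) (sem cap lm (HFor 4 (vm [+] HN 1) ?c) g1)"
    proof (rule sem_for_le[where I = ?I])
      fix i g2 assume i: "i < m + 1" and IH': "?I i g2" and f': "\<And>A. A \<notin> insert 4 (mods ?c) \<Longrightarrow> g2 A = g1 A"
      let ?g = "upd g2 4 0 i"
      define g3 where "g3 = sem cap lm ?x ?g"
      have tg2: "tabs g2" by (rule tabs_cong[OF t1]; rule f'; simp)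
      then have t2: "tabs ?g" by simp
      have f3: "g3 A = ?g A" if "A \<notin> {17, 2}" for A unfolding g3_def by (rule sem_frame) (use that in simp)
      have t3: "tabs g3" by (rule tabs_cong[OF t2]; rule f3; simp)
      have v: "?g 1 0 = l" "?g 28 0 = F" "?g 38 = h 38" "?g 4 0 = i"
        using f' f by (simp_all add: g1)
      have X: "g3 17 0 = crank m F (?S l) i" unfolding g3_def crank_def
      proof (rule sem_hsum_inp[OF _ _ _ tabs_inp[OF t2]])
        fix i' g' assume a: "i' < m + 1" "inp g'" "\<And>A. A \<noteq> 17 \<Longrightarrow> A \<noteq> 2 \<Longrightarrow> g' A = ?g A" "g' 2 0 = i'"
        then have v': "g' 1 0 = l" "g' 28 0 = F" "g' 38 = h 38" "g' 4 0 = i" using v by auto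
        show "hval (ltE (ckE 2) (ckE 4) [*] neE (vr 2) (vr 28)) g' =
            of_bool (ckey m (?S l) i' < ckey m (?S l) i) * of_bool (i' \<noteq> F)"
          using a(1,2,4) v' i l by (simp add: ckE_def ckey_def saved_def)
      next
        have "(\<Sum>i'<m + 1. of_bool (ckey m (?S l) i' < ckey m (?S l) i) * of_bool (i' \<noteq> F)) \<le> (\<Sum>i'<m + 1. 1::nat)"
          by (intro sum_mono) auto
        then show "(\<Sum>i'<m + 1. of_bool (ckey m (?S l) i' < ckey m (?S l) i) * of_bool (i' \<noteq> F)) \<le> cap"
          using V by (intro V_cap) simp
      qed auto
      have step: "sem cap lm ?c ?g = (if hval (neE (vr 4) (vr 28)) g3 \<noteq> 0 then sem cap lm ?A g3 else sem cap lm ?B g3)"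
        by (simp only: sem.simps(2,3) g3_def)
      have v3: "g3 1 0 = l" "g3 28 0 = F" "g3 38 = h 38" "g3 4 0 = i" "g3 39 = g2 39"
        using f3 v by simp_all
      have SFh: "h 38 (F * k + l) = ?S l F" using F l by (simp add: saved_def)
      have pl: "?p l i \<le> m"
        using position_bij[of F m "?S l"] SF F i by (auto simp: bij_betw_def F_def)
      then have pc: "?p l i \<le> cap" using V by (intro V_cap) simp
      have "sem cap lm ?c ?g = upd g3 39 (?ix l i) (?p l i)"
      proof (cases "i = F")
        case True
        then show ?thesis unfolding step using v3 tabs_inp[OF t3] SFh pc by (simp add: position_def F_def[symmetric])
      next
        case False
        then have "?p l i = crank m F (?S l) i + of_bool (?S l F \<le> crank m F (?S l) i)"
          by (simp add: position_def F_def)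
        then show ?thesis unfolding step using v3 tabs_inp[OF t3] SFh pc X False by simp
      qed
      moreover have "?ix l' i' = ?ix l i \<longleftrightarrow> l' = l \<and> i' = i" if "i' \<le> m" for l' i'
        using mult_add_inj[of l' "m + 1" i' l i] that i by auto
      ultimately show "?I (Suc i) (sem cap lm ?c ?g)"
        using IH' v3(5) i by (auto simp: less_Suc_eq)
    qed (use IH tabs_inp[OF t1] in \<open>auto simp: g1\<close>)
    then have J: "?I (m + 1) (sem cap lm ?b (upd g 1 0 l))" unfolding sem.simps(2) g1_def .
    show "\<forall>l'<Suc l. \<forall>i\<le>m. sem cap lm ?b (upd g 1 0 l) 39 (?ix l' i) = ?p l' i"
    proof (intro allI impI)
      fix l' i' assume "l' < Suc l" "i' \<le> m"
      then have "l' < l \<or> l' = l" "i' < m + 1" by auto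
      with J \<open>i' \<le> m\<close> show "sem cap lm ?b (upd g 1 0 l) 39 (?ix l' i') = ?p l' i'" by blast
    qed
  qed (use tabs_inp[OF tabs] in auto)
  with l i show ?thesis by blast
qed

end

text \<open>To be used with an optimal strategy, read as the configuration \<open>D\<close>, and its
  score \<open>\<tau>\<close>. The upper bound on \<open>\<tau>\<close> is half of
  \<open>big - 1\<close>, as the bisection requires.\<close>

lemma (in election) sem_main_prog:
  assumes inp: "inp h"
    and D: "\<And>i l. i \<in> {1..m} \<Longrightarrow> l < k \<Longrightarrow> D i l \<le> m"
      "\<And>i. i \<in> {1..m} \<Longrightarrow> \<sigma> i + (\<Sum>l<k. w l * a (D i l)) \<le> \<tau>"
      "\<And>l t. l < k \<Longrightarrow> t \<le> m \<Longrightarrow> (\<Sum>i\<in>{1..m}. of_bool (D i l \<le> t)) \<le> t + 1"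
    and \<tau>: "\<tau> \<le> (\<Sum>i<m + 1. \<sigma> i) + (\<Sum>l<k. w l) * a m"
  shows "\<exists>M C. good_rate M \<and> (\<forall>l<k. C 0 l = m + 1) \<and>
    (\<forall>i\<in>{1..m}. (\<forall>l<k. C i l \<le> m) \<and> \<sigma> i + (\<Sum>l<k. w l * a (C i l)) \<le> \<tau>) \<and>
    search.Psi m k M (pweight m k w) C \<le> search.target m k M (pweight m k w) \<and>
    (\<forall>l<k. \<forall>i\<le>m. sem cap lm main_prog h 39 (l * (m + 1) + i) = position m (favourite m k w l) (\<lambda>i. C i l) i)"
proof -
  define h1 where "h1 = sem cap lm rank_prog h"
  define h2 where "h2 = sem cap lm weight_prog h1"
  define h3 where "h3 = sem cap lm rate_prog h2"
  define h4 where "h4 = sem cap lm power_prog h3"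
  define h5 where "h5 = sem cap lm bounds_prog h4"
  define h6 where "h6 = sem cap lm bisect_prog h5"
  have res: "sem cap lm main_prog h = sem cap lm output_prog h6"
    by (simp add: main_prog_def h1_def h2_def h3_def h4_def h5_def h6_def)
  have f: "A \<notin> mods rank_prog \<Longrightarrow> h1 A = h A" "A \<notin> mods weight_prog \<Longrightarrow> h2 A = h1 A"
    "A \<notin> mods rate_prog \<Longrightarrow> h3 A = h2 A" "A \<notin> mods power_prog \<Longrightarrow> h4 A = h3 A"
    "A \<notin> mods bounds_prog \<Longrightarrow> h5 A = h4 A" "A \<notin> mods bisect_prog \<Longrightarrow> h6 A = h5 A" for A
    unfolding h1_def h2_def h3_def h4_def h5_def h6_def by (rule sem_frame; assumption)+
  note fr = f[unfolded mods_progs mods_bisect_prog]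
  have i: "inp h1" "inp h2" "inp h3" "inp h4" "inp h5"
    by (rule inp_cong[OF inp]; simp add: fr)+
  have rk: "h1 30 l = wrank k w l" if "l < k" for l using sem_rank_prog[OF inp that] by (simp add: h1_def)
  note W = sem_weight_prog[OF i(1) rk, folded h2_def]
  define M where "M = h3 16 0"
  have gM: "good_rate M" using sem_rate_prog[OF i(2)] by (simp add: M_def h3_def)
  interpret searching m k a \<sigma> w V cap lm M by unfold_locales (rule gM)
  have pw: "h4 32 e = pw m M e" if "e \<le> 3 * m + 3" for e
  proof -
    have "M \<ge> 1" "M \<le> m" using gM unfolding good_rate_def by blast+
    from sem_power_prog[OF i(3) M_def[symmetric] this that] show ?thesis by (simp add: h4_def)
  qed
  note B = sem_bounds_prog[OF i(4), folded h5_def]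
  have B: "h5 27 0 = big" "h5 25 0 = big - 1" "h5 24 0 = low"
    using B W(2,3) by (simp_all add: fr)
  have t5: "tabs h5"
    unfolding tabs_def using i(5) B(1) W(1,4) rk pw by (simp add: fr M_def)
  have t6: "tabs h6" by (rule tabs_cong[OF t5]; simp add: fr)
  have "attainable \<tau>" unfolding attainable_def load_ok_def used_def using D by blast
  moreover have "2 * \<tau> \<le> big - 1" using \<tau> by (simp add: big_def)
  ultimately obtain T where T: "T \<le> \<tau>" "feasible (saved h6) T" "Psi (saved h6) \<le> target"
    using sem_bisect_prog[OF t5 B(3,2)] unfolding h6_def by blast
  have "load_ok (saved h6) \<tau>" using T(1,2) load_ok_mono unfolding feasible_def by blast
  with T gM sem_output_prog[OF t6 T(2)] show ?thesis
    unfolding res by (intro exI[of _ M] exI[of _ "saved h6"]) (simp add: feasible_def load_ok_def)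
qed


section \<open>Input and output\<close>

definition triple :: "(memory \<Rightarrow> bool) \<Rightarrow> prog \<Rightarrow> nat \<Rightarrow> (memory \<Rightarrow> bool) \<Rightarrow> bool" where
  "triple P c T Q \<longleftrightarrow> (\<forall>s r. P s \<longrightarrow> (\<exists>t s'. run c (s, r) t (s', r) \<and> Q s' \<and> t \<le> T))"

lemma triple_Store:
  assumes "\<And>s x. P s \<Longrightarrow> s x < 2 ^ L" "L \<ge> 1" "\<And>s. P s \<Longrightarrow> Q (s(val e s := val f s))"
  shows "triple P (Store e f) (L * (ecost e + ecost f + 1)) Q"
  unfolding triple_def
proof (intro allI impI)
  fix s r assume P: "P s"
  have "cost e s + cost f s + 1 \<le> L * ecost e + L * ecost f + L * 1"
    using assms(1)[OF P] assms(2) by (intro add_mono cost_le) auto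
  then show "\<exists>t s'. run (Store e f) (s, r) t (s', r) \<and> Q s' \<and> t \<le> L * (ecost e + ecost f + 1)"
    using run_Store[of e f s r] assms(3)[OF P]
    by (intro exI[of _ "cost e s + cost f s + 1"] exI[of _ "s(val e s := val f s)"]) (auto simp: algebra_simps)
qed

lemma triple_Seq:
  assumes "triple P c (L * T) R" "triple R c' (L * T') Q"
  shows "triple P (Seq c c') (L * (T + T')) Q"
  unfolding triple_def
proof (intro allI impI)
  fix s r assume "P s"
  with assms(1) obtain t s1 where 1: "run c (s, r) t (s1, r)" "R s1" "t \<le> L * T" unfolding triple_def by blast
  with assms(2) obtain t' s2 where 2: "run c' (s1, r) t' (s2, r)" "Q s2" "t' \<le> L * T'" unfolding triple_def by blast
  from run_Seq[OF 1(1) 2(1)] 1 2 show "\<exists>t s'. run (Seq c c') (s, r) t (s', r) \<and> Q s' \<and> t \<le> L * (T + T')"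
    by (intro exI[of _ "t + t'"] exI[of _ s2]) (auto simp: algebra_simps)
qed

lemma triple_While:
  assumes "\<And>i. i < n \<Longrightarrow> triple (I i) c (L * T) (I (Suc i))"
    and "\<And>i s. i \<le> n \<Longrightarrow> I i s \<Longrightarrow> val e s \<noteq> 0 \<longleftrightarrow> i < n"
    and "\<And>i s x. I i s \<Longrightarrow> s x < 2 ^ L" "L \<ge> 1" "n \<le> N"
  shows "triple (I 0) (While e c) (L * ((N + 1) * (T + ecost e))) (I n)"
  unfolding triple_def
proof (intro allI impI)
  fix s r assume I: "I 0 s"
  have "\<exists>t s'. run (While e c) (s, r) t (s', r) \<and> I n s' \<and> t \<le> (n + 1) * (L * T + L * ecost e)"
  proof (rule run_while_count[where I = I])
    show "\<exists>t s'. run c (s, r) t (s', r) \<and> I (Suc i) s' \<and> t \<le> L * T" if "i < n" "I i s" for i s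
      using assms(1)[OF that(1)] that(2) unfolding triple_def by blast
    show "(val e s \<noteq> 0 \<longleftrightarrow> i < n) \<and> cost e s \<le> L * ecost e" if "i \<le> n" "I i s" for i s
      using assms(2)[OF that] cost_le[of s L e] assms(3)[OF that(2)] assms(4) by blast
  qed fact
  moreover have "(n + 1) * (L * T + L * ecost e) \<le> L * ((N + 1) * (T + ecost e))"
  proof -
    have "(n + 1) * (L * T + L * ecost e) \<le> (N + 1) * (L * T + L * ecost e)"
      using assms(5) by (intro mult_right_mono) auto
    then show ?thesis by (simp add: algebra_simps)
  qed
  ultimately show "\<exists>t s'. run (While e c) (s, r) t (s', r) \<and> I n s' \<and> t \<le> L * ((N + 1) * (T + ecost e))"
    by (meson order_trans)
qed

abbreviation reg :: "nat \<Rightarrow> expr" where "reg r \<equiv> Cell (loc r (Lit 0))"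
abbreviation setr :: "nat \<Rightarrow> expr \<Rightarrow> prog" where "setr r e \<equiv> Store (loc r (Lit 0)) e"

text \<open>
  The base address exceeds the addresses of the input and of the output.  It is kept in cell 0,
  whose content moves to the first cell of the input array.
\<close>

definition base_expr :: expr where
  "base_expr = Mul (Lit 2) (Mul (Add (Cell (Lit 0)) (Lit 2)) (Add (Cell (Lit 1)) (Lit 2)))"

definition start_prog :: prog where
  "start_prog =
     Seq (Store (Add base_expr (Lit 3)) (Cell (Lit 0)))
    (Seq (Store (Lit 0) base_expr)
    (Seq (setr 51 (Add (Add (Mul (Lit 2) (reg 3)) (Cell (Lit 1))) (Lit 3)))
         (setr 52 (Add (reg 3) (Lit 4)))))"

definition copy_body :: prog where
  "copy_body =
     Seq (setr 50 (Add (reg 50) (Lit 1)))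
    (Seq (Store (loc 3 (reg 50)) (Cell (reg 50)))
         (setr 52 (Add (reg 52) (Cell (reg 50)))))"

definition copy_guard :: expr where "copy_guard = Sub (reg 51) (reg 50)"

definition bits_start :: prog where
  "bits_start = Seq (setr 53 (reg 52)) (setr 54 (Add (reg 51) (Lit 1)))"

definition bits_body :: prog where
  "bits_body = Seq (setr 53 (Div (reg 53) (Lit 2))) (setr 54 (Add (reg 54) (Lit 1)))"

definition cap_start :: prog where
  "cap_start =
     Seq (setr 1 (Mul (Lit 8) (Mul (reg 54) (reg 54))))
    (Seq (setr 55 (Lit 1)) (setr 56 (Add (Mul (Lit 3) (reg 3)) (Lit 20))))"

definition cap_body :: prog where
  "cap_body = Seq (setr 55 (Mul (reg 55) (reg 52))) (setr 56 (Sub (reg 56) (Lit 1)))"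

definition cap_set :: prog where
  "cap_set = setr 0 (Add (Add (reg 55) (reg 1)) (Cell (Lit 0)))"

definition prologue :: prog where
  "prologue = Seq start_prog (Seq (While copy_guard copy_body) (Seq bits_start (Seq (While (reg 53) bits_body)
     (Seq cap_start (Seq (While (reg 56) cap_body) cap_set)))))"

definition input_cap :: "nat \<Rightarrow> nat list \<Rightarrow> nat" where "input_cap m xs = (4 + sum_list xs) ^ (3 * m + 20)"

text \<open>The square of the length covers the loops over tables, which have two dimensions; the
  bit length of the sum makes \<open>2 ^ lm\<close> exceed \<open>V ^ 5\<close>.\<close>

definition input_lim :: "nat list \<Rightarrow> nat" where
  "input_lim xs = 8 * (length xs + bits (4 + sum_list xs))\<^sup>2"

definition input_base :: "nat \<Rightarrow> nat \<Rightarrow> nat" where "input_base m k = 2 * ((m + 2) * (k + 2))"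

text \<open>Straight-line code is treated by symbolic execution; \<open>safe\<close> collects the
  conditions that no stored value exceeds the cap.\<close>

fun exec :: "prog \<Rightarrow> memory \<Rightarrow> memory" where
  "exec (Store e f) s = s(val e s := val f s)"
| "exec (Seq c c') s = exec c' (exec c s)"
| "exec _ s = s"

fun pcost :: "prog \<Rightarrow> nat" where
  "pcost (Store e f) = ecost e + ecost f + 1"
| "pcost (Seq c c') = pcost c + pcost c'"
| "pcost _ = 0"

fun safe :: "nat \<Rightarrow> prog \<Rightarrow> memory \<Rightarrow> bool" where
  "safe cap (Store e f) s \<longleftrightarrow> val f s \<le> cap"
| "safe cap (Seq c c') s \<longleftrightarrow> safe cap c s \<and> safe cap c' (exec c s)"
| "safe cap _ s \<longleftrightarrow> False"

lemma triple_exec_eq: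
  assumes "cap < 2 ^ L" "L \<ge> 1" "\<forall>x. s x \<le> cap" "safe cap c s"
  shows "triple (\<lambda>u. u = s) c (L * pcost c) (\<lambda>u. u = exec c s) \<and> (\<forall>x. exec c s x \<le> cap)"
  using assms(3,4)
proof (induction c arbitrary: s)
  case (Store e f)
  have "triple (\<lambda>u. u = s) (Store e f) (L * (ecost e + ecost f + 1)) (\<lambda>u. u = exec (Store e f) s)"
    by (rule triple_Store) (use Store assms(1,2) le_less_trans in auto)
  then have "triple (\<lambda>u. u = s) (Store e f) (L * pcost (Store e f)) (\<lambda>u. u = exec (Store e f) s)"
    by (simp only: pcost.simps)
  moreover have "\<forall>x. exec (Store e f) s x \<le> cap" using Store by simp
  ultimately show ?case ..
next
  case (Seq c c')
  then show ?case using triple_Seq[of "\<lambda>u. u = s" c L "pcost c" "\<lambda>u. u = exec c s" c' "pcost c'"] by simp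
qed auto

lemma triple_exec:
  assumes "cap < 2 ^ L" "L \<ge> 1"
    and "\<And>s. P s \<Longrightarrow> (\<forall>x. s x \<le> cap) \<and> safe cap c s" "\<And>s. P s \<Longrightarrow> (\<forall>x. exec c s x \<le> cap) \<Longrightarrow> Q (exec c s)"
  shows "triple P c (L * pcost c) Q"
  unfolding triple_def
proof (intro allI impI)
  fix s r assume P: "P s"
  have "triple (\<lambda>u. u = s) c (L * pcost c) (\<lambda>u. u = exec c s)" "\<forall>x. exec c s x \<le> cap"
    using triple_exec_eq[OF assms(1,2)] assms(3)[OF P] by blast+
  then show "\<exists>t s'. run c (s, r) t (s', r) \<and> Q s' \<and> t \<le> L * pcost c"
    using assms(4)[OF P] unfolding triple_def by blast
qed

section \<open>Loading the input\<close>

locale input_layout =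
  fixes m k :: nat and xs :: "nat list" and L :: nat
  assumes len: "length xs = 2 * m + k + 4" and xs: "xs ! 0 = m" "xs ! 1 = k"
    and L: "input_cap m xs + input_lim xs + input_base m k < 2 ^ L" "L \<ge> 1"
begin

abbreviation "n \<equiv> length xs"
abbreviation "B \<equiv> input_base m k"
abbreviation "V \<equiv> 4 + sum_list xs"
abbreviation "lm \<equiv> input_lim xs"
abbreviation "cap \<equiv> input_cap m xs + lm + B"

definition inpc :: "nat \<Rightarrow> memory \<Rightarrow> nat" where "inpc i s = s (B + (3 + 64 * i))"

lemma inpc_upd [simp]:
  "r mod 64 \<noteq> 3 \<Longrightarrow> inpc i (s(B + r := v)) = inpc i s" "inpc i (s(B := v)) = inpc i s"
  "inpc i (s(Suc B := v)) = inpc i s" "x < B \<Longrightarrow> inpc i (s(x := v)) = inpc i s"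
  "inpc i (s(B + (3 + 64 * j) := v)) = (if i = j then v else inpc i s)"
proof -
  have *: "r = 3 + 64 * i \<Longrightarrow> r mod 64 = 3" for r by simp
  have ne: "Suc 0 \<noteq> 3 + 64 * i" by simp
  show "r mod 64 \<noteq> 3 \<Longrightarrow> inpc i (s(B + r := v)) = inpc i s" using *[of r] by (auto simp: inpc_def)
qed (auto simp: inpc_def)

lemma inpc_upd_Suc [simp]: "inpc i (s(B + (67 + 64 * j) := v)) = (if i = Suc j then v else inpc i s)"
  using inpc_upd(5)[of i s "Suc j" v] by simp

text \<open>The distances of the registers 50, 51 and 52 from the offset 3 of the input array, none
  of them a multiple of 64.\<close>

lemma far_neq [simp]: "(47::nat) \<noteq> 64 * j" "(48::nat) \<noteq> 64 * j" "(49::nat) \<noteq> 64 * j" "64 * j \<noteq> (47::nat)"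
  "64 * j \<noteq> (48::nat)" "64 * j \<noteq> (49::nat)"
  by presburger+

lemma B_pos [simp]: "B > 0" "B \<noteq> 0" by (simp_all add: input_base_def)

lemma n_le_B: "n \<le> B" by (simp add: len input_base_def algebra_simps)

lemma V_le: "V \<le> input_cap m xs"
  unfolding input_cap_def using power_increasing[of 1 "3 * m + 20" V] by simp

lemma elem_le: "i < n \<Longrightarrow> xs ! i \<le> V"
  using member_le_sum_list[of "xs ! i" xs] by simp

lemma n_le_lim: "n + bits V \<le> lm"
proof -
  have "(n + bits V) * 1 \<le> (n + bits V) * (8 * (n + bits V))" using len by (intro mult_left_mono) auto
  then show ?thesis by (simp add: input_lim_def power2_eq_square mult_ac)
qed

lemma bounded: "(\<forall>x. s x \<le> cap) \<Longrightarrow> s x < 2 ^ L" using L(1) le_less_trans by blast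

definition ready :: "nat \<Rightarrow> memory \<Rightarrow> bool" where
  "ready j s \<longleftrightarrow> s 0 = B \<and> (\<forall>x. s x \<le> cap) \<and> s (B + 51) = n - 1 \<and> (\<forall>i<j. inpc i s = xs ! i)"

definition copying :: "nat \<Rightarrow> memory \<Rightarrow> bool" where
  "copying j s \<longleftrightarrow> ready (j + 1) s \<and> s (B + 50) = j \<and> s (B + 52) = 4 + (\<Sum>i<j + 1. xs ! i) \<and>
     (\<forall>i. 0 < i \<longrightarrow> i < n \<longrightarrow> s i = xs ! i)"

lemma m_le: "m + 4 \<le> V" "k \<le> V" "m + 4 \<le> cap" "k \<le> cap"
proof -
  show 1: "m + 4 \<le> V" using member_le_sum_list[of m xs] xs(1) len nth_mem[of 0 xs] by auto
  show 2: "k \<le> V" using elem_le[of 1] xs(2) len by simp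
  show "m + 4 \<le> cap" "k \<le> cap" using 1 2 V_le by linarith+
qed

lemma ready_simps:
  assumes "ready j s"
  shows "s 0 = B" "s x \<le> cap" "s (B + 51) = n - 1" "0 < j \<Longrightarrow> s (B + 3) = m" "i < j \<Longrightarrow> inpc i s = xs ! i"
  using assms xs(1) unfolding ready_def by (auto simp: inpc_def)

lemma triple_start: "triple (\<lambda>s. s = load xs) start_prog (L * pcost start_prog) (copying 0)"
proof (rule triple_exec[OF L])
  let ?s = "load xs"
  have s: "?s 0 = m" "?s (Suc 0) = k" "\<And>i. i < n \<Longrightarrow> ?s i = xs ! i" "\<And>i. n \<le> i \<Longrightarrow> ?s i = 0"
    using xs len by (auto simp: load_def)
  have le: "?s x \<le> cap" for x using s(3,4)[of x] elem_le[of x] V_le by (cases "x < n") auto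
  have b: "val base_expr ?s = B" "val base_expr (?s(B + 3 := m)) = B"
    using s n_le_B len by (auto simp: base_expr_def input_base_def)
  have nc: "2 * m + k + 3 \<le> cap" using n_le_lim len by simp
  have B2: "B \<noteq> 0" "Suc 0 \<noteq> B" using n_le_B len by auto
  note facts = s b B2 xs nc m_le
  show "(\<forall>x. s x \<le> cap) \<and> safe cap start_prog s" if "s = load xs" for s
    using that le facts by (simp add: start_prog_def)
  show "copying 0 (exec start_prog s)" if "s = load xs" "\<forall>x. exec start_prog s x \<le> cap" for s
    unfolding copying_def ready_def
  proof (intro conjI allI impI that(2)[rule_format])
    note e = that(1) start_prog_def
    show "exec start_prog s 0 = B" using facts by (simp add: e)
    show "exec start_prog s (B + 51) = n - 1" using facts len by (simp add: e)
    show "exec start_prog s (B + 50) = 0" using facts n_le_B by (simp add: e)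
    show "exec start_prog s (B + 52) = 4 + (\<Sum>i<0 + 1. xs ! i)" using facts by (simp add: e)
    show "inpc i (exec start_prog s) = xs ! i" if "i < 0 + 1" for i using facts that by (simp add: e inpc_def)
    show "exec start_prog s i = xs ! i" if "0 < i" "i < n" for i
      using facts that n_le_B by (simp add: e)
  qed
qed

lemma sum_nth_le: "j \<le> n \<Longrightarrow> (\<Sum>i<j. xs ! i) \<le> sum_list xs"
  unfolding sum_list_sum_nth atLeast0LessThan[symmetric] by (rule sum_mono2) auto

lemma triple_copy: "triple (copying 0) (While copy_guard copy_body) (L * ((n + 1) * (pcost copy_body + ecost copy_guard))) (copying (n - 1))"
proof (rule triple_While)
  fix j assume j: "j < n - 1"
  show "triple (copying j) copy_body (L * pcost copy_body) (copying (Suc j))"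
  proof (rule triple_exec[OF L])
    fix s assume C: "copying j s"
    then have s: "s 0 = B" "\<And>x. s x \<le> cap" "s (B + 51) = n - 1" "s (B + 50) = j"
      "s (B + 52) = 4 + (\<Sum>i<j + 1. xs ! i)" "s (Suc j) = xs ! Suc j" "\<And>i. i < j + 1 \<Longrightarrow> inpc i s = xs ! i"
      using j by (auto simp: copying_def ready_def)
    \<comment> \<open>All writes go to addresses beyond \<open>B\<close>, past the end of the input,
      so the cells still to be copied are intact.\<close>
    have jB: "Suc j < B" using j n_le_B by simp
    then have ne: "B \<noteq> 0" "Suc j \<noteq> B" "\<And>r. B + r \<noteq> Suc j" "\<And>r. Suc j \<noteq> B + r" by auto
    have jc: "Suc j \<le> cap" using n_le_lim j by simp
    have sm: "4 + (\<Sum>i<j + 2. xs ! i) \<le> cap"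
    proof -
      have "j + 2 \<le> n" using j by linarith
      from sum_nth_le[OF this] V_le show ?thesis by linarith
    qed
    note facts = s ne jc
    show "(\<forall>x. s x \<le> cap) \<and> safe cap copy_body s"
      using facts sm by (simp add: copy_body_def sum.lessThan_Suc)
    have val: "exec copy_body s = s(B + 50 := Suc j, B + (3 + 64 * Suc j) := xs ! Suc j,
        B + 52 := 4 + (\<Sum>i<Suc j + 1. xs ! i))"
      using facts by (simp add: copy_body_def sum.lessThan_Suc add.assoc)
    show "copying (Suc j) (exec copy_body s)" if bd: "\<forall>x. exec copy_body s x \<le> cap"
      unfolding copying_def ready_def
    proof (intro conjI allI impI bd[rule_format])
      show "inpc i (exec copy_body s) = xs ! i" if "i < Suc j + 1" for i
        unfolding val using facts that by (cases "i = Suc j") simp_all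
      show "exec copy_body s i = xs ! i" if "0 < i" "i < n" for i
        unfolding val using C that n_le_B by (simp add: copying_def)
    qed (unfold val, use facts in simp_all)
  qed
next
  fix i s assume "i \<le> n - 1" "copying i s"
  then show "val copy_guard s \<noteq> 0 \<longleftrightarrow> i < n - 1" by (auto simp: copying_def ready_def copy_guard_def)
next
  fix i s x assume "copying i s"
  then have "\<forall>x. s x \<le> cap" unfolding copying_def ready_def by blast
  then show "s x < 2 ^ L" by (rule bounded)
qed (use L in auto)

text \<open>Halving the sum in register 53 until it vanishes adds its bit length to the length of
  the input in register 54, whose square yields \<open>input_lim\<close>.\<close>

definition counting :: "nat \<Rightarrow> memory \<Rightarrow> bool" where
  "counting j s \<longleftrightarrow> ready n s \<and> s (B + 52) = V \<and> s (B + 53) = V div 2 ^ j \<and> s (B + 54) = n + j"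

lemma ready_upd:
  assumes "ready j s" "r mod 64 \<noteq> 3" "r \<noteq> 51" "v \<le> cap"
  shows "ready j (s(B + r := v))"
  using assms by (simp add: ready_def)

lemma triple_bits_start: "triple (copying (n - 1)) bits_start (L * pcost bits_start) (counting 0)"
proof (rule triple_exec[OF L])
  fix s assume C: "copying (n - 1) s"
  have n1: "n - 1 + 1 = n" using len by simp
  have s: "ready n s" "s (B + 52) = V"
    using C unfolding copying_def n1 sum_list_sum_nth atLeast0LessThan by blast+
  have nc: "n \<le> cap" using n_le_lim by simp
  note f = ready_simps[OF s(1)] s(2) nc V_le
  show "(\<forall>x. s x \<le> cap) \<and> safe cap bits_start s" using f n1 by (simp add: bits_start_def)
  have "exec bits_start s = s(B + 53 := V, B + 54 := n)" using f n1 by (simp add: bits_start_def)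
  then show "counting 0 (exec bits_start s)"
    using ready_upd[OF ready_upd[OF s(1), of 53 V], of 54 n] s nc V_le by (simp add: counting_def)
qed

lemma triple_bits: "triple (counting 0) (While (reg 53) bits_body) (L * ((L + 1) * (pcost bits_body + ecost (reg 53)))) (counting (bits V))"
proof (rule triple_While)
  fix j assume j: "j < bits V"
  show "triple (counting j) bits_body (L * pcost bits_body) (counting (Suc j))"
  proof (rule triple_exec[OF L])
    fix s assume "counting j s"
    then have s: "ready n s" "s (B + 52) = V" "s (B + 53) = V div 2 ^ j" "s (B + 54) = n + j"
      by (auto simp: counting_def)
    have c: "n + Suc j \<le> cap" "V div 2 ^ j div 2 \<le> cap"
      using n_le_lim j V_le order_trans[OF div_le_dividend[of "V div 2 ^ j" 2] div_le_dividend[of V "2 ^ j"]] by linarith+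
    note f = ready_simps[OF s(1)] s(2-) c
    show "(\<forall>x. s x \<le> cap) \<and> safe cap bits_body s" using f by (simp add: bits_body_def)
    have "exec bits_body s = s(B + 53 := V div 2 ^ j div 2, B + 54 := n + Suc j)"
      using f by (simp add: bits_body_def)
    moreover have "V div 2 ^ Suc j = V div 2 ^ j div 2" unfolding power_Suc2 div_mult2_eq ..
    ultimately show "counting (Suc j) (exec bits_body s)"
      using ready_upd[OF ready_upd[OF s(1), of 53 "V div 2 ^ j div 2"], of 54 "n + Suc j"] s c
      by (simp add: counting_def)
  qed
next
  fix i s assume i: "i \<le> bits V" "counting i s"
  have "2 ^ i \<le> V \<longleftrightarrow> i < bits V"
  proof
    assume "2 ^ i \<le> V"
    then have "2 ^ i < (2::nat) ^ bits V" using less_two_power_bits[of V] by linarith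
    then show "i < bits V" by simp
  next
    assume "i < bits V"
    then have "(2::nat) ^ i \<le> 2 ^ (bits V - 1)" by (intro power_increasing) auto
    also have "\<dots> \<le> V" using floorlog_bounds[of V 2] by simp
    finally show "2 ^ i \<le> V" .
  qed
  moreover have "val (reg 53) s = V div 2 ^ i" using i ready_simps[of n s] by (simp add: counting_def)
  moreover have "V div 2 ^ i = 0 \<longleftrightarrow> V < 2 ^ i" by (subst div_eq_0_iff) simp
  ultimately show "val (reg 53) s \<noteq> 0 \<longleftrightarrow> i < bits V" by (simp add: not_less)
next
  fix i s x assume "counting i s"
  then have "\<forall>x. s x \<le> cap" unfolding counting_def ready_def by blast
  then show "s x < 2 ^ L" by (rule bounded)
next
  show "bits V \<le> L" using V_le L(1) by (intro bits_leI) linarith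
qed (use L in auto)

definition powering :: "nat \<Rightarrow> memory \<Rightarrow> bool" where
  "powering j s \<longleftrightarrow> ready n s \<and> s (B + 52) = V \<and> s (Suc B) = lm \<and> s (B + 55) = V ^ j \<and> s (B + 56) = 3 * m + 20 - j"

lemma ready_upd': "ready j s \<Longrightarrow> v \<le> cap \<Longrightarrow> ready j (s(Suc B := v))" "ready j s \<Longrightarrow> v \<le> cap \<Longrightarrow> ready j (s(B := v))"
  by (simp_all add: ready_def)

lemma triple_cap_start: "triple (counting (bits V)) cap_start (L * pcost cap_start) (powering 0)"
proof (rule triple_exec[OF L])
  fix s assume "counting (bits V) s"
  then have s: "ready n s" "s (B + 52) = V" "s (B + 54) = n + bits V" by (auto simp: counting_def)
  have lim: "lm = 8 * ((n + bits V) * (n + bits V))" by (simp add: input_lim_def power2_eq_square)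
  have "3 * m + 20 \<le> lm"
  proof -
    have "4 * (2 * m + 4) \<le> (n + bits V) * (2 * m + 4)" using len by (intro mult_right_mono) auto
    also have "\<dots> \<le> (n + bits V) * (n + bits V)" using len by (intro mult_left_mono) auto
    finally have "8 * (4 * (2 * m + 4)) \<le> 8 * ((n + bits V) * (n + bits V))" by (rule mult_left_mono) simp
    moreover have "3 * m + 20 \<le> 8 * (4 * (2 * m + 4))" by simp
    ultimately show ?thesis unfolding lim by (rule order_trans[rotated])
  qed
  then have c: "3 * m + 20 \<le> cap" "1 \<le> cap" by linarith+
  have np: "0 < n" using len by simp
  note f = ready_simps[OF s(1)] s(2-) c np
  have v: "8 * ((n + bits V) * (n + bits V)) = lm" by (simp only: lim)
  show "(\<forall>x. s x \<le> cap) \<and> safe cap cap_start s" using f v by (simp add: cap_start_def)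
  have "exec cap_start s = s(Suc B := lm, B + 55 := 1, B + 56 := 3 * m + 20)"
    using f v by (simp add: cap_start_def)
  then show "powering 0 (exec cap_start s)"
    using ready_upd[OF ready_upd[OF ready_upd'(1)[OF s(1), of lm], of 55 1], of 56 "3 * m + 20"] s c
    by (simp add: powering_def)
qed

lemma triple_cap_loop: "triple (powering 0) (While (reg 56) cap_body) (L * ((3 * m + 20 + 1) * (pcost cap_body + ecost (reg 56)))) (powering (3 * m + 20))"
proof (rule triple_While)
  fix j assume j: "j < 3 * m + 20"
  show "triple (powering j) cap_body (L * pcost cap_body) (powering (Suc j))"
  proof (rule triple_exec[OF L])
    fix s assume "powering j s"
    then have s: "ready n s" "s (B + 52) = V" "s (Suc B) = lm" "s (B + 55) = V ^ j" "s (B + 56) = 3 * m + 20 - j"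
      by (auto simp: powering_def)
    have "V ^ Suc j \<le> input_cap m xs" unfolding input_cap_def using j by (intro power_increasing) auto
    then have c: "V ^ j * V \<le> cap" by (simp add: mult.commute)
    have c': "3 * m + 20 - Suc j \<le> cap" using s(5) ready_simps(2)[OF s(1), of "B + 56"] by linarith
    note f = ready_simps[OF s(1)] s(2-) c c'
    show "(\<forall>x. s x \<le> cap) \<and> safe cap cap_body s" using f by (simp add: cap_body_def)
    have "exec cap_body s = s(B + 55 := V ^ j * V, B + 56 := 3 * m + 20 - Suc j)"
      using f by (simp add: cap_body_def)
    then show "powering (Suc j) (exec cap_body s)"
      using ready_upd[OF ready_upd[OF s(1), of 55 "V ^ j * V"], of 56 "3 * m + 20 - Suc j"] s c c'
      by (simp add: powering_def mult.commute)
  qed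
next
  fix i s assume "i \<le> 3 * m + 20" "powering i s"
  then show "val (reg 56) s \<noteq> 0 \<longleftrightarrow> i < 3 * m + 20" using ready_simps[of n s] by (auto simp: powering_def)
next
  fix i s x assume "powering i s"
  then have "\<forall>x. s x \<le> cap" unfolding powering_def ready_def by blast
  then show "s x < 2 ^ L" by (rule bounded)
qed (use L in auto)

definition prepared :: "memory \<Rightarrow> bool" where
  "prepared s \<longleftrightarrow> ready n s \<and> s B = cap \<and> s (Suc B) = lm"

lemma triple_cap_set: "triple (powering (3 * m + 20)) cap_set (L * pcost cap_set) prepared"
proof (rule triple_exec[OF L])
  fix s assume "powering (3 * m + 20) s"
  then have s: "ready n s" "s (Suc B) = lm" "s (B + 55) = input_cap m xs"
    by (auto simp: powering_def input_cap_def)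
  note f = ready_simps[OF s(1)] s(2-)
  show "(\<forall>x. s x \<le> cap) \<and> safe cap cap_set s" using f by (simp add: cap_set_def)
  have "exec cap_set s = s(B := cap)" using f by (simp add: cap_set_def)
  then show "prepared (exec cap_set s)" using ready_upd'(2)[OF s(1), of cap] s by (simp add: prepared_def)
qed

lemma triple_prologue:
  "triple (\<lambda>s. s = load xs) prologue
     (L * (pcost start_prog + ((n + 1) * (pcost copy_body + ecost copy_guard) + (pcost bits_start +
       ((L + 1) * (pcost bits_body + ecost (reg 53)) + (pcost cap_start +
       ((3 * m + 20 + 1) * (pcost cap_body + ecost (reg 56)) + pcost cap_set))))))) prepared"
  unfolding prologue_def
  by (intro triple_Seq[OF triple_start] triple_Seq[OF triple_copy] triple_Seq[OF triple_bits_start]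
    triple_Seq[OF triple_bits] triple_Seq[OF triple_cap_start] triple_Seq[OF triple_cap_loop] triple_cap_set)

end

section \<open>Writing the output\<close>

definition out_start :: prog where
  "out_start = Seq (setr 50 (Lit 2)) (setr 51 (Mul (Cell (loc 3 (Lit 1))) (Add (reg 3) (Lit 1))))"

definition out_body :: prog where
  "out_body = Seq (Store (reg 50) (Cell (loc 42 (reg 50)))) (setr 50 (Add (reg 50) (Lit 1)))"

text \<open>
  Cells 0 and 1 are written last: the base address in cell 0 is needed until then, and cell 1
  takes over as a pointer when cell 0 receives its output value.
\<close>

definition out_end :: prog where
  "out_end =
     Seq (Store (Lit 1) (Add (Cell (Lit 0)) (Lit 42)))
    (Seq (Store (Lit 0) (Cell (Cell (Lit 1))))
         (Store (Lit 1) (Cell (Add (Cell (Lit 1)) (Lit 64)))))"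

definition epilogue :: prog where
  "epilogue = Seq out_start (Seq (While copy_guard out_body) out_end)"

definition algorithm :: prog where
  "algorithm = Seq prologue (Seq (compile 0 main_prog) epilogue)"

context input_layout begin

abbreviation "K \<equiv> k * (m + 1)"

lemma K_less: "K < B"
  by (simp add: input_base_def algebra_simps)

lemma cap_big: "B + 42 \<le> cap"
proof -
  have "(4::nat) ^ 20 \<le> V ^ 20" by (intro power_mono) auto
  also have "\<dots> \<le> input_cap m xs" unfolding input_cap_def by (intro power_increasing) auto
  finally show ?thesis by simp
qed

text \<open>Offset 42 belongs to array 39 of the loop program, behind the three reserved
  arrays.\<close>

definition computed :: "(nat \<Rightarrow> nat) \<Rightarrow> memory \<Rightarrow> bool" where
  "computed f s \<longleftrightarrow> s 0 = B \<and> (\<forall>x. s x \<le> cap) \<and> (\<forall>i<K. s (B + (42 + 64 * i)) = f i)"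

definition writing :: "(nat \<Rightarrow> nat) \<Rightarrow> nat \<Rightarrow> memory \<Rightarrow> bool" where
  "writing f j s \<longleftrightarrow> computed f s \<and> s (B + 51) = K \<and> s (B + 50) = 2 + j \<and> (\<forall>i. 2 \<le> i \<and> i < 2 + j \<longrightarrow> s i = f i)"

lemma far_neq_out [simp]: "(8::nat) \<noteq> 64 * j" "(9::nat) \<noteq> 64 * j" "64 * j \<noteq> (8::nat)" "64 * j \<noteq> (9::nat)"
  by presburger+

lemma triple_out_start:
  "triple (\<lambda>s. computed f s \<and> s (B + 3) = m \<and> s (B + 67) = k) out_start (L * pcost out_start) (writing f 0)"
proof (rule triple_exec[OF L])
  fix s assume "computed f s \<and> s (B + 3) = m \<and> s (B + 67) = k"
  then have s: "s 0 = B" "\<And>x. s x \<le> cap" "\<And>i. i < K \<Longrightarrow> s (B + (42 + 64 * i)) = f i" "s (B + 3) = m" "s (B + 67) = k"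
    by (auto simp: computed_def)
  have c: "K \<le> cap" "2 \<le> cap" using K_less cap_big by linarith+
  show "(\<forall>x. s x \<le> cap) \<and> safe cap out_start s" using s c by (simp add: out_start_def)
  have "exec out_start s = s(B + 50 := 2, B + 51 := K)" using s by (simp add: out_start_def)
  then show "writing f 0 (exec out_start s)" using s c by (auto simp: writing_def computed_def)
qed

lemma triple_out_loop:
  "triple (writing f 0) (While copy_guard out_body) (L * ((K + 1) * (pcost out_body + ecost copy_guard))) (writing f (K - 2))"
proof (rule triple_While)
  fix j assume j: "j < K - 2"
  show "triple (writing f j) out_body (L * pcost out_body) (writing f (Suc j))"
  proof (rule triple_exec[OF L])
    fix s assume "writing f j s"
    then have s: "s 0 = B" "\<And>x. s x \<le> cap" "\<And>i. i < K \<Longrightarrow> s (B + (42 + 64 * i)) = f i" "s (B + 51) = K"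
      "s (B + 50) = 2 + j" "\<And>i. 2 \<le> i \<Longrightarrow> i < 2 + j \<Longrightarrow> s i = f i"
      by (auto simp: computed_def writing_def)
    have jB: "2 + j < K" "2 + j < B" using j K_less by linarith+
    then have ne: "\<And>r. B + r \<noteq> 2 + j" "\<And>r. 2 + j \<noteq> B + r" by linarith+
    have c: "Suc (2 + j) \<le> cap" using jB cap_big by linarith
    have o: "s (B + (42 + 64 * (2 + j))) = f (2 + j)" "f (2 + j) \<le> cap"
      using s(3)[OF jB(1)] s(2)[of "B + (42 + 64 * (2 + j))"] by simp_all
    have e: "exec out_body s = s(2 + j := f (2 + j), B + 50 := Suc (2 + j))"
      using s(1,5) o ne by (simp add: out_body_def)
    show "(\<forall>x. s x \<le> cap) \<and> safe cap out_body s"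
      using s(1,2,5) o ne c by (simp add: out_body_def)
    show "writing f (Suc j) (exec out_body s)" unfolding e
      using s o ne c jB by (auto simp: writing_def computed_def less_Suc_eq)
  qed
next
  fix i s assume "i \<le> K - 2" "writing f i s"
  then show "val copy_guard s \<noteq> 0 \<longleftrightarrow> i < K - 2" by (auto simp: writing_def computed_def copy_guard_def)
next
  fix i s x assume "writing f i s"
  then have "\<forall>x. s x \<le> cap" unfolding writing_def computed_def by blast
  then show "s x < 2 ^ L" by (rule bounded)
qed (use L in auto)

lemma triple_out_end:
  "triple (writing f (K - 2)) out_end (L * pcost out_end) (\<lambda>s. \<forall>i<K. s i = f i)"
proof (rule triple_exec[OF L])
  fix s assume "writing f (K - 2) s"
  then have s: "s 0 = B" "\<And>x. s x \<le> cap" "\<And>i. i < K \<Longrightarrow> s (B + (42 + 64 * i)) = f i"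
      "\<And>i. 2 \<le> i \<Longrightarrow> i < 2 + (K - 2) \<Longrightarrow> s i = f i"
    by (auto simp: computed_def writing_def)
  have B: "B \<ge> 8" by (simp add: input_base_def)
  have ne: "B + 42 \<noteq> 1" "B + 42 \<noteq> 0" "B + 106 \<noteq> 1" "B + 106 \<noteq> 0" using B by linarith+
  \<comment> \<open>\<open>106 = 42 + 64\<close>: entry 1 of the output array, one stride after the
    entry 0 to which cell 1 points.\<close>
  have e: "exec out_end s = s(1 := B + 42, 0 := s (B + 42), 1 := s (106 + B))"
    using s(1) ne B by (simp add: out_end_def fun_upd_twist)
  show "(\<forall>x. s x \<le> cap) \<and> safe cap out_end s"
    using s(1,2) ne cap_big B by (simp add: out_end_def)
  show "\<forall>i<K. exec out_end s i = f i"
  proof (intro allI impI)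
    fix i assume i: "i < K"
    consider "i = 0" | "i = 1" | "2 \<le> i" by linarith
    then show "exec out_end s i = f i"
    proof cases
      case 3
      then show ?thesis unfolding e using s(4)[of i] i by simp
    qed (use s(3)[OF i] in \<open>simp_all add: e add.commute[of B]\<close>)
  qed
qed

lemma algorithm_run:
  obtains t s' h where "run algorithm (load xs, r) t (s', r)" "\<And>i. i < n \<Longrightarrow> h 0 i = xs ! i"
    "\<And>i. i < K \<Longrightarrow> s' i = sem cap lm main_prog h 39 i"
    "t \<le> L * ((pcost start_prog + ((n + 1) * (pcost copy_body + ecost copy_guard) + (pcost bits_start +
       ((L + 1) * (pcost bits_body + ecost (reg 53)) + (pcost cap_start +
       ((3 * m + 20 + 1) * (pcost cap_body + ecost (reg 56)) + pcost cap_set)))))) +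
       (hcost lm 0 main_prog +
       (pcost out_start + ((K + 1) * (pcost out_body + ecost copy_guard) + pcost out_end))))"
proof -
  obtain t1 s1 where 1: "run prologue (load xs, r) t1 (s1, r)" "prepared s1"
      "t1 \<le> L * (pcost start_prog + ((n + 1) * (pcost copy_body + ecost copy_guard) + (pcost bits_start +
       ((L + 1) * (pcost bits_body + ecost (reg 53)) + (pcost cap_start +
       ((3 * m + 20 + 1) * (pcost cap_body + ecost (reg 56)) + pcost cap_set))))))"
    using triple_prologue unfolding triple_def by blast
  define h where "h A i = s1 (B + (A + 3 + 64 * i))" for A i
  have rep: "represents B cap lm h s1" and b1: "\<And>x. s1 x \<le> cap"
    using 1(2) by (auto simp: prepared_def ready_def represents_def h_def)
  have lc: "lm \<le> cap" by simp
  obtain t2 s2 where 2: "run (compile 0 main_prog) (s1, r) t2 (s2, r)"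
      "represents B cap lm (sem cap lm main_prog h) s2" "\<forall>x. s2 x \<le> cap" "t2 \<le> L * hcost lm 0 main_prog"
    using comp_correct[OF wf_main_prog rep b1 lc L, of 0] by blast
  define f where "f i = sem cap lm main_prog h 39 i" for i
  have h0: "h 0 i = xs ! i" if "i < n" for i
    using 1(2) that by (auto simp: prepared_def ready_def h_def inpc_def)
  have "0 \<notin> mods main_prog" by (simp add: prog_defs)
  then have m0: "sem cap lm main_prog h 0 = h 0" by (rule sem_frame)
  have s2: "s2 (B + (A + 3 + 64 * i)) = sem cap lm main_prog h A i" if "A < 61" for A i
    using 2(2) that by (simp add: represents_def)
  have "computed f s2 \<and> s2 (B + 3) = m \<and> s2 (B + 67) = k"
    using 2(2,3) s2[of 39] s2[of 0 0] s2[of 0 1] m0 h0[of 0] h0[of 1] xs len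
    by (simp add: computed_def f_def represents_def)
  moreover have "triple (\<lambda>s. computed f s \<and> s (B + 3) = m \<and> s (B + 67) = k) epilogue
      (L * (pcost out_start + ((K + 1) * (pcost out_body + ecost copy_guard) + pcost out_end))) (\<lambda>s. \<forall>i<K. s i = f i)"
    unfolding epilogue_def by (intro triple_Seq[OF triple_out_start] triple_Seq[OF triple_out_loop] triple_out_end)
  ultimately obtain t3 s3 where 3: "run epilogue (s2, r) t3 (s3, r)" "\<forall>i<K. s3 i = f i"
      "t3 \<le> L * (pcost out_start + ((K + 1) * (pcost out_body + ecost copy_guard) + pcost out_end))"
    unfolding triple_def by blast
  have "run algorithm (load xs, r) (t1 + (t2 + t3)) (s3, r)"
    unfolding algorithm_def by (intro run_Seq[OF 1(1)] run_Seq[OF 2(1)] 3(1))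
  moreover note h0
  moreover have "\<And>i. i < K \<Longrightarrow> s3 i = sem cap lm main_prog h 39 i" using 3(2) by (simp add: f_def)
  moreover note order_trans[OF add_mono[OF 1(3) add_mono[OF 2(4) 3(3)]] eq_refl, unfolded distrib_left[symmetric, of L], OF refl]
  ultimately show thesis by (rule that)
qed

end


section \<open>Running time\<close>

lemma sum_list_less: "sum_list xs + 1 \<le> 2 ^ input_size xs"
proof (induction xs)
  case (Cons x xs)
  have "sum_list (x # xs) + 1 \<le> (x + 1) * (sum_list xs + 1)" by simp
  also have "\<dots> \<le> 2 ^ (bits x + 1) * 2 ^ input_size xs"
  proof (rule mult_mono)
    show "x + 1 \<le> 2 ^ (bits x + 1)" using less_two_power_bits[of x] by simp
  qed (use Cons in auto)
  finally show ?case by (simp add: input_size_def power_add mult_ac)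
qed (simp add: input_size_def)

lemma length_le_input_size: "length xs \<le> input_size xs"
  by (induction xs) (auto simp: input_size_def)

text \<open>A bit length for all cells: the exponents of powers of two bounding
  \<open>input_cap\<close>, \<open>input_lim\<close> and \<open>input_base\<close>, and 2 more for
  adding up three terms.\<close>

definition space_poly :: "nat poly" where
  "space_poly = [:2, 1:] * [:20, 3:] + [:8:] * [:3, 2:]\<^sup>2 + [:2:] * [:2, 1:]\<^sup>2 + [:2:]"

lemma poly_space_poly:
  "poly space_poly x = (x + 2) * (3 * x + 20) + 8 * (2 * x + 3)\<^sup>2 + 2 * (x + 2)\<^sup>2 + 2"
  by (simp add: space_poly_def algebra_simps)

lemma bits_sum_le: "bits (4 + sum_list xs) \<le> input_size xs + 3"
proof (rule bits_leI)
  have "4 + sum_list xs \<le> 4 * 2 ^ input_size xs" using sum_list_less[of xs] by simp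
  then show "4 + sum_list xs < 2 ^ (input_size xs + 3)" by (simp add: power_add)
qed

lemma input_lim_le: "input_lim xs \<le> 8 * (2 * input_size xs + 3)\<^sup>2"
  unfolding input_lim_def using bits_sum_le[of xs] length_le_input_size[of xs]
  by (intro mult_left_mono power_mono) auto

lemma input_cap_less:
  assumes "length xs = 2 * m + k + 4"
  shows "input_cap m xs + input_lim xs + input_base m k < 2 ^ poly space_poly (input_size xs)"
proof -
  let ?n = "input_size xs"
  let ?a = "(?n + 2) * (3 * ?n + 20)" and ?b = "8 * (2 * ?n + 3)\<^sup>2" and ?c = "2 * (?n + 2)\<^sup>2"
  have n: "m \<le> ?n" "k \<le> ?n" using assms length_le_input_size[of xs] by linarith+
  have "4 + sum_list xs \<le> 4 * 2 ^ ?n" using sum_list_less[of xs] by simp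
  also have "\<dots> = 2 ^ (?n + 2)" by (simp add: power_add)
  finally have "input_cap m xs \<le> (2 ^ (?n + 2)) ^ (3 * m + 20)"
    unfolding input_cap_def by (intro power_mono) auto
  also have "\<dots> \<le> 2 ^ ?a"
    unfolding power_mult[symmetric] using n by (intro power_increasing mult_left_mono) auto
  finally have 1: "input_cap m xs \<le> 2 ^ ?a" .
  have 2: "input_lim xs \<le> 2 ^ ?b" using input_lim_le[of xs] less_exp[of ?b] by linarith
  have "input_base m k \<le> 2 * ((?n + 2) * (?n + 2))"
    unfolding input_base_def using n by (intro mult_left_mono mult_mono) auto
  then have 3: "input_base m k \<le> 2 ^ ?c" using less_exp[of ?c] by (simp only: power2_eq_square)
  have "(2::nat) ^ ?a \<le> 2 ^ (?a + ?b + ?c)" "(2::nat) ^ ?b \<le> 2 ^ (?a + ?b + ?c)" "(2::nat) ^ ?c \<le> 2 ^ (?a + ?b + ?c)"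
    by (intro power_increasing; simp)+
  then have "input_cap m xs + input_lim xs + input_base m k \<le> 3 * 2 ^ (?a + ?b + ?c)" using 1 2 3 by linarith
  also have "3 * 2 ^ e < (2::nat) ^ (e + 2)" for e by (simp add: power_add)
  finally show ?thesis by (simp only: poly_space_poly)
qed

text \<open>The bit length of the cells enters twice: as the charge per operation and as the round
  bound of the loop that counts bits.\<close>

lemma algorithm_polynomial:
  obtains p :: "nat poly" where
    "\<And>m k xs r. length xs = 2 * m + k + 4 \<Longrightarrow> xs ! 0 = m \<Longrightarrow> xs ! 1 = k \<Longrightarrow>
      \<exists>t s' h. run algorithm (load xs, r) t (s', r) \<and> t \<le> poly p (input_size xs) \<and>
        (\<forall>i<length xs. h 0 i = xs ! i) \<and>
        (\<forall>i<k * (m + 1). s' i =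
          sem (input_cap m xs + input_lim xs + input_base m k) (input_lim xs) main_prog h 39 i)"
proof -
  obtain Kh eh where Kh: "\<And>lm. hcost lm 0 main_prog \<le> Kh * (lm + 1) ^ eh" using hcost_polynomial by metis
  define p where "p = space_poly *
    (([:pcost start_prog:] + ([:1, 1:] * [:pcost copy_body + ecost copy_guard:] + ([:pcost bits_start:] +
       ((space_poly + [:1:]) * [:pcost bits_body + ecost (reg 53):] + ([:pcost cap_start:] +
       ([:21, 3:] * [:pcost cap_body + ecost (reg 56):] + [:pcost cap_set:])))))) +
       ([:Kh:] * ([:8:] * [:3, 2:]\<^sup>2 + [:1:]) ^ eh +
       ([:pcost out_start:] + (([:0, 1:] * [:1, 1:] + [:1:]) * [:pcost out_body + ecost copy_guard:] + [:pcost out_end:]))))"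
  show thesis
  proof (rule that[of p])
    fix m k :: nat and xs r assume hyps: "length xs = 2 * m + k + 4" "xs ! 0 = m" "xs ! 1 = k"
    let ?L = "poly space_poly (input_size xs)" and ?n = "input_size xs"
    interpret input_layout m k xs ?L
      using hyps input_cap_less[OF hyps(1)] by unfold_locales (auto simp: poly_space_poly)
    have n: "m \<le> ?n" "k \<le> ?n" "length xs \<le> ?n" "m + 1 \<le> ?n + 1"
      using hyps length_le_input_size[of xs] by linarith+
    obtain t s' h where R: "run algorithm (load xs, r) t (s', r)" "\<And>i. i < length xs \<Longrightarrow> h 0 i = xs ! i"
      "\<And>i. i < k * (m + 1) \<Longrightarrow> s' i = sem cap lm main_prog h 39 i"
      "t \<le> ?L * ((pcost start_prog + ((length xs + 1) * (pcost copy_body + ecost copy_guard) + (pcost bits_start +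
       ((?L + 1) * (pcost bits_body + ecost (reg 53)) + (pcost cap_start +
       ((3 * m + 20 + 1) * (pcost cap_body + ecost (reg 56)) + pcost cap_set)))))) +
       (hcost lm 0 main_prog +
       (pcost out_start + ((k * (m + 1) + 1) * (pcost out_body + ecost copy_guard) + pcost out_end))))"
      using algorithm_run[of r] by metis
    note R(4)
    also have "?L * ((pcost start_prog + ((length xs + 1) * (pcost copy_body + ecost copy_guard) + (pcost bits_start +
       ((?L + 1) * (pcost bits_body + ecost (reg 53)) + (pcost cap_start +
       ((3 * m + 20 + 1) * (pcost cap_body + ecost (reg 56)) + pcost cap_set)))))) +
       (hcost lm 0 main_prog +
       (pcost out_start + ((k * (m + 1) + 1) * (pcost out_body + ecost copy_guard) + pcost out_end))))
     \<le> ?L * ((pcost start_prog + ((?n + 1) * (pcost copy_body + ecost copy_guard) + (pcost bits_start +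
       ((?L + 1) * (pcost bits_body + ecost (reg 53)) + (pcost cap_start +
       ((3 * ?n + 20 + 1) * (pcost cap_body + ecost (reg 56)) + pcost cap_set)))))) +
       (Kh * (8 * (2 * ?n + 3)\<^sup>2 + 1) ^ eh +
       (pcost out_start + ((?n * (?n + 1) + 1) * (pcost out_body + ecost copy_guard) + pcost out_end))))"
    proof (intro mult_left_mono add_mono mult_right_mono order_refl)
      have "(lm + 1) ^ eh \<le> (8 * (2 * ?n + 3)\<^sup>2 + 1) ^ eh"
        using input_lim_le[of xs] by (intro power_mono) auto
      then show "hcost lm 0 main_prog \<le> Kh * (8 * (2 * ?n + 3)\<^sup>2 + 1) ^ eh"
        using Kh[of lm] by (meson mult_left_mono order_trans zero_le)
      show "k * (m + 1) \<le> ?n * (?n + 1)" using n by (intro mult_mono) auto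
    qed (use n in auto)
    also have "\<dots> = poly p ?n"
      by (simp add: p_def poly_power) (simp add: algebra_simps)
    finally show "\<exists>t s' h. run algorithm (load xs, r) t (s', r) \<and> t \<le> poly p ?n \<and>
        (\<forall>i<length xs. h 0 i = xs ! i) \<and> (\<forall>i<k * (m + 1). s' i = sem cap lm main_prog h 39 i)"
      using R(1-3) by blast
  qed
qed


section \<open>The theorem\<close>

lemma encode_nth:
  fixes m :: nat and a \<sigma> :: "nat \<Rightarrow> nat" and ws :: "nat list"
  defines "xs \<equiv> encode_instance m a \<sigma> ws"
  shows "length xs = 2 * m + length ws + 4" "xs ! 0 = m" "xs ! 1 = length ws"
    "j \<le> m \<Longrightarrow> xs ! (j + 2) = a j" "i \<le> m \<Longrightarrow> xs ! (i + (m + 3)) = \<sigma> i"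
    "l < length ws \<Longrightarrow> xs ! (l + (2 * m + 4)) = ws ! l"
    "sum_list xs = m + length ws + (\<Sum>i<m + 1. a i) + (\<Sum>i<m + 1. \<sigma> i) + (\<Sum>l<length ws. ws ! l)"
proof -
  have xs: "xs = [m, length ws] @ map a [0..<m + 1] @ map \<sigma> [0..<m + 1] @ ws"
    by (simp add: xs_def encode_instance_def)
  show "length xs = 2 * m + length ws + 4" "xs ! 0 = m" "xs ! 1 = length ws" by (simp_all add: xs)
  show "xs ! (j + 2) = a j" if "j \<le> m" for j
    using that by (simp add: xs nth_append del: upt_Suc)
  show "xs ! (i + (m + 3)) = \<sigma> i" if "i \<le> m" for i
    using that by (simp add: xs nth_append nth_Cons' del: upt_Suc)
  show "xs ! (l + (2 * m + 4)) = ws ! l" if "l < length ws" for l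
    using that by (simp add: xs nth_append nth_Cons' del: upt_Suc)
  have s: "sum_list (map f [0..<m + 1]) = (\<Sum>i<m + 1. f i)" for f :: "nat \<Rightarrow> nat"
    by (simp add: interv_sum_list_conv_sum_set_nat atLeast0LessThan del: upt_Suc)
  have "sum_list ws = (\<Sum>l<length ws. ws ! l)" by (simp add: sum_list_sum_nth atLeast0LessThan)
  then show "sum_list xs = m + length ws + (\<Sum>i<m + 1. a i) + (\<Sum>i<m + 1. \<sigma> i) + (\<Sum>l<length ws. ws ! l)"
    using s[of a] s[of \<sigma>] by (simp add: xs del: upt_Suc)
qed

lemma election_instance:
  fixes m :: nat and a \<sigma> :: "nat \<Rightarrow> nat" and ws :: "nat list"
  defines "xs \<equiv> encode_instance m a \<sigma> ws"
  assumes "m \<ge> 1" "mono_on {0..m} a" "\<forall>w\<in>set ws. w > 0"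
  shows "election m (length ws) a \<sigma> (\<lambda>l. ws ! l) (4 + sum_list xs)
    (input_cap m xs + input_lim xs + input_base m (length ws)) (input_lim xs)"
proof
  let ?k = "length ws"
  define V where "V = 4 + sum_list xs"
  define z where "z = length xs + bits V"
  note enc = encode_nth[where m = m and a = a and \<sigma> = \<sigma> and ws = ws, folded xs_def]
  have am: "a m \<le> (\<Sum>i<m + 1. a i)" by (intro member_le_sum) auto
  show "m + 2 \<le> 4 + sum_list xs" "?k + 2 \<le> 4 + sum_list xs" "a m + 2 \<le> 4 + sum_list xs"
    "(\<Sum>l<?k. ws ! l) + 2 \<le> 4 + sum_list xs" "(\<Sum>i<m + 1. \<sigma> i) + 2 \<le> 4 + sum_list xs"
    using am unfolding enc(7) by linarith+
  have z: "2 * m + ?k + 4 \<le> z" using enc(1) by (simp add: z_def)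
  have lim: "input_lim xs = 8 * (z * z)" by (simp add: input_lim_def z_def V_def power2_eq_square)
  have zz: "x * y \<le> z * z" if "x \<le> 2 * m + ?k + 4" "y \<le> 2 * m + ?k + 4" for x y
    using that z by (intro mult_mono) auto
  define y where "y = z * z"
  have "(2 * m + ?k + 4) * 2 \<le> y" "?k * 1 \<le> y" "?k * m \<le> y" "1 * 1 \<le> y" "m * m \<le> y"
    "(m + 1) * ?k \<le> y" unfolding y_def by (rule zz; simp)+
  moreover have "input_lim xs = 8 * y" by (simp add: lim y_def)
  ultimately show "3 * m + 3 \<le> input_lim xs" "?k \<le> input_lim xs" "?k * m + 1 \<le> input_lim xs"
    "4 * (m * m) + 1 \<le> input_lim xs" "(m + 1) * ?k \<le> input_lim xs" by simp_all
  have "V ^ 5 < (2 ^ bits V) ^ 5" using less_two_power_bits by (intro power_strict_mono) auto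
  also have "\<dots> = 2 ^ (bits V * 5)" by (simp add: power_mult)
  also have "\<dots> \<le> 2 ^ input_lim xs"
  proof (intro power_increasing)
    have "z * 1 \<le> z * z" using z by (intro mult_left_mono) auto
    moreover have "bits V \<le> z" by (simp add: z_def)
    ultimately show "bits V * 5 \<le> input_lim xs" unfolding lim by linarith
  qed simp
  finally show "(4 + sum_list xs) ^ 5 < 2 ^ input_lim xs" by (simp add: V_def)
  show "(4 + sum_list xs) ^ (3 * m + 20) \<le> input_cap m xs + input_lim xs + input_base m ?k"
    by (simp add: input_cap_def)
qed (use assms in auto)

lemma gap_step:
  assumes "j + b \<le> m" "a j \<le> a (j + b)"
  shows "a (j + b) \<le> a j + nat (gap m a b)"
proof -
  have "\<bar>int (a (j + b)) - int (a j)\<bar> \<le> gap m a b"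
    unfolding gap_def using assms(1) by (intro Max_ge) auto
  then show ?thesis using assms(2) by linarith
qed

lemma gap_nonneg: "gap m a b \<ge> 0"
proof -
  have "\<bar>int (a (0 + b)) - int (a 0)\<bar> \<le> gap m a b"
    unfolding gap_def by (rule Max_ge, simp, rule image_eqI[of _ _ 0], simp_all)
  then show ?thesis by linarith
qed

lemma (in election) position_load:
  assumes gM: "good_rate M"
    and C0: "\<And>l. l < k \<Longrightarrow> C 0 l = m + 1" and C: "\<And>i l. i \<in> {1..m} \<Longrightarrow> l < k \<Longrightarrow> C i l \<le> m"
    and Psi: "search.Psi m k M (pweight m k w) C \<le> search.target m k M (pweight m k w)"
    and b: "beta 30 m \<le> m" and i: "i \<in> {1..m}"
  shows "(\<Sum>l<k. w l * a (position m (favourite m k w l) (\<lambda>i. C i l) i))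
    \<le> (\<Sum>l<k. w l * a (C i l)) + nat (gap m a (beta 30 m)) * (\<Sum>l<k. w l)"
proof (cases "m = 1")
  \<comment> \<open>The logarithm vanishes and \<open>beta\<close> is 0, but every manipulator
    favours the only candidate, which keeps its configured positions exactly.\<close>
  case True
  then have "favourite m k w l = i" for l using i by (simp add: favourite_def)
  then show ?thesis by (simp add: position_def)
next
  case False
  then have m2: "m \<ge> 2" using m by simp
  let ?b = "beta 30 m"
  interpret search m k M "pweight m k w" using m gM by unfold_locales (auto simp: good_rate_def)
  have "30 * sqrt (real m * ln (real m)) > 0" using m2 by simp
  then have rb: "30 * sqrt (real m * ln (real m)) \<le> real ?b" and b1: "1 \<le> ?b"
    unfolding beta_def by linarith+
  obtain L where L: "m < 2 ^ L" "2 ^ L \<le> 2 * m" "M\<^sup>2 * L \<le> m" "m < (M + 1)\<^sup>2 * L" and M1: "M \<ge> 1"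
    using gM unfolding good_rate_def by blast
  have num: "2 * (m + 1) ^ 4 * pw m M (m + 4 + m div M) \<le> pw m M (m + 1 + ?b)"
    using numeric_bound[OF m2 L(1,2) M1 L(3,4) b rb] .
  define Fl where "Fl = {l. l < k \<and> (\<exists>t\<le>m. t + 1 + ?b \<le> used C l t)}"
  have light: "m * (\<Sum>l\<in>Fl. w l) \<le> (\<Sum>l | l < k \<and> favourite m k w l = i. w l)"
    unfolding Fl_def by (rule failure_weight[OF m M1 w Psi b num i])
  show ?thesis
  proof (rule score_bound[where m = m and a = a and i = i and b = ?b and g = "nat (gap m a ?b)" and k = k
        and C = C and fav = "favourite m k w" and Fl = Fl and w = w])
    show "a (j + ?b) \<le> a j + nat (gap m a ?b)" if "j + ?b \<le> m" for j
      using gap_step[OF that, of a] a_le[of j "j + ?b"] that by simp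
    show "favourite m k w l \<in> {1..m}" for l by (rule favourite_range[OF m])
    then show "C (favourite m k w l) l \<le> m" if "l < k" for l using C that by blast
    show "(\<Sum>i'\<in>{1..m}. of_bool (C i' l \<le> C i l)) \<le> C i l + ?b" if "l < k" "l \<notin> Fl" for l
    proof -
      have "\<not> C i l + 1 + ?b \<le> used C l (C i l)" using that C[OF i that(1)] by (auto simp: Fl_def)
      then show ?thesis by (simp add: used_def)
    qed
    show "Fl \<subseteq> {..<k}" by (auto simp: Fl_def)
  qed (use mono i b1 b C0 C light in simp_all)
qed

lemma T_opt_attained:
  obtains S where "strategy m (length ws) S" "max_score m a \<sigma> ws S = T_opt m a \<sigma> ws"
proof -
  have "strategy m (length ws) (\<lambda>_ i. i)" by (simp add: strategy_def bij_betw_def)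
  then have "max_score m a \<sigma> ws ` {S. strategy m (length ws) S} \<noteq> {}" by blast
  then have "T_opt m a \<sigma> ws \<in> max_score m a \<sigma> ws ` {S. strategy m (length ws) S}"
    unfolding T_opt_def by (rule Inf_nat_def1)
  then show thesis using that by auto
qed

theorem theorem2:
  fixes \<alpha> :: "nat \<Rightarrow> nat \<Rightarrow> nat"
  assumes "\<And>m. mono_on {0..m} (\<alpha> m)"
    and "\<exists>q :: nat poly. \<forall>m. \<alpha> m m \<le> poly q m"
  shows "\<exists>d :: real. d > 0 \<and>
    (\<exists>(A :: prog) (p :: nat poly) (c :: real). c > 0 \<and>
      (\<forall>(m :: nat) (\<sigma> :: nat \<Rightarrow> nat) (ws :: nat list).
        m \<ge> 1 \<longrightarrow> (\<forall>w \<in> set ws. w > 0) \<longrightarrow>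
        (let xs = encode_instance m (\<alpha> m) \<sigma> ws;
             N = poly p (input_size xs)
         in halts_within A xs N \<and>
            (beta d m \<le> m \<longrightarrow>
               failure_prob A xs N
                 (\<lambda>s. let S = decode_strategy m s in
                    strategy m (length ws) S \<and>
                    int (max_score m (\<alpha> m) \<sigma> ws S)
                      \<le> int (T_opt m (\<alpha> m) \<sigma> ws)
                        + int (sum_list ws) * gap m (\<alpha> m) (beta d m))
               \<le> exp (- c * real m)))))"
proof -
  obtain p :: "nat poly" where p: "\<And>m k xs r. length xs = 2 * m + k + 4 \<Longrightarrow> xs ! 0 = m \<Longrightarrow> xs ! 1 = k \<Longrightarrow>
      \<exists>t s' h. run algorithm (load xs, r) t (s', r) \<and> t \<le> poly p (input_size xs) \<and>
        (\<forall>i<length xs. h 0 i = xs ! i) \<and>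
        (\<forall>i<k * (m + 1). s' i =
          sem (input_cap m xs + input_lim xs + input_base m k) (input_lim xs) main_prog h 39 i)"
    using algorithm_polynomial by metis
  have main: "halts_within algorithm xs (poly p (input_size xs)) \<and>
      (beta 30 m \<le> m \<longrightarrow> failure_prob algorithm xs (poly p (input_size xs))
         (\<lambda>s. let S = decode_strategy m s in strategy m (length ws) S \<and>
            int (max_score m (\<alpha> m) \<sigma> ws S)
              \<le> int (T_opt m (\<alpha> m) \<sigma> ws) + int (sum_list ws) * gap m (\<alpha> m) (beta 30 m))
       \<le> exp (- 1 * real m))"
    if m: "m \<ge> 1" and ws: "\<forall>w\<in>set ws. w > 0" and xs_def: "xs = encode_instance m (\<alpha> m) \<sigma> ws"
    for m \<sigma> ws xs
  proof -
    let ?k = "length ws" and ?a = "\<alpha> m" and ?w = "\<lambda>l. ws ! l"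
    define cap where "cap = input_cap m xs + input_lim xs + input_base m ?k"
    note enc = encode_nth[where m = m and a = ?a and \<sigma> = \<sigma> and ws = ws, folded xs_def]
    note run = p[OF enc(1-3), folded cap_def]
    interpret election m ?k ?a \<sigma> ?w "4 + sum_list xs" cap "input_lim xs"
      using election_instance[OF m assms(1) ws, of \<sigma>] unfolding cap_def xs_def .
    have "halts_within algorithm xs (poly p (input_size xs))"
      unfolding halts_within_def using run by blast
    moreover have "failure_prob algorithm xs (poly p (input_size xs))
         (\<lambda>s. let S = decode_strategy m s in strategy m ?k S \<and>
            int (max_score m ?a \<sigma> ws S) \<le> int (T_opt m ?a \<sigma> ws) + int (sum_list ws) * gap m ?a (beta 30 m)) = 0"
      if b: "beta 30 m \<le> m"
    proof -
      define \<tau> where "\<tau> = T_opt m ?a \<sigma> ws"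
      obtain S where S: "strategy m ?k S" "max_score m ?a \<sigma> ws S = \<tau>"
        using T_opt_attained[where m = m and ws = ws and a = ?a and \<sigma> = \<sigma>] by (auto simp: \<tau>_def)
      have Sm: "S l i \<le> m" if "l < ?k" "i \<le> m" for l i
        using S(1) that unfolding strategy_def bij_betw_def by fastforce
      have score_le: "score ?a \<sigma> ws S i \<le> \<tau>" if "i \<in> {1..m}" for i
        unfolding S(2)[symmetric] max_score_def using that by (intro Max_ge) auto
      have score_eq: "score ?a \<sigma> ws S' i = \<sigma> i + (\<Sum>l<?k. ?w l * ?a (S' l i))" for S' i
        by (simp add: score_def)
      have used: "(\<Sum>i\<in>{1..m}. of_bool (S l i \<le> t)) \<le> t + 1" if "l < ?k" for l t
      proof -
        have inj: "inj_on (S l) {0..m}" using S(1) that by (simp add: strategy_def bij_betw_def)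
        have "(\<Sum>i\<in>{1..m}. of_bool (S l i \<le> t)) = card {i \<in> {1..m}. S l i \<le> t}"
          by (rule sum_of_bool_eq_card) simp
        also have "\<dots> \<le> card {0..t}"
          by (rule card_inj_on_le[of "S l"]) (auto intro: inj_on_subset[OF inj])
        finally show ?thesis by simp
      qed
      have \<tau>_le: "\<tau> \<le> (\<Sum>i<m + 1. \<sigma> i) + (\<Sum>l<?k. ?w l) * ?a m"
        unfolding S(2)[symmetric] max_score_def
      proof (subst Max_le_iff; safe?)
        fix i assume i: "i \<in> {1..m}"
        have "(\<Sum>l<?k. ?w l * ?a (S l i)) \<le> (\<Sum>l<?k. ?w l * ?a m)"
          using Sm i by (intro sum_mono mult_left_mono a_le) auto
        also have "\<dots> = (\<Sum>l<?k. ?w l) * ?a m" by (rule sum_distrib_right[symmetric])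
        finally show "score ?a \<sigma> ws S i \<le> (\<Sum>i<m + 1. \<sigma> i) + (\<Sum>l<?k. ?w l) * ?a m"
          unfolding score_eq using sigma_le[of i] i by (intro add_mono) auto
      qed (use m in auto)
      have good: "\<exists>t s r'. run algorithm (load xs, r) t (s, r') \<and>
          (let S = decode_strategy m s in strategy m ?k S \<and>
            int (max_score m ?a \<sigma> ws S) \<le> int \<tau> + int (sum_list ws) * gap m ?a (beta 30 m))" for r
      proof -
        obtain t s h where R: "run algorithm (load xs, r) t (s, r)" "\<forall>i<length xs. h 0 i = xs ! i"
            "\<forall>i<?k * (m + 1). s i = sem cap (input_lim xs) main_prog h 39 i"
          using run by blast
        have inp: "inp h"
          unfolding inp_def using R(2) enc by (auto simp del: One_nat_def)
        have "\<exists>M C. good_rate M \<and> (\<forall>l<?k. C 0 l = m + 1) \<and>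
            (\<forall>i\<in>{1..m}. (\<forall>l<?k. C i l \<le> m) \<and> \<sigma> i + (\<Sum>l<?k. ?w l * ?a (C i l)) \<le> \<tau>) \<and>
            search.Psi m ?k M (pweight m ?k ?w) C \<le> search.target m ?k M (pweight m ?k ?w) \<and>
            (\<forall>l<?k. \<forall>i\<le>m. sem cap (input_lim xs) main_prog h 39 (l * (m + 1) + i) =
               position m (favourite m ?k ?w l) (\<lambda>i. C i l) i)"
        proof (rule sem_main_prog[OF inp, where D = "\<lambda>i l. S l i"])
          show "\<sigma> i + (\<Sum>l<?k. ?w l * ?a (S l i)) \<le> \<tau>" if "i \<in> {1..m}" for i
            using score_le[OF that] unfolding score_eq .
        qed (use Sm used \<tau>_le in simp_all)
        then obtain M C where MC: "good_rate M" "\<forall>l<?k. C 0 l = m + 1"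
          "\<forall>i\<in>{1..m}. (\<forall>l<?k. C i l \<le> m) \<and> \<sigma> i + (\<Sum>l<?k. ?w l * ?a (C i l)) \<le> \<tau>"
          "search.Psi m ?k M (pweight m ?k ?w) C \<le> search.target m ?k M (pweight m ?k ?w)"
          "\<forall>l<?k. \<forall>i\<le>m. sem cap (input_lim xs) main_prog h 39 (l * (m + 1) + i) =
             position m (favourite m ?k ?w l) (\<lambda>i. C i l) i"
          by (elim exE conjE) (rule that)
        have C: "C 0 l = m + 1" "i \<in> {1..m} \<Longrightarrow> C i l \<le> m" if "l < ?k" for i l
          using MC(2,3) that by blast+
        have load: "\<sigma> i + (\<Sum>l<?k. ?w l * ?a (C i l)) \<le> \<tau>" if "i \<in> {1..m}" for i
          using MC(3) that by blast
        let ?S = "decode_strategy m s"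
        have pos: "?S l i = position m (favourite m ?k ?w l) (\<lambda>i. C i l) i" if "l < ?k" "i \<le> m" for l i
        proof -
          have "l * (m + 1) + i < ?k * (m + 1)" using mult_add_less[of l ?k i "m + 1" 0] that by simp
          then show ?thesis using R(3) MC(5) that by (simp add: decode_strategy_def)
        qed
        have "strategy m ?k ?S" unfolding strategy_def
        proof (intro allI impI)
          fix l assume l: "l < ?k"
          have f: "favourite m ?k ?w l \<in> {1..m}" by (rule favourite_range[OF m])
          then have "bij_betw (position m (favourite m ?k ?w l) (\<lambda>i. C i l)) {0..m} {0..m}"
            using C(2)[OF l f] f by (intro position_bij) auto
          then show "bij_betw (?S l) {0..m} {0..m}"
            using pos[OF l] by (subst bij_betw_cong) auto
        qed
        moreover have "max_score m ?a \<sigma> ws ?S \<le> \<tau> + nat (gap m ?a (beta 30 m)) * (\<Sum>l<?k. ?w l)"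
          unfolding max_score_def
        proof (subst Max_le_iff; safe?)
          fix i assume i: "i \<in> {1..m}"
          have "score ?a \<sigma> ws ?S i = \<sigma> i + (\<Sum>l<?k. ?w l * ?a (position m (favourite m ?k ?w l) (\<lambda>i. C i l) i))"
            unfolding score_eq using pos i by (intro arg_cong2[of _ _ _ _ "(+)"] sum.cong) auto
          also have "\<dots> \<le> \<sigma> i + ((\<Sum>l<?k. ?w l * ?a (C i l)) + nat (gap m ?a (beta 30 m)) * (\<Sum>l<?k. ?w l))"
            using position_load[OF MC(1) C(1) C(2) MC(4) b i] by simp
          also have "\<dots> \<le> \<tau> + nat (gap m ?a (beta 30 m)) * (\<Sum>l<?k. ?w l)" using load[OF i] by simp
          finally show "score ?a \<sigma> ws ?S i \<le> \<dots>" .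
        qed (use m in auto)
        moreover have "(\<Sum>l<?k. ?w l) = sum_list ws" by (simp add: sum_list_sum_nth atLeast0LessThan)
        ultimately have "int (max_score m ?a \<sigma> ws ?S) \<le> int (\<tau> + nat (gap m ?a (beta 30 m)) * sum_list ws)"
          by (simp only: of_nat_le_iff)
        also have "\<dots> = int \<tau> + int (sum_list ws) * gap m ?a (beta 30 m)"
          using gap_nonneg[of m ?a "beta 30 m"] by (simp add: mult.commute)
        finally show ?thesis using R(1) \<open>strategy m ?k ?S\<close> unfolding Let_def by blast
      qed
      \<comment> \<open>A good run exists for every tape, so the event of failure is empty.\<close>
      then show ?thesis unfolding failure_prob_def \<tau>_def by simp
    qed
    ultimately show ?thesis by simp
  qed
  \<comment> \<open>The failure probability is 0, so any positive \<open>c\<close> would do; 30 is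
    the constant for which \<open>numeric_bound\<close> leaves enough positions.\<close>
  show ?thesis
    by (rule exI[of _ 30], intro conjI exI[of _ algorithm] exI[of _ p] exI[of _ "1 :: real"] allI impI)
      (use main in \<open>auto simp: Let_def\<close>)
qed

end
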